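(* Let $\phi\in\mathcal B$. (1) $W_\phi\in\mathtt A_{(\overline{\mathfrak a}_\phi,\infty)}\cap\mathtt M_{(\mathfrak a_\phi,\infty)}$ and $W_\phi$ is zero-free on $\mathbb C_{(\mathfrak a_\phi,\infty)}$. If $\phi(0)>0$ then $W_\phi\in\mathtt A_{[0,\infty)}$ and $W_\phi$ is zero-free on $\mathbb C_{[0,\infty)}$. If $\phi(0)=0$ (resp. $\phi(0)=0$ and $\phi'(0^+)<\infty$) then $W_\phi$ (resp. $z\mapsto zW_\phi(z)$) extends continuously to $i\mathbb R\setminus\mathcal Z_0(\phi)$ (resp. $(i\mathbb R\setminus\mathcal Z_0(\phi))\cup\{0\}$), and if $\mathfrak z\in\mathcal Z_0(\phi)$ then $\lim_{\Re(z)\ge0,\,z\to\mathfrak z}\phi(z)W_\phi(z)=W_\phi(\mathfrak z+1)$. Finally, if $\phi(0)=0$ and $|\phi''(0^+)|<\infty$, then $W_\phi(z)-\frac1{\phi'(0^+)z}$ extends continuously to $(i\mathbb R\setminus\mathcal Z_0(\phi))\cup\{0\}$. (2) There exists $\mathfrak z\in\mathcal Z_0(\phi)$ with $\mathfrak z\ne0$ if and only if $\phi(0)=\mathtt d=0$ and $\mu=\sum_{n=0}^\infty c_n\delta_{hk_n}$ with $\sum_{n=1}^\infty c_n<\infty$, $h>0$, $k_n\in\mathbb N$ and $c_n\ge0$ for all $n\in\mathbb N$. In this case the mappings $z\mapsto e^{-z\ln\phi(\infty)}W_\phi(z)$ and $z\mapsto|W_\phi(z)|$ are periodic with period $\frac{2\pi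 i}h$ on $\mathbb C_{(0,\infty)}$. (3) Assume that $\mathfrak u_\phi\in(-\infty,0)$, $\mathcal Z_{\mathfrak u_\phi}(\phi)=\{\mathfrak u_\phi\}$ and $|\phi''(\mathfrak u_\phi^+)|<\infty$, the latter being always true if $\mathfrak u_\phi>\mathfrak a_\phi$. Then $$z\mapsto W_\phi(z)-\frac{W_\phi(1+\mathfrak u_\phi)}{\phi'(\mathfrak u_\phi^+)(z-\mathfrak u_\phi)}\in\mathtt A_{[\mathfrak u_\phi,\infty)},$$ and $\phi'(\mathfrak u_\phi^+)=\mathtt d+\int_0^\infty ye^{-\mathfrak u_\phi y}\mu(dy)\in(0,\infty)$. (4) Assume that $\mathfrak a_\phi<\mathfrak u_\phi\le0$ and put $N=\max\{n\in\mathbb N:\mathfrak u_\phi-n>\mathfrak a_\phi\}\in\mathbb N\cup\{\infty\}$. Then there exists an open set $\mathcal O\subset\mathbb C$ such that $[\mathfrak u_\phi-N,1]\subset\mathcal O$ if $N<\infty$, and $(-\infty,1]\subset\mathcal O$ if $N=\infty$, and $W_\phi$ is meromorphic on $\mathcal O$ with simple poles at $\{\mathfrak u_\phi-k\}_{0\le k<N+1}$ and residues $\mathfrak R_k=\frac{W_\phi(1+\mathfrak u_\phi)}{\phi'(\mathfrak u_\phi)\prod_{j=1}^k\phi(\mathfrak u_\phi-j)}$, $0\le k<N+1$, with the convention $\prod_1^0=1$. (5) For $c>0$, $W_{c\phi}(z)=c^{z-1}W_\phi(z)$.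
   Context: $\mathbb N=\{0,1,2,\dots\}$. $\mathbb C_{(a,b)}=\{a<\Re z<b\}$, $\mathbb C_{[0,\infty)}=\{\Re z\ge0\}$, $\mathbb C_a=\{\Re z=a\}$. $\mathtt A_{(a,b)}$, $\mathtt M_{(a,b)}$: holomorphic, resp. meromorphic, functions on $\mathbb C_{(a,b)}$; $\mathtt A_{[a,b)}$: functions in $\mathtt A_{(a,b)}$ extending continuously to $\mathbb C_a$. $f(x^+)$ is the right limit. $\mathcal B$: Bernstein functions $\phi\not\equiv0$, $\phi(z)=\phi(0)+\mathtt dz+\int_0^\infty(1-e^{-zy})\mu(dy)$, $\Re z\ge0$, with $\phi(0)\ge0$, $\mathtt d\ge0$, $\mu$ a measure on $(0,\infty)$ with $\int_0^\infty(1\wedge y)\mu(dy)<\infty$; $\phi(\infty)=\lim_{u\to\infty}\phi(u)$. $\mathfrak a_\phi=\inf\{u<0:\phi\in\mathtt A_{(u,\infty)}\}$, $\mathfrak u_\phi=\sup\{u\in[\mathfrak a_\phi,0]:\phi(u)=0\}$, $\overline{\mathfrak a}_\phi=\max\{\mathfrak a_\phi,\mathfrak u_\phi\}$ ($\inf\emptyset=0$, $\sup\emptyset=-\infty$). $\mathcal Z_a(\phi)=\{z\in\mathbb C_a:\phi(z)=0\}$. Bernstein-gamma function: $W_\phi(z)=\frac{e^{-\gamma_\phi z}}{\phi(z)}\prod_{k=1}^\infty\frac{\phi(k)}{\phi(k+z)}e^{\frac{\phi'(k)}{\phi(k)}z}$, $\Re z>0$ (absolutely convergent), with $\gamma_\phi=\lim_{n\to\infty}\big(\sum_{k=1}^n\frac{\phi'(k)}{\phi(k)}-\ln\phi(n)\big)$;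 it satisfies $W_\phi(1)=1$ and $W_\phi(z+1)=\phi(z)W_\phi(z)$, and $W_\phi$ also denotes its extension to the left through this recurrence. *)

theory Defs
  imports "HOL-Complex_Analysis.Complex_Analysis"
begin

text \<open>
  A Bernstein function is a function on the closed right half-plane; its values elsewhere are
  never used. The number \<open>\<phi>(0)\<close> is read off from \<open>\<phi>\<close> itself, so only the drift \<open>d\<close> and the
  measure \<open>\<mu>\<close> on \<open>(0,\<infinity>)\<close> are separate data.
\<close>

definition bernstein :: "(complex \<Rightarrow> complex) \<Rightarrow> real \<Rightarrow> real measure \<Rightarrow> bool" where
  "bernstein \<phi> d \<mu> \<longleftrightarrow>
     \<phi> 0 \<in> \<real> \<and> 0 \<le> Re (\<phi> 0) \<and> 0 \<le> d \<and>
     sets \<mu> = sets (restrict_space borel {0<..}) \<and>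
     (\<integral>\<^sup>+ y. ennreal (min 1 y) \<partial>\<mu>) < \<infinity> \<and>
     (\<forall>z. 0 \<le> Re z \<longrightarrow>
        \<phi> z = \<phi> 0 + of_real d * z + (\<integral>y. (1 - exp (- z * of_real y)) \<partial>\<mu>)) \<and>
     (\<exists>z. 0 \<le> Re z \<and> \<phi> z \<noteq> 0)"

definition halfplane :: "ereal \<Rightarrow> complex set" where
  "halfplane a = {z. a < ereal (Re z)}"

definition vline :: "real \<Rightarrow> complex set" where
  "vline a = {z. Re z = a}"

definition extends_continuously :: "(complex \<Rightarrow> complex) \<Rightarrow> complex set \<Rightarrow> complex set \<Rightarrow> bool" where
  "extends_continuously f S B \<longleftrightarrow> (\<exists>g. continuous_on (S \<union> B) g \<and> (\<forall>z\<in>S. g z = f z))"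

text \<open>The class \<open>A\<^bsub>[a,\<infinity>)\<^esub>\<close>.\<close>

definition holo_cont_ext :: "(complex \<Rightarrow> complex) \<Rightarrow> real \<Rightarrow> bool" where
  "holo_cont_ext f a \<longleftrightarrow>
     f holomorphic_on halfplane a \<and> extends_continuously f (halfplane a) (vline a)"

text \<open>The right limit \<open>f(x+)\<close> along the real axis, for \<open>f\<close> real on the real axis.\<close>

definition right_lim :: "(complex \<Rightarrow> complex) \<Rightarrow> real \<Rightarrow> ereal" where
  "right_lim f x = Lim (at_right x) (\<lambda>u. ereal (Re (f (of_real u))))"

definition phi_infinity :: "(complex \<Rightarrow> complex) \<Rightarrow> ereal" where
  "phi_infinity \<phi> = Lim at_top (\<lambda>u. ereal (Re (\<phi> (of_real u))))"

definition holo_extension :: "(complex \<Rightarrow> complex) \<Rightarrow> ereal \<Rightarrow> (complex \<Rightarrow> complex) \<Rightarrow> bool" where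
  "holo_extension \<phi> a g \<longleftrightarrow> g holomorphic_on halfplane a \<and> (\<forall>z. 0 \<le> Re z \<longrightarrow> g z = \<phi> z)"

text \<open>Inserting \<open>0\<close> into the set of negative numbers implements \<open>inf \<emptyset> = 0\<close>.\<close>

definition bf_a :: "(complex \<Rightarrow> complex) \<Rightarrow> ereal" where
  "bf_a \<phi> = Inf (insert 0 {ereal u |u. u < 0 \<and> (\<exists>g. holo_extension \<phi> u g)})"

text \<open>
  The analytic continuation of \<open>\<phi>\<close>, uniquely determined on
  \<open>halfplane (bf_a \<phi>) \<union> {z. 0 \<le> Re z}\<close>.
\<close>

definition bf_cont :: "(complex \<Rightarrow> complex) \<Rightarrow> complex \<Rightarrow> complex" where
  "bf_cont \<phi> = (SOME g. holo_extension \<phi> (bf_a \<phi>) g)"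

text \<open>
  On the boundary line \<open>Re z = bf_a \<phi> < 0\<close> the function \<open>\<phi>\<close> is given by its limit from within the
  half-plane, and is undefined where this limit does not exist; \<open>bf_dom \<phi>\<close> collects the
  points where \<open>\<phi>\<close> is defined.
\<close>

definition bf_ext :: "(complex \<Rightarrow> complex) \<Rightarrow> complex \<Rightarrow> complex" where
  "bf_ext \<phi> z =
     (if bf_a \<phi> < ereal (Re z) \<or> 0 \<le> Re z then bf_cont \<phi> z
      else Lim (at z within halfplane (bf_a \<phi>)) (bf_cont \<phi>))"

definition bf_dom :: "(complex \<Rightarrow> complex) \<Rightarrow> complex set" where
  "bf_dom \<phi> =
     {z. bf_a \<phi> < ereal (Re z) \<or> 0 \<le> Re z \<or>
         bf_a \<phi> = ereal (Re z) \<and> (\<exists>w. (bf_cont \<phi> \<longlongrightarrow> w) (at z within halfplane (bf_a \<phi>)))}"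

definition bf_zeros :: "real \<Rightarrow> (complex \<Rightarrow> complex) \<Rightarrow> complex set" where
  "bf_zeros a \<phi> = {z \<in> vline a \<inter> bf_dom \<phi>. bf_ext \<phi> z = 0}"

definition bf_u :: "(complex \<Rightarrow> complex) \<Rightarrow> ereal" where
  "bf_u \<phi> = Sup {ereal u |u. bf_a \<phi> \<le> ereal u \<and> u \<le> 0 \<and>
                             of_real u \<in> bf_dom \<phi> \<and> bf_ext \<phi> (of_real u) = 0}"

definition bf_abar :: "(complex \<Rightarrow> complex) \<Rightarrow> ereal" where
  "bf_abar \<phi> = max (bf_a \<phi>) (bf_u \<phi>)"

definition bf_gamma :: "(complex \<Rightarrow> complex) \<Rightarrow> real" where
  "bf_gamma \<phi> =
     lim (\<lambda>n. (\<Sum>k=1..n. Re (deriv \<phi> (of_nat k) / \<phi> (of_nat k))) - ln (Re (\<phi> (of_nat n))))"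

definition W_prod :: "(complex \<Rightarrow> complex) \<Rightarrow> complex \<Rightarrow> complex" where
  "W_prod \<phi> z =
     exp (- of_real (bf_gamma \<phi>) * z) / \<phi> z *
     (\<Prod>k. \<phi> (of_nat (Suc k)) / \<phi> (of_nat (Suc k) + z) *
           exp (deriv \<phi> (of_nat (Suc k)) / \<phi> (of_nat (Suc k)) * z))"

text \<open>
  To the left of the imaginary axis (and on it) \<open>W\<close> is given by the recurrence
  \<open>W(z + 1) = \<phi>(z) W(z)\<close>. As division by zero yields zero, \<open>W\<close> has the value \<open>0\<close> where \<open>\<phi>(z + j) = 0\<close>
  for some \<open>j\<close>; zero-freeness is therefore a statement about points which are not poles. Values with
  \<open>Re z < 0\<close> and \<open>Re z \<le> bf_a \<phi>\<close> are meaningless.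
\<close>

function W :: "(complex \<Rightarrow> complex) \<Rightarrow> complex \<Rightarrow> complex" where
  "W \<phi> z = (if 0 < Re z then W_prod \<phi> z else W \<phi> (z + 1) / bf_ext \<phi> z)"
  by auto
termination
proof (relation "Wellfounded.measure (\<lambda>(\<phi>, z). nat (\<lfloor>1 - Re z\<rfloor>))")
  fix \<phi> :: "complex \<Rightarrow> complex" and z :: complex
  assume "\<not> 0 < Re z"
  then have "\<lfloor>1 - Re z\<rfloor> \<ge> 1" by linarith
  moreover have "\<lfloor>1 - Re (z + 1)\<rfloor> = \<lfloor>1 - Re z\<rfloor> - 1"
    by simp linarith
  ultimately show "((\<phi>, z + 1), (\<phi>, z)) \<in> Wellfounded.measure (\<lambda>(\<phi>, z). nat (\<lfloor>1 - Re z\<rfloor>))"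
    by simp
qed simp

declare W.simps [simp del]

text \<open>
  \<open>\<mu> = \<Sum>\<^sub>n c\<^sub>n \<delta>\<^bsub>h k\<^sub>n\<^esub>\<close> as measures on \<open>(0,\<infinity>)\<close>; terms with \<open>k\<^sub>n = 0\<close> do not contribute.
\<close>

definition lattice_measure :: "real measure \<Rightarrow> real \<Rightarrow> (nat \<Rightarrow> real) \<Rightarrow> (nat \<Rightarrow> nat) \<Rightarrow> bool" where
  "lattice_measure \<mu> h c k \<longleftrightarrow>
     0 < h \<and> (\<forall>n. 0 \<le> c n) \<and> summable (\<lambda>n. c (Suc n)) \<and>
     (\<forall>A\<in>sets \<mu>. emeasure \<mu> A = (\<Sum>n. ennreal (c n) * indicator A (h * real (k n))))"

text \<open>
  \<open>N = max {n. u - n > bf_a \<phi>}\<close>: the set is an initial segment of the naturals, so the supremum is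
  its maximum if it is finite and \<open>\<infinity>\<close> otherwise.
\<close>

definition bf_N :: "(complex \<Rightarrow> complex) \<Rightarrow> enat" where
  "bf_N \<phi> = Sup {enat n |n. bf_a \<phi> < bf_u \<phi> - ereal (real n)}"

end

theory Submission
  imports Defs
begin

text \<open>
  The function \<open>\<Phi>(z) = \<phi>(0) + dz + \<integral>(1 - e\<^sup>-\<^sup>z\<^sup>y) \<mu>(dy)\<close> extends \<open>\<phi>\<close> to the left as far as the integral
  converges absolutely. Since \<open>\<mu>\<close> is nonnegative, Landau's argument
  (\<open>admissible_of_holo_extension\<close>) shows that this is as far as \<open>\<phi>\<close> extends holomorphically to a
  half-plane; hence the analytic continuation of \<open>\<phi>\<close> is \<open>\<Phi>\<close>, and the integral can be used
  everywhere. It yields \<open>Re \<Phi>(z) \<ge> \<Phi>(Re z)\<close> and the strict monotonicity on the reals of a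
  nonconstant \<open>\<Phi>\<close>, so that there is at most one real zero \<open>u\<close>, and no zero at all to the right
  of the line through it.

  The product converges because \<open>\<phi>(k + z) = \<phi>(k) + z\<phi>'(k) + O(\<phi>(k)/k\<^sup>2)\<close>, locally uniformly in
  \<open>z\<close>, and \<open>|\<phi>(k + z)| \<ge> \<phi>(k)\<close> (\<open>factor_bound\<close>). Absorbing the exponentials into a power of
  \<open>\<phi>(n)\<close> turns it into the limit of
  \<open>\<phi>(n)\<^sup>z \<phi>(1)\<cdots>\<phi>(n) / (\<phi>(z)\<phi>(z+1)\<cdots>\<phi>(z+n))\<close> (\<open>Gauss_limit\<close>), from which the recurrence and, for
  a periodic \<open>\<phi>\<close>, the periodicity are immediate.

  To the left of the imaginary axis \<open>W(z) = W(z + m) / (\<Phi>(z)\<cdots>\<Phi>(z + m - 1))\<close> with a holomorphic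
  zero-free numerator; so \<open>W\<close> has no zeros, and its poles are the shifted zeros of \<open>\<Phi>\<close>, which
  are simple on the real axis as \<open>\<Phi>' > 0\<close> there. On a boundary line, where \<open>\<Phi>\<close> need not be
  holomorphic, a second-order expansion of \<open>\<Phi>\<close> inside the closed half-plane takes the place of the
  Laurent expansion (\<open>W_minus_pole_extends\<close>); it holds as soon as the one-sided second derivative is
  finite, since by monotone convergence this means that the second moment is finite.

  Finally, a zero \<open>z\<close> of \<open>\<phi>\<close> on the imaginary axis forces \<open>e\<^sup>-\<^sup>z\<^sup>y = 1\<close> for \<open>\<mu>\<close>-almost all \<open>y\<close>. If \<open>z\<close>
  is not \<open>0\<close>, then \<open>\<mu>\<close> is carried by a lattice.
\<close>

section \<open>Exponential estimates and differentiation under the integral\<close>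

text \<open>On the closed left half-plane \<open>exp\<close> and its derivatives are bounded by \<open>1\<close>. Taylor remainders
  therefore carry no exponential factor, and the bounds below stay integrable up to the boundary
  of the half-plane of convergence.\<close>

lemma norm_exp_minus_Taylor:
  fixes w :: complex
  assumes "0 \<le> Re w"
  shows "cmod (exp (- w) - (\<Sum>i\<le>n. (- w) ^ i / fact i)) \<le> cmod w ^ Suc n / fact n"
proof -
  have "cmod (exp (- w) - (\<Sum>i\<le>n. exp 0 * (- w - 0) ^ i / fact i)) \<le> 1 * cmod (- w - 0) ^ Suc n / fact n"
  proof (rule complex_Taylor[where f = "\<lambda>_. exp" and S = "{z. Re z \<le> 0}"])
    show "convex {z::complex. Re z \<le> 0}" by (rule convex_halfspace_Re_le)
  qed (use assms in \<open>auto intro: DERIV_subset[OF DERIV_exp]\<close>)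
  then show ?thesis by simp
qed

lemma norm_one_minus_exp_le:
  fixes w :: complex
  assumes "0 \<le> Re w"
  shows "cmod (1 - exp (- w)) \<le> cmod w"
  using norm_exp_minus_Taylor[OF assms, of 0] by (simp add: norm_minus_commute)

lemma norm_one_minus_exp_le_2:
  fixes w :: complex
  assumes "0 \<le> Re w"
  shows "cmod (1 - exp (- w)) \<le> 2"
proof -
  have "cmod (1 - exp (- w)) \<le> 1 + cmod (exp (- w))"
    by (metis norm_one norm_triangle_ineq4)
  also have "cmod (exp (- w)) \<le> 1" using assms by simp
  finally show ?thesis by simp
qed

lemma norm_exp_minus_affine_le:
  fixes w :: complex
  assumes "0 \<le> Re w"
  shows "cmod (1 - exp (- w) - w) \<le> cmod w ^ 2"
proof -
  have "1 - exp (- w) - w = - (exp (- w) - (1 - w))" by simp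
  then have "cmod (1 - exp (- w) - w) = cmod (exp (- w) - (1 - w))"
    by (simp only: norm_minus_cancel)
  also have "\<dots> \<le> cmod w ^ 2"
    using norm_exp_minus_Taylor[OF assms, of 1] by (simp add: power2_eq_square)
  finally show ?thesis .
qed

lemma norm_exp_minus_quadratic_le:
  fixes w :: complex
  assumes "0 \<le> Re w"
  shows "cmod (exp (- w) - 1 + w - w\<^sup>2 / 2) \<le> cmod w ^ 3"
proof -
  have "(\<Sum>i\<le>2. (- w) ^ i / fact i) = 1 - w + w\<^sup>2 / 2"
    by (simp add: numeral_2_eq_2)
  then have "cmod (exp (- w) - (1 - w + w\<^sup>2 / 2)) \<le> cmod w ^ 3 / 2"
    using norm_exp_minus_Taylor[OF assms, of 2] by (simp add: numeral_3_eq_3)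
  also have "exp (- w) - (1 - w + w\<^sup>2 / 2) = exp (- w) - 1 + w - w\<^sup>2 / 2" by simp
  also have "cmod w ^ 3 / 2 \<le> cmod w ^ 3" by simp
  finally show ?thesis .
qed

lemma norm_exp_affine_le:
  fixes v :: complex
  shows "cmod (exp v - 1 - v) \<le> cmod v ^ 2 * exp (cmod v)"
proof -
  have "cmod (exp v - 1 - v) \<le> exp \<bar>Re v\<bar> * cmod v ^ 2"
    using Taylor_exp[of v 1] by (simp add: algebra_simps power2_eq_square)
  also have "\<dots> \<le> exp (cmod v) * cmod v ^ 2"
    by (intro mult_right_mono) (auto simp: abs_Re_le_cmod)
  finally show ?thesis by (simp add: mult.commute)
qed

text \<open>Because of the factor \<open>min 1 y\<close> on the right, all moments of order at least one converge
  strictly inside the half-plane of convergence.\<close>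

lemma power_exp_le_min:
  fixes e :: real
  assumes "0 < e" "1 \<le> n"
  obtains C where "\<And>y. 0 < y \<Longrightarrow> y ^ n * exp (- e * y) \<le> C * min 1 y"
proof
  have pow: "y ^ m * exp (- e * y) \<le> fact m / e ^ m" if "0 < y" for y :: real and m
  proof -
    have "(\<Sum>i\<in>{m}. (e * y) ^ i / fact i) \<le> (\<Sum>i. (e * y) ^ i / fact i)"
      by (rule sum_le_suminf) (use assms that exp_converges[of "e * y"] in
        \<open>auto simp: sums_iff scaleR_conv_of_real divide_inverse mult.commute\<close>)
    also have "\<dots> = exp (e * y)"
      using exp_converges[of "e * y"] by (simp add: sums_iff scaleR_conv_of_real divide_inverse mult.commute)
    finally have "(e * y) ^ m / fact m \<le> exp (e * y)" by simp
    then show ?thesis using assms that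
      by (simp add: exp_minus field_simps power_mult_distrib)
  qed
  fix y :: real assume y: "0 < y"
  show "y ^ n * exp (- e * y) \<le> (fact n / e ^ n + fact (n-1) / e ^ (n-1)) * min 1 y"
  proof (cases "y \<le> 1")
    case True
    have "y ^ n * exp (- e * y) = y * (y ^ (n-1) * exp (- e * y))"
      using assms by (cases n) auto
    also have "\<dots> \<le> y * (fact (n-1) / e ^ (n-1))"
      using y pow[OF y] by (intro mult_left_mono) auto
    also have "\<dots> \<le> (fact n / e ^ n + fact (n-1) / e ^ (n-1)) * y"
      using assms y by (simp add: field_simps)
    finally show ?thesis using True by simp
  next
    case False
    have "y ^ n * exp (- e * y) \<le> fact n / e ^ n" by (rule pow[OF y])
    also have "\<dots> \<le> fact n / e ^ n + fact (n-1) / e ^ (n-1)" using assms by simp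
    finally show ?thesis using False by simp
  qed
qed

text \<open>With a quadratic remainder that is dominated by an integrable function, differentiation under
  the integral needs no limit theorem: one integrates the remainder.\<close>

lemma has_field_derivative_integral_quadratic:
  fixes f :: "complex \<Rightarrow> 'a \<Rightarrow> complex"
  assumes r: "0 < r"
    and f: "\<And>w. dist w z < r \<Longrightarrow> integrable M (f w)"
    and f': "integrable M f'" and B: "integrable M B"
    and bd: "\<And>w y. dist w z < r \<Longrightarrow> y \<in> space M \<Longrightarrow>
        cmod (f w y - f z y - (w - z) * f' y) \<le> cmod (w - z) ^ 2 * B y"
  shows "((\<lambda>w. \<integral>y. f w y \<partial>M) has_field_derivative (\<integral>y. f' y \<partial>M)) (at z)"
proof -
  have fz: "integrable M (f z)" using f r by simp
  have bound: "cmod ((\<integral>y. f w y \<partial>M) - (\<integral>y. f z y \<partial>M) - (w - z) * (\<integral>y. f' y \<partial>M))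
      \<le> cmod (w - z) ^ 2 * (\<integral>y. B y \<partial>M)" if w: "dist w z < r" for w
  proof -
    have "(\<integral>y. f w y \<partial>M) - (\<integral>y. f z y \<partial>M) - (w - z) * (\<integral>y. f' y \<partial>M)
        = (\<integral>y. f w y - f z y - (w - z) * f' y \<partial>M)"
      using f[OF w] fz f' by (simp add: Bochner_Integration.integral_diff)
    also have "cmod \<dots> \<le> (\<integral>y. cmod (f w y - f z y - (w - z) * f' y) \<partial>M)"
      by (rule integral_norm_bound)
    also have "\<dots> \<le> (\<integral>y. cmod (w - z) ^ 2 * B y \<partial>M)"
      by (rule integral_mono) (use f[OF w] fz f' B bd[OF w] in auto)
    finally show ?thesis using B by simp
  qed
  let ?F = "\<lambda>w. \<integral>y. f w y \<partial>M"
  let ?q = "\<lambda>w. (?F w - ?F z) / (w - z) - (\<integral>y. f' y \<partial>M)"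
  have "(?q \<longlongrightarrow> 0) (at z)"
  proof (rule Lim_null_comparison)
    show "((\<lambda>w. cmod (w - z) * (\<integral>y. B y \<partial>M)) \<longlongrightarrow> 0) (at z)"
      by (auto intro!: tendsto_eq_intros)
    have "eventually (\<lambda>w. dist w z < r \<and> w \<noteq> z) (at z)"
      using r unfolding eventually_at by auto
    then show "eventually (\<lambda>w. cmod (?q w) \<le> cmod (w - z) * (\<integral>y. B y \<partial>M)) (at z)"
    proof eventually_elim
      case (elim w)
      then have wz: "cmod (w - z) > 0" by simp
      have "?q w = (?F w - ?F z - (w - z) * (\<integral>y. f' y \<partial>M)) / (w - z)"
        using elim by (simp add: field_simps)
      then have "cmod (?q w) \<le> (cmod (w - z) ^ 2 * (\<integral>y. B y \<partial>M)) / cmod (w - z)"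
        using bound[of w] elim wz by (simp add: norm_divide divide_right_mono)
      then show ?case using wz by (simp add: power2_eq_square)
    qed
  qed
  then show ?thesis
    unfolding has_field_derivative_iff using LIM_zero_iff by blast
qed

section \<open>Bernstein functions as Laplace-type integrals\<close>

locale bernstein_function =
  fixes \<phi> :: "complex \<Rightarrow> complex" and d :: real and \<mu> :: "real measure"
  assumes bern: "bernstein \<phi> d \<mu>"
begin

lemmas bern_unfolded = bern[unfolded bernstein_def]

lemma killing_real: "\<phi> 0 = of_real (Re (\<phi> 0))"
  using bern_unfolded[THEN conjunct1] by simp

lemma killing_nonneg: "0 \<le> Re (\<phi> 0)"
  by (rule bern_unfolded[THEN conjunct2, THEN conjunct1])

lemma drift_nonneg: "0 \<le> d"
  by (rule bern_unfolded[THEN conjunct2, THEN conjunct2, THEN conjunct1])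

lemma sets_mu: "sets \<mu> = sets (restrict_space borel {0<..})"
  by (rule bern_unfolded[THEN conjunct2, THEN conjunct2, THEN conjunct2, THEN conjunct1])

lemma levy: "(\<integral>\<^sup>+ y. ennreal (min 1 y) \<partial>\<mu>) < \<infinity>"
  by (rule bern_unfolded[THEN conjunct2, THEN conjunct2, THEN conjunct2, THEN conjunct2, THEN conjunct1])

lemma phi_formula:
  "0 \<le> Re z \<Longrightarrow> \<phi> z = \<phi> 0 + of_real d * z + (\<integral>y. (1 - exp (- z * of_real y)) \<partial>\<mu>)"
  using bern_unfolded by blast

lemma phi_not_zero: "\<exists>z. 0 \<le> Re z \<and> \<phi> z \<noteq> 0"
  using bern_unfolded by blast

lemma space_mu [simp]: "space \<mu> = {0<..}"
  using sets_eq_imp_space_eq[OF sets_mu] by (simp add: space_restrict_space)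

lemma measurable_mu: "f \<in> borel_measurable borel \<Longrightarrow> f \<in> borel_measurable \<mu>"
  by (subst measurable_cong_sets[OF sets_mu refl]) (rule measurable_restrict_space1)

lemma measurable_cont: "continuous_on UNIV f \<Longrightarrow> f \<in> borel_measurable \<mu>"
  by (intro measurable_mu borel_measurable_continuous_onI)

text \<open>Near \<open>0\<close> the integrand \<open>1 - e\<^sup>-\<^sup>z\<^sup>y\<close> is of the order of \<open>y\<close>, and near infinity it is at most of the
  order of \<open>1 + e\<^sup>-\<^sup>x\<^sup>y\<close> with \<open>x = Re z\<close>. Admissibility of \<open>x\<close> thus means absolute convergence on the
  line \<open>Re z = x\<close>.\<close>

definition admissible :: "real \<Rightarrow> bool" where
  "admissible x \<longleftrightarrow> integrable \<mu> (\<lambda>y. min 1 y * exp (- x * y))"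

definition \<Phi> :: "complex \<Rightarrow> complex" where
  "\<Phi> z = \<phi> 0 + of_real d * z + (\<integral>y. (1 - exp (- z * of_real y)) \<partial>\<mu>)"

definition moment :: "nat \<Rightarrow> complex \<Rightarrow> complex" where
  "moment n z = (\<integral>y. of_real (y ^ n) * exp (- z * of_real y) \<partial>\<mu>)"

lemma phi_eq: "0 \<le> Re z \<Longrightarrow> \<phi> z = \<Phi> z"
  unfolding \<Phi>_def by (rule phi_formula)

lemma integrable_dominated:
  fixes f :: "real \<Rightarrow> 'b::{banach, second_countable_topology}"
  assumes "continuous_on UNIV f" "integrable \<mu> g" "\<And>y. 0 < y \<Longrightarrow> norm (f y) \<le> g y"
  shows "integrable \<mu> f"
proof (rule Bochner_Integration.integrable_bound[OF assms(2) measurable_cont[OF assms(1)]])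
  show "AE y in \<mu>. norm (f y) \<le> norm (g y)"
    by (rule AE_I2) (use assms(3) in \<open>force intro: order_trans\<close>)
qed

lemma integrable_min: "integrable \<mu> (\<lambda>y. min 1 y)"
proof -
  have "(\<integral>\<^sup>+ y. ennreal (norm (min 1 y)) \<partial>\<mu>) = (\<integral>\<^sup>+ y. ennreal (min 1 y) \<partial>\<mu>)"
    by (rule nn_integral_cong) auto
  then show ?thesis using levy
    by (auto simp: integrable_iff_bounded intro!: measurable_cont continuous_intros)
qed

lemma admissible_0: "admissible 0"
  unfolding admissible_def using integrable_min by simp

lemma admissible_mono:
  assumes "admissible v" "v \<le> x"
  shows "admissible x"
  unfolding admissible_def
  by (rule integrable_dominated[OF _ assms(1)[unfolded admissible_def]])
     (use assms(2) in \<open>auto intro!: continuous_intros mult_left_mono simp: abs_mult mult_right_mono\<close>)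

text \<open>To the left of the axis, factoring out \<open>e\<^sup>-\<^sup>z\<^sup>y\<close> reduces the bound to that for \<open>- z\<close>.\<close>

lemma one_minus_exp_bound:
  assumes "0 < y" "v \<le> Re z" "cmod z \<le> R"
  shows "cmod (1 - exp (- z * of_real y)) \<le> (2 + R) * (min 1 y + min 1 y * exp (- v * y))"
proof -
  have R: "0 \<le> R" using assms(3) norm_ge_zero order_trans by blast
  have rot: "cmod (1 - exp (- w)) \<le> (2 + R) * min 1 y"
    if "0 \<le> Re w" "cmod w \<le> R * y" for w
  proof (cases "y \<le> 1")
    case True
    have "cmod (1 - exp (- w)) \<le> R * y" using norm_one_minus_exp_le[OF that(1)] that(2) by simp
    also have "\<dots> \<le> (2 + R) * y" using assms(1) by (intro mult_right_mono) auto
    finally show ?thesis using True by simp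
  next
    case False
    then show ?thesis using norm_one_minus_exp_le_2[OF that(1)] R by simp
  qed
  have nz: "cmod (z * of_real y) \<le> R * y"
    using assms by (simp add: norm_mult mult_right_mono)
  show ?thesis
  proof (cases "0 \<le> Re z")
    case True
    have "cmod (1 - exp (- (z * of_real y))) \<le> (2 + R) * min 1 y"
      by (rule rot) (use True assms(1) nz in auto)
    also have "\<dots> \<le> (2 + R) * (min 1 y + min 1 y * exp (- v * y))"
      using R assms(1) by (intro mult_left_mono) auto
    finally show ?thesis by simp
  next
    case False
    have "1 - exp (- z * of_real y) = - exp (- z * of_real y) * (1 - exp (- (- z * of_real y)))"
      by (simp add: algebra_simps exp_minus)
    then have "cmod (1 - exp (- z * of_real y))
        = exp (- Re z * y) * cmod (1 - exp (- (- z * of_real y)))"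
      by (simp add: norm_mult)
    also have "\<dots> \<le> exp (- v * y) * ((2 + R) * min 1 y)"
    proof (intro mult_mono rot)
      show "exp (- Re z * y) \<le> exp (- v * y)" using assms by simp
      show "0 \<le> Re (- z * of_real y)" using False assms(1) by (simp add: mult_nonpos_nonneg)
    qed (use nz in auto)
    also have "\<dots> \<le> (2 + R) * (min 1 y + min 1 y * exp (- v * y))"
      using R assms(1) by (simp add: algebra_simps)
    finally show ?thesis by simp
  qed
qed

lemma integrable_one_minus_exp:
  assumes "admissible v" "v \<le> Re z"
  shows "integrable \<mu> (\<lambda>y. 1 - exp (- z * of_real y))"
  by (rule integrable_dominated[where g = "\<lambda>y. (2 + cmod z) * (min 1 y + min 1 y * exp (- v * y))"])
     (use assms one_minus_exp_bound[of _ v z "cmod z"] integrable_min in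
       \<open>auto simp: admissible_def intro!: continuous_intros\<close>)

lemma continuous_on_Phi:
  assumes "admissible v"
  shows "continuous_on {z. v \<le> Re z} \<Phi>"
proof -
  have "continuous_on {z. v \<le> Re z} (\<lambda>z. \<integral>y. (1 - exp (- z * of_real y)) \<partial>\<mu>)"
  proof (subst continuous_on_sequentially, safe)
    fix x a assume a: "v \<le> Re a" and x: "\<forall>n. x n \<in> {z. v \<le> Re z}" and lim: "x \<longlonglongrightarrow> a"
    obtain R where R: "\<And>n. cmod (x n) \<le> R"
      using convergent_imp_Bseq[OF convergentI[OF lim]] by (auto simp: Bseq_def)
    show "((\<lambda>z. \<integral>y. (1 - exp (- z * of_real y)) \<partial>\<mu>) \<circ> x)
        \<longlonglongrightarrow> (\<integral>y. (1 - exp (- a * of_real y)) \<partial>\<mu>)"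
      unfolding comp_def
    proof (rule integral_dominated_convergence[where
          w = "\<lambda>y. (2 + R) * (min 1 y + min 1 y * exp (- v * y))"])
      show "integrable \<mu> (\<lambda>y. (2 + R) * (min 1 y + min 1 y * exp (- v * y)))"
        using assms integrable_min by (auto simp: admissible_def)
      show "AE y in \<mu>. (\<lambda>i. 1 - exp (- x i * of_real y)) \<longlonglongrightarrow> 1 - exp (- a * of_real y)"
        by (rule AE_I2) (intro tendsto_intros lim)
      show "AE y in \<mu>. cmod (1 - exp (- x i * of_real y))
          \<le> (2 + R) * (min 1 y + min 1 y * exp (- v * y))" for i
        by (rule AE_I2) (use x R in \<open>auto intro!: one_minus_exp_bound[simplified]\<close>)
    qed (auto intro!: measurable_cont continuous_intros)
  qed
  then show ?thesis unfolding \<Phi>_def by (intro continuous_intros)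
qed

lemma integrable_moment:
  assumes "admissible v" "v < Re z" "1 \<le> n"
  shows "integrable \<mu> (\<lambda>y. of_real (y ^ n) * exp (- z * of_real y) :: complex)"
proof -
  obtain C where C: "\<And>y. 0 < y \<Longrightarrow> y ^ n * exp (- (Re z - v) * y) \<le> C * min 1 y"
    using power_exp_le_min[of "Re z - v" n] assms by auto
  show ?thesis
  proof (rule integrable_dominated[where g = "\<lambda>y. C * (min 1 y * exp (- v * y))"])
    fix y :: real assume y: "0 < y"
    have "cmod (of_real (y ^ n) * exp (- z * of_real y)) = y ^ n * exp (- Re z * y)"
      using y by (simp add: norm_mult norm_power)
    also have "\<dots> = (y ^ n * exp (- (Re z - v) * y)) * exp (- v * y)"
      by (simp add: exp_add[symmetric] algebra_simps)
    also have "\<dots> \<le> (C * min 1 y) * exp (- v * y)"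
      by (intro mult_right_mono C y) auto
    finally show "cmod (of_real (y ^ n) * exp (- z * of_real y)) \<le> C * (min 1 y * exp (- v * y))"
      by simp
  qed (use assms in \<open>auto simp: admissible_def intro!: continuous_intros\<close>)
qed

lemma integrable_real_moment:
  assumes "admissible v" "v < x" "1 \<le> n"
  shows "integrable \<mu> (\<lambda>y. y ^ n * exp (- x * y))"
proof -
  have "integrable \<mu> (\<lambda>y. Re (of_real (y ^ n) * exp (- of_real x * of_real y) :: complex))"
    by (intro integrable_Re integrable_moment[OF assms(1)]) (use assms in auto)
  then show ?thesis by (simp add: Re_exp flip: of_real_power)
qed

lemma exp_shift_bound:
  fixes z w :: complex
  assumes "0 < y" "cmod (w - z) < r"
  shows "cmod (exp (- w * of_real y) - exp (- z * of_real y) + (w - z) * (of_real y * exp (- z * of_real y)))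
      \<le> cmod (w - z) ^ 2 * (y ^ 2 * exp (- (Re z - r) * y))"
proof -
  let ?h = "- (w - z) * of_real y"
  have "exp (- w * of_real y) - exp (- z * of_real y) + (w - z) * (of_real y * exp (- z * of_real y))
      = exp (- z * of_real y) * (exp ?h - 1 - ?h)"
    by (simp add: algebra_simps flip: exp_add)
  also have "cmod \<dots> \<le> exp (- Re z * y) * (cmod ?h ^ 2 * exp (cmod ?h))"
    unfolding norm_mult[of "exp (- z * of_real y)"]
    by (intro mult_mono norm_exp_affine_le) auto
  also have "\<dots> \<le> exp (- Re z * y) * ((cmod (w - z) * y) ^ 2 * exp (r * y))"
    using assms by (intro mult_left_mono mult_mono) (auto simp: norm_mult norm_minus_commute)
  also have "\<dots> = cmod (w - z) ^ 2 * (y ^ 2 * (exp (- Re z * y) * exp (r * y)))"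
    by (simp add: power_mult_distrib algebra_simps)
  also have "exp (- Re z * y) * exp (r * y) = exp (- (Re z - r) * y)"
    by (simp add: exp_add[symmetric] algebra_simps)
  finally show ?thesis .
qed

lemma DERIV_Phi:
  assumes "admissible v" "v < Re z"
  shows "(\<Phi> has_field_derivative (of_real d + moment 1 z)) (at z)"
proof -
  define r where "r = (Re z - v) / 2"
  have r: "0 < r" "v < Re z - r" using assms unfolding r_def by (auto simp: field_simps)
  have "((\<lambda>w. \<integral>y. (1 - exp (- w * of_real y)) \<partial>\<mu>) has_field_derivative
      (\<integral>y. of_real (y ^ 1) * exp (- z * of_real y) \<partial>\<mu>)) (at z)"
  proof (rule has_field_derivative_integral_quadratic[where r = r
        and B = "\<lambda>y. y ^ 2 * exp (- (Re z - r) * y)"])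
    show "integrable \<mu> (\<lambda>y. 1 - exp (- w * of_real y))" if "dist w z < r" for w
    proof (rule integrable_one_minus_exp[OF assms(1)])
      have "\<bar>Re (w - z)\<bar> < r" using that abs_Re_le_cmod[of "w - z"] by (simp add: dist_norm)
      then show "v \<le> Re w" using r by simp
    qed
    show "integrable \<mu> (\<lambda>y. y ^ 2 * exp (- (Re z - r) * y))"
      by (rule integrable_real_moment[OF assms(1)]) (use r in auto)
    show "cmod (1 - exp (- w * of_real y) - (1 - exp (- z * of_real y)) -
          (w - z) * (of_real (y ^ 1) * exp (- z * of_real y)))
        \<le> cmod (w - z) ^ 2 * (y ^ 2 * exp (- (Re z - r) * y))"
      if "dist w z < r" "y \<in> space \<mu>" for w y
    proof -
      have "1 - exp (- w * of_real y) - (1 - exp (- z * of_real y)) -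
          (w - z) * (of_real (y ^ 1) * exp (- z * of_real y))
         = - (exp (- w * of_real y) - exp (- z * of_real y) + (w - z) * (of_real y * exp (- z * of_real y)))"
        by simp
      then show ?thesis using exp_shift_bound[of y w z r] that
        by (simp only: norm_minus_cancel) (simp add: dist_norm)
    qed
  qed (use r assms in \<open>auto intro!: integrable_moment[OF assms(1), of z 1, simplified]\<close>)
  then show ?thesis unfolding \<Phi>_def moment_def by (auto intro!: derivative_eq_intros)
qed

lemma DERIV_moment:
  assumes "admissible v" "v < Re z" "1 \<le> n"
  shows "(moment n has_field_derivative (- moment (Suc n) z)) (at z)"
proof -
  define r where "r = (Re z - v) / 2"
  have r: "0 < r" "v < Re z - r" using assms unfolding r_def by (auto simp: field_simps)
  have "((\<lambda>w. \<integral>y. of_real (y ^ n) * exp (- w * of_real y) \<partial>\<mu>) has_field_derivative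
      (\<integral>y. - (of_real (y ^ Suc n) * exp (- z * of_real y)) \<partial>\<mu>)) (at z)"
  proof (rule has_field_derivative_integral_quadratic[where r = r
        and B = "\<lambda>y. y ^ (n + 2) * exp (- (Re z - r) * y)"])
    show "integrable \<mu> (\<lambda>y. of_real (y ^ n) * exp (- w * of_real y) :: complex)" if "dist w z < r" for w
    proof (rule integrable_moment[OF assms(1)])
      have "\<bar>Re (w - z)\<bar> < r" using that abs_Re_le_cmod[of "w - z"] by (simp add: dist_norm)
      then show "v < Re w" using r by simp
    qed fact
    show "integrable \<mu> (\<lambda>y. y ^ (n + 2) * exp (- (Re z - r) * y))"
      by (rule integrable_real_moment[OF assms(1)]) (use r in auto)
    show "integrable \<mu> (\<lambda>y. - (of_real (y ^ Suc n) * exp (- z * of_real y)) :: complex)"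
      by (intro Bochner_Integration.integrable_minus integrable_moment[OF assms(1,2)]) simp
    show "cmod (of_real (y ^ n) * exp (- w * of_real y) - of_real (y ^ n) * exp (- z * of_real y) -
          (w - z) * - (of_real (y ^ Suc n) * exp (- z * of_real y)))
        \<le> cmod (w - z) ^ 2 * (y ^ (n + 2) * exp (- (Re z - r) * y))"
      if "dist w z < r" "y \<in> space \<mu>" for w y
    proof -
      have "of_real (y ^ n) * exp (- w * of_real y) - of_real (y ^ n) * exp (- z * of_real y) -
          (w - z) * - (of_real (y ^ Suc n) * exp (- z * of_real y))
         = of_real (y ^ n) * (exp (- w * of_real y) - exp (- z * of_real y)
            + (w - z) * (of_real y * exp (- z * of_real y)))"
        by (simp add: algebra_simps)
      also have "cmod \<dots> \<le> y ^ n * (cmod (w - z) ^ 2 * (y ^ 2 * exp (- (Re z - r) * y)))"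
        unfolding norm_mult using that
        by (intro mult_mono exp_shift_bound) (auto simp: dist_norm norm_power)
      also have "\<dots> = cmod (w - z) ^ 2 * (y ^ (n + 2) * exp (- (Re z - r) * y))"
        by (simp add: power_add power2_eq_square mult_ac)
      finally show ?thesis .
    qed
  qed (use r in auto)
  then show ?thesis unfolding moment_def by simp
qed

lemma deriv_Phi:
  assumes "admissible v" "v < Re z"
  shows "deriv \<Phi> z = of_real d + moment 1 z"
  by (rule DERIV_imp_deriv[OF DERIV_Phi[OF assms]])

lemma higher_deriv_Phi:
  assumes "admissible v" "v < Re z"
  shows "(deriv ^^ Suc (Suc n)) \<Phi> z = (-1) ^ Suc n * moment (Suc (Suc n)) z"
  using assms(2)
proof (induction n arbitrary: z)
  case 0
  have "eventually (\<lambda>w. deriv \<Phi> w = of_real d + moment 1 w) (nhds z)"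
    using eventually_nhds_in_open[OF open_halfspace_Re_gt[of v], of z] 0
    by (auto elim!: eventually_mono intro!: deriv_Phi[OF assms(1)] simp del: One_nat_def)
  then have "deriv (deriv \<Phi>) z = deriv (\<lambda>w. of_real d + moment 1 w) z"
    by (rule deriv_cong_ev) simp
  also have "\<dots> = - moment 2 z"
    using DERIV_moment[OF assms(1) 0, of 1]
    by (intro DERIV_imp_deriv) (auto intro!: derivative_eq_intros simp: numeral_2_eq_2)
  finally show ?case by (simp add: numeral_2_eq_2)
next
  case (Suc n)
  have "eventually (\<lambda>w. (deriv ^^ Suc (Suc n)) \<Phi> w = (-1) ^ Suc n * moment (Suc (Suc n)) w) (nhds z)"
  proof (rule eventually_mono)
    show "eventually (\<lambda>w. w \<in> {w. v < Re w}) (nhds z)"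
      by (rule eventually_nhds_in_open) (use Suc.prems open_halfspace_Re_gt[of v] in auto)
  qed (use Suc.IH in blast)
  then have "deriv ((deriv ^^ Suc (Suc n)) \<Phi>) z = deriv (\<lambda>w. (-1) ^ Suc n * moment (Suc (Suc n)) w) z"
    by (rule deriv_cong_ev) simp
  also have "\<dots> = (-1) ^ Suc n * - moment (Suc (Suc (Suc n))) z"
    by (intro DERIV_imp_deriv DERIV_cmult DERIV_moment[OF assms(1) Suc.prems]) simp
  finally show ?case by simp
qed

lemma holomorphic_Phi:
  assumes "\<And>x. a < ereal x \<Longrightarrow> admissible x"
  shows "\<Phi> holomorphic_on halfplane a"
  unfolding holomorphic_on_def halfplane_def
proof safe
  fix z assume "a < ereal (Re z)"
  then obtain v where "a < ereal v" "v < Re z" using ereal_dense2 by (metis less_ereal.simps(1))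
  then show "\<Phi> field_differentiable at z within {z. a < ereal (Re z)}"
    using DERIV_Phi[OF assms, of v z] field_differentiable_at_within field_differentiable_def by blast
qed

end

section \<open>The half-plane of holomorphy is the half-plane of convergence\<close>

lemma open_halfplane: "open (halfplane a)"
proof -
  have "halfplane a = Re -` (ereal -` {a<..})" by (auto simp: halfplane_def)
  moreover have "open (ereal -` {a<..})"
    by (rule open_vimage) (auto intro: continuous_intros continuous_on_ereal)
  ultimately show ?thesis by (simp add: open_vimage continuous_on_Re)
qed

lemma convex_halfplane: "convex (halfplane a)"
proof -
  have "is_interval {x::real. a < ereal x}"
    unfolding is_interval_1 using less_le_trans by fastforce
  then have "convex {x::real. a < ereal x}" by (simp add: is_interval_convex_1)
  then have "convex (Re -` {x::real. a < ereal x})"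
    by (rule convex_linear_vimage[OF bounded_linear.linear[OF bounded_linear_Re]])
  then show ?thesis by (simp add: halfplane_def vimage_def)
qed

lemma halfplane_mono: "a \<le> b \<Longrightarrow> halfplane b \<subseteq> halfplane a"
  by (auto simp: halfplane_def intro: le_less_trans)

lemma holo_extension_unique:
  assumes g: "holo_extension \<phi> a g" and h: "holo_extension \<phi> b h" and "a \<le> b" "b \<le> 0"
    and z: "b < ereal (Re z) \<or> 0 \<le> Re z"
  shows "g z = h z"
proof (cases "0 \<le> Re z")
  case True
  then show ?thesis using g h by (simp add: holo_extension_def)
next
  case False
  then have z: "z \<in> halfplane b" using z by (auto simp: halfplane_def)
  show ?thesis
  proof (rule analytic_continuation_open[OF _ open_halfplane _ _ _ _ _ _ z])
    show "open (halfplane 0)" by (rule open_halfplane)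
    have "1 \<in> halfplane 0" by (simp add: halfplane_def)
    then show "halfplane 0 \<noteq> {}" by auto
    show "connected (halfplane b)" by (rule convex_connected[OF convex_halfplane])
    show "halfplane 0 \<subseteq> halfplane b" using assms by (intro halfplane_mono)
    show "g holomorphic_on halfplane b" "h holomorphic_on halfplane b"
      using g h assms halfplane_mono[of a b]
      by (auto simp: holo_extension_def intro: holomorphic_on_subset)
    show "g w = h w" if "w \<in> halfplane 0" for w
      using that g h by (auto simp: holo_extension_def halfplane_def)
  qed
qed

lemma bf_a_le_0: "bf_a \<phi> \<le> 0"
  unfolding bf_a_def by (rule Inf_lower) simp

context bernstein_function
begin

definition real_moment :: "nat \<Rightarrow> real \<Rightarrow> real" where
  "real_moment n x = (\<integral>y. y ^ n * exp (- x * y) \<partial>\<mu>)"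

lemma moment_of_real: "moment n (of_real x) = of_real (real_moment n x)"
  unfolding moment_def real_moment_def
  by (subst integral_complex_of_real[symmetric]) (simp flip: exp_of_real)

text \<open>Landau's theorem on Laplace transforms of nonnegative measures. The Taylor series of the
  extension at \<open>1\<close> converges at \<open>x\<close>, for the disc around \<open>1\<close> that touches a line \<open>Re z = v\<close> with
  \<open>u < v < x\<close> lies in the domain. From degree \<open>2\<close> on, its coefficients are, up to alternating signs,
  the moments of \<open>e\<^sup>-\<^sup>y \<mu>(dy)\<close>, and left of \<open>1\<close> all terms have the same sign. So sum and integral may
  be exchanged, which gives the integrability of \<open>e\<^sup>-\<^sup>y (e\<^sup>t\<^sup>y - 1 - ty)\<close> for \<open>t = 1 - x\<close>.\<close>

lemma admissible_of_holo_extension: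
  assumes g: "holo_extension \<phi> u g" and ux: "u < ereal x"
  shows "admissible x"
proof (cases "0 \<le> x")
  case True
  then show ?thesis using admissible_mono[OF admissible_0] by simp
next
  case False
  obtain v where v: "u < ereal v" "v < x" using ereal_dense2[OF ux] by (metis less_ereal.simps(1))
  define t where "t = 1 - x"
  have t: "0 \<le> t" using False by (simp add: t_def)
  define h where "h n y = y ^ (n + 2) * exp (- 1 * y) * (t ^ (n + 2) / fact (n + 2))" for n and y :: real
  have "ball (1::complex) (1 - v) \<subseteq> halfplane u"
  proof
    fix w :: complex assume "w \<in> ball 1 (1 - v)"
    then have "\<bar>Re (1 - w)\<bar> < 1 - v"
      using abs_Re_le_cmod[of "1 - w"] by (simp add: dist_norm)
    then have "v < Re w" by simp
    then show "w \<in> halfplane u" using v(1) by (auto simp: halfplane_def intro: less_trans)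
  qed
  then have "g holomorphic_on ball 1 (1 - v)"
    using g holomorphic_on_subset by (auto simp: holo_extension_def)
  moreover have "cmod (1 - complex_of_real x) = \<bar>1 - x\<bar>"
    by (metis norm_of_real of_real_1 of_real_diff)
  then have "complex_of_real x \<in> ball 1 (1 - v)"
    using v False by (simp add: dist_norm)
  ultimately have "(\<lambda>n. (deriv ^^ n) g 1 / fact n * (of_real x - 1) ^ n) sums g (of_real x)"
    by (rule holomorphic_power_series)
  then have "summable (\<lambda>n. (deriv ^^ n) g 1 / fact n * (of_real x - 1) ^ n)"
    by (rule sums_summable)
  then have "summable (\<lambda>n. (deriv ^^ (n + 2)) g 1 / fact (n + 2) * (of_real x - 1) ^ (n + 2))"
    by (subst summable_iff_shift)
  moreover have "(deriv ^^ (n + 2)) g 1 / fact (n + 2) * (of_real x - 1) ^ (n + 2)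
      = - of_real (real_moment (n + 2) 1 * (t ^ (n + 2) / fact (n + 2)))" for n
  proof -
    have "eventually (\<lambda>w. g w = \<Phi> w) (nhds 1)"
      using eventually_nhds_in_open[OF open_halfplane[of 0], of 1] g phi_eq
      by (auto elim!: eventually_mono simp: halfplane_def holo_extension_def)
    then have "(deriv ^^ (n + 2)) g 1 = (deriv ^^ (n + 2)) \<Phi> 1"
      by (rule higher_deriv_cong_ev) simp
    also have "\<dots> = (-1) ^ Suc n * of_real (real_moment (n + 2) 1)"
      using higher_deriv_Phi[OF admissible_0, of 1 n] moment_of_real[of "n + 2" 1]
      by simp
    finally have 1: "(deriv ^^ (n + 2)) g 1 = (-1) ^ Suc n * of_real (real_moment (n + 2) 1)" .
    have "(of_real x - 1 :: complex) = - 1 * of_real t" by (simp add: t_def)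
    then have 2: "(of_real x - 1 :: complex) ^ (n + 2) = (-1) ^ n * of_real (t ^ (n + 2))"
      by (simp only: power_mult_distrib of_real_power) simp
    have 3: "(-1 :: complex) ^ Suc n * (-1) ^ n = -1"
      by (simp flip: power_add add: power_mult_distrib[symmetric])
    have "(deriv ^^ (n + 2)) g 1 / fact (n + 2) * (of_real x - 1) ^ (n + 2)
       = ((-1) ^ Suc n * (-1) ^ n) * (of_real (real_moment (n + 2) 1) * (of_real (t ^ (n + 2)) / fact (n + 2)))"
      unfolding 1 2 by (simp only: divide_inverse mult_ac)
    then show ?thesis unfolding 3 by (simp only: of_real_mult of_real_divide of_real_fact) simp
  qed
  ultimately have "summable (\<lambda>n. - complex_of_real (real_moment (n + 2) 1 * (t ^ (n + 2) / fact (n + 2))))"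
    by simp
  then have sum: "summable (\<lambda>n. real_moment (n + 2) 1 * (t ^ (n + 2) / fact (n + 2)))"
    by (simp only: summable_minus_iff summable_of_real_iff)
  have h_int: "integrable \<mu> (h n)" for n
    unfolding h_def by (intro integrable_mult_left integrable_real_moment[OF admissible_0]) auto
  have h_sums: "(\<lambda>n. h n y) sums (exp (- y) * (exp (t * y) - 1 - t * y))" for y
  proof -
    have "(\<lambda>n. (t * y) ^ n / fact n) sums exp (t * y)"
      using exp_converges[of "t * y"] by (simp add: scaleR_conv_of_real divide_inverse mult.commute)
    then have "(\<lambda>n. (t * y) ^ (n + 2) / fact (n + 2)) sums (exp (t * y) - (\<Sum>n<2. (t * y) ^ n / fact n))"
      by (subst sums_iff_shift) simp
    then have "(\<lambda>n. (t * y) ^ (n + 2) / fact (n + 2)) sums (exp (t * y) - 1 - t * y)"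
      by (simp add: numeral_2_eq_2 diff_diff_eq)
    then have "(\<lambda>n. exp (- y) * ((t * y) ^ (n + 2) / fact (n + 2))) sums (exp (- y) * (exp (t * y) - 1 - t * y))"
      by (rule sums_mult)
    moreover have "exp (- y) * ((t * y) ^ (n + 2) / fact (n + 2)) = h n y" for n
      unfolding h_def by (simp only: power_mult_distrib) simp
    ultimately show ?thesis by simp
  qed
  have h_nonneg: "0 \<le> h n y" if "0 < y" for n y using t that by (simp add: h_def)
  have "integrable \<mu> (\<lambda>y. \<Sum>n. h n y)"
  proof (rule integrable_suminf[OF h_int])
    show "AE y in \<mu>. summable (\<lambda>n. norm (h n y))"
      using h_sums h_nonneg by (intro AE_I2) (auto simp: sums_iff)
    have "(\<integral>y. norm (h n y) \<partial>\<mu>) = real_moment (n + 2) 1 * (t ^ (n + 2) / fact (n + 2))" for n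
    proof -
      have "(\<integral>y. norm (h n y) \<partial>\<mu>) = (\<integral>y. h n y \<partial>\<mu>)"
        by (rule Bochner_Integration.integral_cong) (use h_nonneg in auto)
      then show ?thesis unfolding h_def real_moment_def by simp
    qed
    then show "summable (\<lambda>n. \<integral>y. norm (h n y) \<partial>\<mu>)" using sum by simp
  qed
  then have H: "integrable \<mu> (\<lambda>y. exp (- y) * (exp (t * y) - 1 - t * y))"
    using h_sums by (simp add: sums_iff)
  show ?thesis
    unfolding admissible_def
  proof (rule integrable_dominated[where
        g = "\<lambda>y. exp (- y) * (exp (t * y) - 1 - t * y) + (1 + t) * min 1 y"])
    fix y :: real assume y: "0 < y"
    have e: "exp (- x * y) = exp (- y) * (exp (t * y) - 1 - t * y) + exp (- y) * (1 + t * y)"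
      by (simp add: t_def algebra_simps flip: exp_add)
    have "0 \<le> exp (- y) * (exp (t * y) - 1 - t * y)"
    proof (rule mult_nonneg_nonneg)
      show "0 \<le> exp (t * y) - 1 - t * y" using exp_ge_add_one_self[of "t * y"] by linarith
    qed simp
    then have 1: "min 1 y * (exp (- y) * (exp (t * y) - 1 - t * y)) \<le> exp (- y) * (exp (t * y) - 1 - t * y)"
      by (intro mult_left_le_one_le) (use y in auto)
    have "y \<le> exp y" using exp_ge_add_one_self[of y] by linarith
    then have "y * exp (- y) \<le> 1" by (simp add: exp_minus field_simps)
    then have "t * (y * exp (- y)) \<le> t * 1" by (intro mult_left_mono t)
    moreover have "exp (- y) \<le> 1" using y by simp
    moreover have "exp (- y) * (1 + t * y) = exp (- y) + t * (y * exp (- y))"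
      by (simp add: algebra_simps)
    ultimately have "exp (- y) * (1 + t * y) \<le> 1 + t" by linarith
    then have 2: "min 1 y * (exp (- y) * (1 + t * y)) \<le> min 1 y * (1 + t)"
      using y by (intro mult_left_mono) auto
    have "min 1 y * exp (- x * y) =
        min 1 y * (exp (- y) * (exp (t * y) - 1 - t * y)) + min 1 y * (exp (- y) * (1 + t * y))"
      unfolding e by (rule distrib_left)
    with 1 2 have "min 1 y * exp (- x * y)
        \<le> exp (- y) * (exp (t * y) - 1 - t * y) + (1 + t) * min 1 y"
      by (simp only: mult.commute[of "1 + t"])
    then show "norm (min 1 y * exp (- x * y)) \<le> exp (- y) * (exp (t * y) - 1 - t * y) + (1 + t) * min 1 y"
      using y by simp
  qed (use H integrable_min in \<open>auto intro!: continuous_intros\<close>)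
qed

lemma admissible_of_bf_a:
  assumes "bf_a \<phi> < ereal x"
  shows "admissible x"
proof (cases "0 \<le> x")
  case True
  then show ?thesis using admissible_mono[OF admissible_0] by simp
next
  case False
  with assms obtain u g where "holo_extension \<phi> (ereal u) g" "ereal u < ereal x"
    unfolding bf_a_def Inf_less_iff by (auto simp: zero_ereal_def)
  then show ?thesis by (rule admissible_of_holo_extension)
qed

lemma holo_extension_Phi: "holo_extension \<phi> (bf_a \<phi>) \<Phi>"
  unfolding holo_extension_def
  using holomorphic_Phi[of "bf_a \<phi>"] admissible_of_bf_a phi_eq by auto

lemma holomorphic_Phi_bf_a: "\<Phi> holomorphic_on halfplane (bf_a \<phi>)"
  using holo_extension_Phi by (simp add: holo_extension_def)

lemma bf_cont_eq_Phi:
  assumes "bf_a \<phi> < ereal (Re z) \<or> 0 \<le> Re z"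
  shows "bf_cont \<phi> z = \<Phi> z"
proof -
  have "holo_extension \<phi> (bf_a \<phi>) (bf_cont \<phi>)"
    unfolding bf_cont_def by (rule someI[where P = "holo_extension \<phi> (bf_a \<phi>)", OF holo_extension_Phi])
  then show ?thesis
    by (rule holo_extension_unique[OF _ holo_extension_Phi]) (use assms bf_a_le_0 in auto)
qed

lemma bf_ext_eq_Phi:
  assumes "bf_a \<phi> < ereal (Re z) \<or> 0 \<le> Re z"
  shows "bf_ext \<phi> z = \<Phi> z"
  using assms bf_cont_eq_Phi by (auto simp: bf_ext_def)

lemma at_within_halfplane_nontrivial:
  assumes "a \<le> ereal (Re z)"
  shows "at z within halfplane a \<noteq> bot"
proof -
  have "z \<in> closure (halfplane a)"
  proof (rule closure_sequential[THEN iffD2], intro exI conjI allI)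
    show "z + of_real (inverse (real (Suc n))) \<in> halfplane a" for n
      using assms by (auto simp: halfplane_def intro: le_less_trans)
    have "(\<lambda>n. z + of_real (inverse (real (Suc n)))) \<longlonglongrightarrow> z + of_real 0"
      by (intro tendsto_intros LIMSEQ_inverse_real_of_nat)
    then show "(\<lambda>n. z + of_real (inverse (real (Suc n)))) \<longlonglongrightarrow> z" by simp
  qed
  moreover have "z islimpt halfplane a" if "z \<in> halfplane a"
    using that open_halfplane interior_open interior_limit_point by metis
  ultimately show ?thesis
    by (metis closure_def Un_iff mem_Collect_eq trivial_limit_within)
qed

text \<open>If the integral still converges on the boundary line, then it is continuous up to that line by
  dominated convergence, and so it gives the limit from within the half-plane.\<close>

lemma
  assumes adm: "admissible u" and a: "bf_a \<phi> \<le> ereal u" and z: "Re z = u"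
  shows bf_dom_boundary: "z \<in> bf_dom \<phi>"
    and bf_ext_boundary: "bf_ext \<phi> z = \<Phi> z"
proof -
  have "z \<in> bf_dom \<phi> \<and> bf_ext \<phi> z = \<Phi> z"
  proof (cases "bf_a \<phi> < ereal (Re z) \<or> 0 \<le> Re z")
    case True
    then show ?thesis using bf_ext_eq_Phi by (auto simp: bf_dom_def)
  next
    case False
    with a z have au: "bf_a \<phi> = ereal u" by simp
    have "(\<Phi> \<longlongrightarrow> \<Phi> z) (at z within {z. u \<le> Re z})"
      using continuous_on_Phi[OF adm] z by (simp add: continuous_on)
    then have "(\<Phi> \<longlongrightarrow> \<Phi> z) (at z within halfplane (bf_a \<phi>))"
      by (rule tendsto_within_subset) (auto simp: au halfplane_def)
    then have lim: "(bf_cont \<phi> \<longlongrightarrow> \<Phi> z) (at z within halfplane (bf_a \<phi>))"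
      by (rule Lim_transform_eventually)
         (auto simp: eventually_at_filter halfplane_def bf_cont_eq_Phi)
    moreover have "at z within halfplane (bf_a \<phi>) \<noteq> bot"
      by (rule at_within_halfplane_nontrivial) (simp add: au z)
    ultimately have "bf_ext \<phi> z = \<Phi> z"
      unfolding bf_ext_def using False by (simp add: tendsto_Lim)
    with lim show ?thesis using au z by (auto simp: bf_dom_def)
  qed
  then show "z \<in> bf_dom \<phi>" "bf_ext \<phi> z = \<Phi> z" by auto
qed

section \<open>Positivity and real zeros\<close>

lemma Re_Phi:
  assumes "admissible v" "v \<le> Re z"
  shows "Re (\<Phi> z) = Re (\<phi> 0) + d * Re z + (\<integral>y. 1 - exp (- Re z * y) * cos (Im z * y) \<partial>\<mu>)"
proof -
  have "Re (\<integral>y. (1 - exp (- z * of_real y)) \<partial>\<mu>) = (\<integral>y. Re (1 - exp (- z * of_real y)) \<partial>\<mu>)"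
    by (rule integral_Re[symmetric]) (rule integrable_one_minus_exp[OF assms])
  then show ?thesis by (simp add: \<Phi>_def Re_exp)
qed

lemma Re_Phi_of_real:
  assumes "admissible v" "v \<le> x"
  shows "Re (\<Phi> (of_real x)) = Re (\<phi> 0) + d * x + (\<integral>y. 1 - exp (- x * y) \<partial>\<mu>)"
  using Re_Phi[of v "of_real x"] assms by simp

lemma Im_Phi_of_real: "\<Phi> (of_real x) = of_real (Re (\<Phi> (of_real x)))"
proof -
  have "(\<integral>y. 1 - exp (- complex_of_real x * of_real y) \<partial>\<mu>) = of_real (\<integral>y. 1 - exp (- x * y) \<partial>\<mu>)"
    by (subst integral_complex_of_real[symmetric]) (simp flip: exp_of_real)
  then have "\<Phi> (of_real x) = of_real (Re (\<phi> 0) + d * x + (\<integral>y. 1 - exp (- x * y) \<partial>\<mu>))"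
    unfolding \<Phi>_def using killing_real by (metis of_real_add of_real_mult)
  then show ?thesis by simp
qed

lemma integrable_real_one_minus_exp:
  assumes "admissible v" "v \<le> x"
  shows "integrable \<mu> (\<lambda>y. 1 - exp (- x * y))"
  using integrable_Re[OF integrable_one_minus_exp[of v "of_real x"]] assms by (simp add: Re_exp)

text \<open>The integrand of the real part contains \<open>- e\<^sup>-\<^sup>x\<^sup>y cos (Im z y) \<ge> - e\<^sup>-\<^sup>x\<^sup>y\<close>.\<close>

lemma Re_Phi_ge:
  assumes "admissible v" "v \<le> Re z"
  shows "Re (\<Phi> (of_real (Re z))) \<le> Re (\<Phi> z)"
proof -
  have "(\<integral>y. 1 - exp (- Re z * y) \<partial>\<mu>) \<le> (\<integral>y. 1 - exp (- Re z * y) * cos (Im z * y) \<partial>\<mu>)"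
  proof (rule integral_mono)
    show "integrable \<mu> (\<lambda>y. 1 - exp (- Re z * y) * cos (Im z * y))"
      using integrable_Re[OF integrable_one_minus_exp[OF assms]] by (simp add: Re_exp)
    show "integrable \<mu> (\<lambda>y. 1 - exp (- Re z * y))"
      using integrable_real_one_minus_exp[OF assms] .
  qed auto
  then show ?thesis using Re_Phi[OF assms] Re_Phi_of_real[OF assms] by simp
qed

lemma Phi_mono:
  assumes "admissible x" "x \<le> x'"
  shows "Re (\<Phi> (of_real x)) \<le> Re (\<Phi> (of_real x'))"
proof -
  have "(\<integral>y. 1 - exp (- x * y) \<partial>\<mu>) \<le> (\<integral>y. 1 - exp (- x' * y) \<partial>\<mu>)"
    by (rule integral_mono)
       (use integrable_real_one_minus_exp[OF assms(1), of x] integrable_real_one_minus_exp[OF assms] assms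
        in \<open>auto intro: mult_right_mono\<close>)
  moreover have "d * x \<le> d * x'" using drift_nonneg assms by (intro mult_left_mono) auto
  ultimately show ?thesis
    using Re_Phi_of_real[OF assms(1), of x] Re_Phi_of_real[OF assms] by simp
qed

lemma Phi_trivial_measure:
  assumes "AE y in \<mu>. False"
  shows "\<Phi> z = \<phi> 0 + of_real d * z"
proof -
  have "(\<integral>y. 1 - exp (- z * of_real y) \<partial>\<mu>) = 0"
    by (rule integral_eq_zero_AE) (use assms in auto)
  then show ?thesis by (simp add: \<Phi>_def)
qed

lemma Phi_strict_mono:
  assumes adm: "admissible x" and xx: "x < x'" and nonconst: "0 < d \<or> \<not> (AE y in \<mu>. False)"
  shows "Re (\<Phi> (of_real x)) < Re (\<Phi> (of_real x'))"
proof (rule ccontr)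
  assume "\<not> ?thesis"
  then have eq: "Re (\<Phi> (of_real x)) = Re (\<Phi> (of_real x'))"
    using Phi_mono[OF adm, of x'] xx by simp
  have int: "integrable \<mu> (\<lambda>y. 1 - exp (- x * y))" "integrable \<mu> (\<lambda>y. 1 - exp (- x' * y))"
    using integrable_real_one_minus_exp[OF adm] xx by auto
  have nn: "0 \<le> (1 - exp (- x' * y)) - (1 - exp (- x * y))" if "0 < y" for y
    using that xx by simp
  have "(\<integral>y. (1 - exp (- x' * y)) - (1 - exp (- x * y)) \<partial>\<mu>) = d * x - d * x'"
    using eq Re_Phi_of_real[OF adm, of x] Re_Phi_of_real[OF adm, of x'] xx
    by (subst Bochner_Integration.integral_diff[OF int(2,1)]) simp
  moreover have "0 \<le> (\<integral>y. (1 - exp (- x' * y)) - (1 - exp (- x * y)) \<partial>\<mu>)"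
    by (rule Bochner_Integration.integral_nonneg) (use nn in auto)
  moreover have "d * x \<le> d * x'" using drift_nonneg xx by (intro mult_left_mono) auto
  ultimately have int_0: "(\<integral>y. (1 - exp (- x' * y)) - (1 - exp (- x * y)) \<partial>\<mu>) = 0" and d: "d * x = d * x'"
    by auto
  have "AE y in \<mu>. 0 \<le> (1 - exp (- x' * y)) - (1 - exp (- x * y))"
    by (rule AE_I2) (use nn in auto)
  with int_0 have "AE y in \<mu>. (1 - exp (- x' * y)) - (1 - exp (- x * y)) = 0"
    using integral_nonneg_eq_0_iff_AE[OF Bochner_Integration.integrable_diff[OF int(2,1)]] by blast
  then have "AE y in \<mu>. False"
    by (rule AE_mp) (intro AE_I2, use xx in auto)
  then show False using nonconst d xx by auto
qed

lemma nonconst_if_killing_0: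
  assumes "\<phi> 0 = 0"
  shows "0 < d \<or> \<not> (AE y in \<mu>. False)"
proof (rule ccontr)
  assume "\<not> ?thesis"
  then have "d = 0" "AE y in \<mu>. False" using drift_nonneg by auto
  then have "\<phi> z = 0" if "0 \<le> Re z" for z
    using phi_eq[OF that] Phi_trivial_measure[of z] assms by simp
  then show False using phi_not_zero by blast
qed

lemma Phi_pos_of_pos:
  assumes "0 < x"
  shows "0 < Re (\<Phi> (of_real x))"
proof (cases "\<phi> 0 = 0")
  case True
  then have "Re (\<Phi> (of_real 0)) < Re (\<Phi> (of_real x))"
    by (intro Phi_strict_mono[OF admissible_0 assms] nonconst_if_killing_0)
  then show ?thesis using phi_eq[of 0] True by simp
next
  case False
  then have "0 < Re (\<phi> 0)" using killing_nonneg killing_real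
    by (metis less_eq_real_def of_real_0)
  then show ?thesis using Phi_mono[OF admissible_0, of x] assms phi_eq[of 0] by simp
qed

lemma nonconst_if_zero:
  assumes "\<Phi> z = 0"
  shows "0 < d \<or> \<not> (AE y in \<mu>. False)"
proof (rule ccontr)
  assume "\<not> ?thesis"
  then have "d = 0" "AE y in \<mu>. False" using drift_nonneg by auto
  then have "\<Phi> 1 = \<Phi> z"
    using Phi_trivial_measure[of 1] Phi_trivial_measure[of z] by simp
  then show False using assms Phi_pos_of_pos[of 1] by simp
qed

lemma Phi_real_zero_unique:
  assumes "\<Phi> (of_real x) = 0" "\<Phi> (of_real x') = 0" "admissible x" "admissible x'"
  shows "x = x'"
proof (rule ccontr)
  assume "x \<noteq> x'"
  then consider "x < x'" | "x' < x" by linarith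
  then show False
    using Phi_strict_mono[OF assms(3), of x'] Phi_strict_mono[OF assms(4), of x]
      nonconst_if_zero[OF assms(1)] assms(1,2) by cases auto
qed

text \<open>As \<open>\<Phi>(1) > 0\<close>, a nonpositive value at \<open>x\<close> would produce, by the intermediate value theorem, a
  zero at or to the right of \<open>x\<close>.\<close>

lemma Phi_pos:
  assumes "bf_abar \<phi> < ereal x"
  shows "0 < Re (\<Phi> (of_real x))"
proof (rule ccontr)
  assume neg: "\<not> 0 < Re (\<Phi> (of_real x))"
  then have x: "x \<le> 0" using Phi_pos_of_pos[of x] by (cases "0 < x") auto
  have ax: "bf_a \<phi> < ereal x" and ux: "bf_u \<phi> < ereal x" using assms by (auto simp: bf_abar_def)
  have "continuous_on {x..1} (\<lambda>t. Re (\<Phi> (of_real t)))"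
    by (intro continuous_intros continuous_on_compose2[OF continuous_on_Phi[OF admissible_of_bf_a[OF ax]]]) auto
  then obtain t where t: "x \<le> t" "t \<le> 1" "Re (\<Phi> (of_real t)) = 0"
    using IVT'[of "\<lambda>t. Re (\<Phi> (of_real t))" x 0 1] neg Phi_pos_of_pos[of 1] x by auto
  then have "\<Phi> (of_real t) = 0" "t \<le> 0"
    using Im_Phi_of_real[of t] Phi_pos_of_pos[of t] by (simp, cases "0 < t", auto)
  moreover have at: "bf_a \<phi> < ereal t" using ax t(1) by (meson ereal_less_eq(3) less_le_trans)
  ultimately have "ereal t \<le> bf_u \<phi>"
    unfolding bf_u_def by (intro Sup_upper) (auto simp: bf_dom_def bf_ext_eq_Phi intro: less_imp_le)
  then show False using ux t(1) by (meson ereal_less_eq(3) leD le_trans order_trans)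
qed

lemma bf_abar_le_0: "bf_abar \<phi> \<le> 0"
  unfolding bf_abar_def bf_u_def by (auto simp: bf_a_le_0 intro!: Sup_least)

lemma Phi_nonzero:
  assumes "bf_abar \<phi> < ereal (Re z)"
  shows "\<Phi> z \<noteq> 0"
proof -
  have "bf_a \<phi> < ereal (Re z)" using assms by (simp add: bf_abar_def)
  then show ?thesis
    using Re_Phi_ge[OF admissible_of_bf_a, of "Re z" z] Phi_pos[OF assms] by auto
qed

text \<open>If the supremum were not attained, there would be several zeros strictly inside the half-plane
  of holomorphy, against the strict monotonicity of \<open>\<Phi>\<close>.\<close>

lemma bf_u_attained:
  assumes "bf_u \<phi> = ereal u"
  shows "bf_a \<phi> \<le> ereal u" "u \<le> 0" "of_real u \<in> bf_dom \<phi>" "bf_ext \<phi> (of_real u) = 0"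
proof -
  define Z where "Z = {u. bf_a \<phi> \<le> ereal u \<and> u \<le> 0 \<and> of_real u \<in> bf_dom \<phi> \<and> bf_ext \<phi> (of_real u) = 0}"
  have "bf_u \<phi> = Sup (ereal ` Z)" by (auto simp: bf_u_def Z_def image_def intro!: arg_cong[where f = Sup])
  then have Sup: "Sup (ereal ` Z) = ereal u" using assms by simp
  have approx: "\<exists>x\<in>Z. s < x" if "s < u" for s
    using that less_Sup_iff[of "ereal s" "ereal ` Z"] Sup by auto
  have "u \<in> Z"
  proof (rule ccontr)
    assume "u \<notin> Z"
    moreover have "x \<le> u" if "x \<in> Z" for x
      using that Sup by (metis Sup_upper ereal_less_eq(3) imageI)
    ultimately have lt: "x < u" if "x \<in> Z" for x using that by (metis order_less_le)
    obtain x where x: "x \<in> Z" using approx[of "u - 1"] by auto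
    obtain x' where x': "x' \<in> Z" "x < x'" using approx[OF lt[OF x]] by auto
    obtain x'' where x'': "x'' \<in> Z" "x' < x''" using approx[OF lt[OF x'(1)]] by auto
    have a: "bf_a \<phi> < ereal x'" "bf_a \<phi> < ereal x''"
      using x x' x'' unfolding Z_def by (auto intro: le_less_trans)
    then have "\<Phi> (of_real x') = 0" "\<Phi> (of_real x'') = 0"
      using x' x'' by (simp_all add: Z_def bf_ext_eq_Phi)
    then show False using Phi_real_zero_unique[of x' x''] a admissible_of_bf_a x'' by auto
  qed
  then show "bf_a \<phi> \<le> ereal u" "u \<le> 0" "of_real u \<in> bf_dom \<phi>" "bf_ext \<phi> (of_real u) = 0"
    by (auto simp: Z_def)
qed

end

section \<open>The Weierstrass product\<close>

context bernstein_function
begin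

lemma phi_of_real: "0 \<le> x \<Longrightarrow> \<phi> (of_real x) = of_real (Re (\<phi> (of_real x)))"
  using Im_Phi_of_real[of x] phi_eq[of "of_real x"] by simp

lemma phi_pos: "0 < x \<Longrightarrow> 0 < Re (\<phi> (of_real x))"
  using Phi_pos_of_pos[of x] phi_eq[of "of_real x"] by simp

lemma norm_phi_of_real: "0 < x \<Longrightarrow> cmod (\<phi> (of_real x)) = Re (\<phi> (of_real x))"
  using phi_of_real[of x] phi_pos[of x] by (metis abs_of_pos less_imp_le norm_of_real)

lemma phi_of_nat: "\<phi> (of_nat n) = of_real (Re (\<phi> (of_nat n)))"
  using phi_of_real[of "real n"] by simp

lemma phi_of_nat_pos: "0 < n \<Longrightarrow> 0 < Re (\<phi> (of_nat n))"
  using phi_pos[of "real n"] by simp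

lemma exp_ln_phi:
  assumes "0 < n"
  shows "exp (of_real (ln (Re (\<phi> (of_nat n))))) = \<phi> (of_nat n)"
  using phi_of_nat_pos[OF assms] by (subst exp_of_real, subst exp_ln) (simp_all flip: phi_of_nat)

lemma norm_phi_ge:
  assumes "0 < x" "0 \<le> Re z"
  shows "Re (\<phi> (of_real x)) \<le> cmod (\<phi> (of_real x + z))"
proof -
  have "Re (\<Phi> (of_real x)) \<le> Re (\<Phi> (of_real (Re (of_real x + z))))"
    by (rule Phi_mono) (use assms admissible_mono[OF admissible_0, of x] in auto)
  also have "\<dots> \<le> Re (\<Phi> (of_real x + z))"
    by (rule Re_Phi_ge[OF admissible_0]) (use assms in auto)
  also have "\<dots> \<le> cmod (\<Phi> (of_real x + z))" by (rule complex_Re_le_cmod)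
  finally show ?thesis using assms phi_eq[of "of_real x"] phi_eq[of "of_real x + z"] by simp
qed

lemma phi_nonzero:
  assumes "0 < Re z"
  shows "\<phi> z \<noteq> 0"
proof -
  have "ereal (Re z) > bf_abar \<phi>"
    using bf_abar_le_0 assms by (metis ereal_less(2) le_less_trans)
  then show ?thesis using Phi_nonzero phi_eq assms by simp
qed

lemma deriv_phi:
  assumes "0 < Re z"
  shows "deriv \<phi> z = of_real d + moment 1 z"
proof -
  have "eventually (\<lambda>w. w \<in> {w. 0 < Re w}) (nhds z)"
    by (rule eventually_nhds_in_open) (use assms open_halfspace_Re_gt[of 0] in auto)
  then have "eventually (\<lambda>w. \<phi> w = \<Phi> w) (nhds z)"
    by (rule eventually_mono) (use phi_eq in auto)
  then have "deriv \<phi> z = deriv \<Phi> z" by (rule deriv_cong_ev) simp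
  then show ?thesis using deriv_Phi[OF admissible_0 assms] by simp
qed

lemma integral_one_minus_exp_le:
  assumes "0 < x"
  shows "(\<integral>y. 1 - exp (- x * y) \<partial>\<mu>) \<le> Re (\<phi> (of_real x)) - d * x"
  using Re_Phi_of_real[OF admissible_0, of x] assms killing_nonneg phi_eq[of "of_real x"] by simp

text \<open>From \<open>t e\<^sup>-\<^sup>t \<le> 1 - e\<^sup>-\<^sup>t\<close> with \<open>t = xy\<close>.\<close>

lemma deriv_phi_bound:
  assumes "0 < x"
  shows "cmod (deriv \<phi> (of_real x)) \<le> Re (\<phi> (of_real x)) / x"
proof -
  have "real_moment 1 x \<le> (\<integral>y. inverse x * (1 - exp (- x * y)) \<partial>\<mu>)"
    unfolding real_moment_def
  proof (rule integral_mono)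
    show "integrable \<mu> (\<lambda>y. y ^ 1 * exp (- x * y))"
      by (rule integrable_real_moment[OF admissible_0]) (use assms in auto)
    show "integrable \<mu> (\<lambda>y. inverse x * (1 - exp (- x * y)))"
      using integrable_real_one_minus_exp[OF admissible_0, of x] assms by simp
    fix y assume "y \<in> space \<mu>"
    have "1 + x * y \<le> exp (x * y)" by (rule exp_ge_add_one_self)
    then show "y ^ 1 * exp (- x * y) \<le> inverse x * (1 - exp (- x * y))"
      using assms by (simp add: exp_minus field_simps)
  qed
  also have "\<dots> = (\<integral>y. 1 - exp (- x * y) \<partial>\<mu>) / x" by (simp add: divide_inverse mult.commute)
  also have "\<dots> \<le> (Re (\<phi> (of_real x)) - d * x) / x"
    using integral_one_minus_exp_le[OF assms] assms by (intro divide_right_mono) auto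
  finally have "d + real_moment 1 x \<le> Re (\<phi> (of_real x)) / x"
    using assms by (simp add: field_simps)
  moreover have "0 \<le> real_moment 1 x"
    unfolding real_moment_def by (rule Bochner_Integration.integral_nonneg) auto
  moreover have "deriv \<phi> (of_real x) = of_real (d + real_moment 1 x)"
    using deriv_phi[of "of_real x"] moment_of_real[of 1 x] assms by simp
  ultimately show ?thesis using drift_nonneg
    by (metis abs_of_nonneg add_nonneg_nonneg norm_of_real)
qed

text \<open>The remainder is the integral of \<open>e\<^sup>-\<^sup>x\<^sup>y (1 - e\<^sup>-\<^sup>z\<^sup>y - zy)\<close>, at most \<open>|z|\<^sup>2 y\<^sup>2 e\<^sup>-\<^sup>x\<^sup>y\<close> in absolute value;
  and \<open>t\<^sup>2 e\<^sup>-\<^sup>t \<le> 2 (1 - e\<^sup>-\<^sup>t)\<close> with \<open>t = xy\<close> compares this with \<open>\<phi>(x)\<close>.\<close>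

lemma phi_remainder_bound:
  assumes x: "0 < x" and z: "0 \<le> Re z"
  shows "cmod (\<phi> (of_real x + z) - \<phi> (of_real x) - z * deriv \<phi> (of_real x))
      \<le> 2 * cmod z ^ 2 / x ^ 2 * Re (\<phi> (of_real x))"
proof -
  let ?X = "complex_of_real x"
  have int: "integrable \<mu> (\<lambda>y. 1 - exp (- (?X + z) * of_real y))"
     "integrable \<mu> (\<lambda>y. 1 - exp (- ?X * of_real y))"
     "integrable \<mu> (\<lambda>y. z * (of_real (y ^ 1) * exp (- ?X * of_real y)))"
    using x z by (intro integrable_one_minus_exp[OF admissible_0]
        Bochner_Integration.integrable_mult_right integrable_moment[OF admissible_0]; simp)+
  have "\<phi> (?X + z) - \<phi> ?X - z * deriv \<phi> ?X
     = (\<integral>y. 1 - exp (- (?X + z) * of_real y) \<partial>\<mu>) - (\<integral>y. 1 - exp (- ?X * of_real y) \<partial>\<mu>)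
        - z * moment 1 ?X"
    using phi_eq[of "?X + z"] phi_eq[of ?X] deriv_phi[of ?X] x z by (simp add: \<Phi>_def algebra_simps)
  also have "\<dots> = (\<integral>y. 1 - exp (- (?X + z) * of_real y) \<partial>\<mu>) - (\<integral>y. 1 - exp (- ?X * of_real y) \<partial>\<mu>)
        - (\<integral>y. z * (of_real (y ^ 1) * exp (- ?X * of_real y)) \<partial>\<mu>)"
    by (simp add: moment_def)
  also have "\<dots> = (\<integral>y. (1 - exp (- (?X + z) * of_real y)) - (1 - exp (- ?X * of_real y))
        - z * (of_real (y ^ 1) * exp (- ?X * of_real y)) \<partial>\<mu>)"
    by (simp only: Bochner_Integration.integral_diff[OF int(1,2)]
        Bochner_Integration.integral_diff[OF Bochner_Integration.integrable_diff[OF int(1,2)] int(3)])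
  also have "cmod \<dots> \<le> (\<integral>y. 2 * cmod z ^ 2 / x ^ 2 * (1 - exp (- x * y)) \<partial>\<mu>)"
  proof (rule Bochner_Integration.integral_norm_bound_integral)
    show "integrable \<mu> (\<lambda>y. (1 - exp (- (?X + z) * of_real y)) - (1 - exp (- ?X * of_real y))
        - z * (of_real (y ^ 1) * exp (- ?X * of_real y)))"
      by (intro Bochner_Integration.integrable_diff int)
    show "integrable \<mu> (\<lambda>y. 2 * cmod z ^ 2 / x ^ 2 * (1 - exp (- x * y)))"
      using integrable_real_one_minus_exp[OF admissible_0, of x] x by simp
    fix y assume "y \<in> space \<mu>"
    then have y: "0 < y" by simp
    have "(1 - exp (- (?X + z) * of_real y)) - (1 - exp (- ?X * of_real y))
        - z * (of_real (y ^ 1) * exp (- ?X * of_real y))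
        = exp (- ?X * of_real y) * (1 - exp (- (z * of_real y)) - z * of_real y)"
      by (simp add: algebra_simps flip: exp_add)
    also have "cmod \<dots> \<le> exp (- x * y) * cmod (z * of_real y) ^ 2"
      unfolding norm_mult[of "exp (- ?X * of_real y)"]
      by (intro mult_mono norm_exp_minus_affine_le) (use y z in auto)
    also have "\<dots> = cmod z ^ 2 / x ^ 2 * ((x * y) ^ 2 * exp (- (x * y)))"
      using x y by (simp add: norm_mult power_mult_distrib)
    also have "\<dots> \<le> cmod z ^ 2 / x ^ 2 * (2 * (1 - exp (- (x * y))))"
    proof (rule mult_left_mono)
      have "1 + x * y + (x * y) ^ 2 / 2 \<le> exp (x * y)"
        by (rule exp_lower_Taylor_quadratic) (use x y in simp)
      then have "(x * y) ^ 2 \<le> 2 * (exp (x * y) - 1)" using x y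
        by (smt (verit) mult_pos_pos field_sum_of_halves)
      then have "(x * y) ^ 2 * exp (- (x * y)) \<le> 2 * (exp (x * y) - 1) * exp (- (x * y))"
        by (intro mult_right_mono) auto
      then show "(x * y) ^ 2 * exp (- (x * y)) \<le> 2 * (1 - exp (- (x * y)))"
        by (simp add: exp_minus field_simps)
    qed auto
    also have "\<dots> = 2 * cmod z ^ 2 / x ^ 2 * (1 - exp (- x * y))" by (simp add: mult_ac)
    finally show "cmod ((1 - exp (- (?X + z) * of_real y)) - (1 - exp (- ?X * of_real y))
        - z * (of_real (y ^ 1) * exp (- ?X * of_real y))) \<le> 2 * cmod z ^ 2 / x ^ 2 * (1 - exp (- x * y))" .
  qed
  also have "\<dots> = 2 * cmod z ^ 2 / x ^ 2 * (\<integral>y. 1 - exp (- x * y) \<partial>\<mu>)" by simp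
  also have "\<dots> \<le> 2 * cmod z ^ 2 / x ^ 2 * Re (\<phi> ?X)"
  proof (rule mult_left_mono)
    have "0 \<le> d * x" using drift_nonneg x by simp
    then show "(\<integral>y. 1 - exp (- x * y) \<partial>\<mu>) \<le> Re (\<phi> ?X)" using integral_one_minus_exp_le[OF x] by simp
  qed simp
  finally show ?thesis .
qed

lemma phi_ratio_tendsto:
  assumes "0 \<le> Re w"
  shows "(\<lambda>n. \<phi> (of_nat n + w) / \<phi> (of_nat n)) \<longlonglongrightarrow> 1"
proof -
  have "(\<lambda>n. \<phi> (of_nat n + w) / \<phi> (of_nat n) - 1) \<longlonglongrightarrow> 0"
  proof (rule Lim_null_comparison)
    have "(\<lambda>n. cmod w / real n + 2 * (cmod w / real n) ^ 2) \<longlonglongrightarrow> 0 + 2 * 0 ^ 2"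
      by (intro tendsto_intros lim_const_over_n)
    then show "(\<lambda>n. cmod w / real n + 2 * cmod w ^ 2 / real n ^ 2) \<longlonglongrightarrow> 0"
      by (simp add: power_divide)
    show "eventually (\<lambda>n. norm (\<phi> (of_nat n + w) / \<phi> (of_nat n) - 1)
        \<le> cmod w / real n + 2 * cmod w ^ 2 / real n ^ 2) sequentially"
      using eventually_gt_at_top[of 0]
    proof eventually_elim
      case (elim n)
      let ?p = "Re (\<phi> (of_nat n))"
      have p: "0 < ?p" by (rule phi_of_nat_pos[OF elim])
      have "\<phi> (of_nat n + w) - \<phi> (of_nat n)
          = (\<phi> (of_nat n + w) - \<phi> (of_nat n) - w * deriv \<phi> (of_nat n)) + w * deriv \<phi> (of_nat n)"
        by simp
      also have "cmod \<dots> \<le> 2 * cmod w ^ 2 / real n ^ 2 * ?p + cmod w * (?p / real n)"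
      proof (rule norm_triangle_mono)
        show "cmod (\<phi> (of_nat n + w) - \<phi> (of_nat n) - w * deriv \<phi> (of_nat n))
            \<le> 2 * cmod w ^ 2 / real n ^ 2 * ?p"
          using phi_remainder_bound[of "real n" w] elim assms by simp
        show "cmod (w * deriv \<phi> (of_nat n)) \<le> cmod w * (?p / real n)"
          using mult_left_mono[OF deriv_phi_bound[of "real n"], of "cmod w"] elim by (simp add: norm_mult)
      qed
      finally have "cmod (\<phi> (of_nat n + w) - \<phi> (of_nat n)) / ?p \<le> cmod w / real n + 2 * cmod w ^ 2 / real n ^ 2"
        using p elim by (simp add: field_simps)
      moreover have "cmod (\<phi> (of_nat n)) = ?p" using norm_phi_of_real[of "real n"] elim by simp
      moreover from this p have "\<phi> (of_nat n) \<noteq> 0" by auto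
      then have "\<phi> (of_nat n + w) / \<phi> (of_nat n) - 1 = (\<phi> (of_nat n + w) - \<phi> (of_nat n)) / \<phi> (of_nat n)"
        by (simp add: diff_divide_distrib)
      ultimately show ?case by (simp add: norm_divide)
    qed
  qed
  then show ?thesis by (rule LIM_zero_cancel)
qed

definition factor :: "nat \<Rightarrow> complex \<Rightarrow> complex" where
  "factor k z = \<phi> (of_nat (Suc k)) / \<phi> (of_nat (Suc k) + z) *
     exp (deriv \<phi> (of_nat (Suc k)) / \<phi> (of_nat (Suc k)) * z)"

lemma factor_nonzero: "0 \<le> Re z \<Longrightarrow> factor k z \<noteq> 0"
  unfolding factor_def using phi_nonzero[of "of_nat (Suc k)"] phi_nonzero[of "of_nat (Suc k) + z"]
  by simp

text \<open>With \<open>c = \<phi>'(n)/\<phi>(n)\<close> and \<open>q = \<phi>(n + z)/\<phi>(n)\<close>, where \<open>n = k + 1\<close>, the factor is \<open>e\<^sup>c\<^sup>z / q\<close>.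
  Numerator and denominator are both \<open>1 + cz + O(n\<^sup>-\<^sup>2)\<close>, and \<open>|q| \<ge> 1\<close>.\<close>

lemma factor_bound:
  assumes z: "0 \<le> Re z" "cmod z \<le> R"
  shows "cmod (factor k z - 1) \<le> (R ^ 2 * exp R + 2 * R ^ 2) * (1 / real (Suc k) ^ 2)"
proof -
  define n where "n = real (Suc k)"
  have n: "1 \<le> n" by (simp add: n_def)
  define p where "p = Re (\<phi> (of_real n))"
  have p: "0 < p" "\<phi> (of_real n) = of_real p"
    unfolding p_def using phi_pos[of n] phi_of_real[of n] n by auto
  define c where "c = deriv \<phi> (of_real n) / of_real p"
  have c: "cmod c \<le> 1 / n"
  proof -
    have "cmod (deriv \<phi> (of_real n)) \<le> p / n" using deriv_phi_bound[of n] n by (simp add: p_def)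
    moreover have "cmod c = cmod (deriv \<phi> (of_real n)) / p" using p(1) by (simp add: c_def norm_divide)
    ultimately have "cmod c \<le> p / n / p" using p(1) by (simp only: divide_right_mono less_imp_le)
    then show ?thesis using p(1) by simp
  qed
  define s where "s = exp (c * z) - 1 - c * z"
  define r where "r = (\<phi> (of_real n + z) - of_real p - z * deriv \<phi> (of_real n)) / of_real p"
  have R: "0 \<le> R" using z norm_ge_zero order_trans by blast
  have cz: "cmod (c * z) \<le> R / n"
    using mult_mono[OF c z(2)] n R by (simp add: norm_mult)
  have s: "cmod s \<le> R ^ 2 * exp R * (1 / n ^ 2)"
  proof -
    have "cmod s \<le> cmod (c * z) ^ 2 * exp (cmod (c * z))" unfolding s_def by (rule norm_exp_affine_le)
    also have "\<dots> \<le> (R / n) ^ 2 * exp R"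
    proof (intro mult_mono power_mono)
      have "R / n \<le> R / 1" using n R by (intro divide_left_mono) auto
      then show "exp (cmod (c * z)) \<le> exp R" using cz by simp
    qed (use cz in auto)
    finally show ?thesis by (simp add: power_divide)
  qed
  have r: "cmod r \<le> 2 * R ^ 2 * (1 / n ^ 2)"
  proof -
    have "cmod (\<phi> (of_real n + z) - of_real p - z * deriv \<phi> (of_real n)) \<le> 2 * cmod z ^ 2 / n ^ 2 * p"
      using phi_remainder_bound[of n z] n z p unfolding p_def by simp
    then have "cmod r \<le> 2 * cmod z ^ 2 / n ^ 2"
      unfolding r_def using p by (simp add: norm_divide field_simps)
    also have "\<dots> \<le> 2 * R ^ 2 / n ^ 2"
      using z R by (intro divide_right_mono mult_left_mono power_mono) auto
    finally show ?thesis by simp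
  qed
  define q where "q = \<phi> (of_real n + z) / of_real p"
  have q: "1 \<le> cmod q"
    using norm_phi_ge[of n z] n z p(1) by (simp add: q_def p_def norm_divide)
  have "factor k z - 1 = (s - r) / q"
  proof -
    have nz: "\<phi> (of_real n + z) \<noteq> 0" using q p by (auto simp: q_def)
    have "factor k z = exp (c * z) / q"
      unfolding factor_def c_def q_def using p nz by (simp add: n_def divide_simps)
    moreover have "q = 1 + c * z + r" unfolding q_def r_def c_def using p by (simp add: field_simps)
    moreover have "q \<noteq> 0" using q by auto
    ultimately show ?thesis by (simp add: s_def field_simps)
  qed
  then have "cmod (factor k z - 1) = cmod (s - r) / cmod q" by (simp add: norm_divide)
  also have "\<dots> \<le> cmod (s - r) / 1" using q by (intro divide_left_mono) auto
  also have "\<dots> \<le> cmod s + cmod r" by (simp add: norm_triangle_ineq4)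
  also have "\<dots> \<le> (R ^ 2 * exp R + 2 * R ^ 2) * (1 / n ^ 2)" using s r by (simp add: algebra_simps add_divide_distrib)
  finally show ?thesis by (simp add: n_def)
qed

lemma summable_factor_bound: "summable (\<lambda>k. (C::real) * (1 / real (Suc k) ^ 2))"
  using inverse_squares_sums by (intro summable_mult) (auto simp: sums_iff)

lemma factor_convergent:
  assumes "0 \<le> Re z"
  shows "convergent_prod (\<lambda>k. factor k z)"
proof (rule abs_convergent_prod_imp_convergent_prod, rule summable_imp_abs_convergent_prod)
  show "summable (\<lambda>k. norm (factor k z - 1))"
    by (rule summable_comparison_test'[OF summable_factor_bound[of "cmod z ^ 2 * exp (cmod z) + 2 * cmod z ^ 2"], of 0])
       (use factor_bound[OF assms order_refl] in auto)
qed

lemma factor_LIMSEQ: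
  assumes "0 \<le> Re z"
  shows "(\<lambda>n. \<Prod>k<n. factor k z) \<longlonglongrightarrow> (\<Prod>k. factor k z)"
  using has_prod_imp_tendsto'[OF convergent_prod_has_prod[OF factor_convergent[OF assms]]] .

lemma prodinf_factor_nonzero: "0 \<le> Re z \<Longrightarrow> (\<Prod>k. factor k z) \<noteq> 0"
  by (rule prodinf_nonzero[OF factor_convergent factor_nonzero])

lemma phi_holomorphic: "\<phi> holomorphic_on {z. 0 < Re z}"
proof -
  have "\<Phi> holomorphic_on {z. 0 < Re z}"
    using holomorphic_Phi_bf_a by (rule holomorphic_on_subset)
      (auto simp: halfplane_def intro: le_less_trans[OF bf_a_le_0])
  then show ?thesis by (rule holomorphic_transform) (use phi_eq in auto)
qed

lemma factor_holomorphic: "factor k holomorphic_on {z. 0 < Re z}"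
proof -
  have "\<phi> \<circ> (\<lambda>z. of_nat (Suc k) + z) holomorphic_on {z. 0 < Re z}"
    by (rule holomorphic_on_compose_gen[OF _ phi_holomorphic]) (auto intro!: holomorphic_intros)
  then have "(\<lambda>z. \<phi> (of_nat (Suc k) + z)) holomorphic_on {z. 0 < Re z}" by (simp add: comp_def)
  moreover have "\<phi> (of_nat (Suc k) + z) \<noteq> 0" if "0 < Re z" for z
    using that by (intro phi_nonzero) simp
  ultimately show ?thesis unfolding factor_def by (intro holomorphic_intros) auto
qed

lemma prodinf_factor_holomorphic: "(\<lambda>z. \<Prod>k. factor k z) holomorphic_on {z. 0 < Re z}"
proof (rule holomorphic_uniform_sequence)
  show "open {z. 0 < Re z}" by (rule open_halfspace_Re_gt)
  show "(\<lambda>z. \<Prod>k<n. factor k z) holomorphic_on {z. 0 < Re z}" for n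
    by (intro holomorphic_intros factor_holomorphic)
  fix x :: complex assume "x \<in> {z. 0 < Re z}"
  then obtain e where e: "0 < e" "cball x e \<subseteq> {z. 0 < Re z}"
    using open_halfspace_Re_gt open_contains_cball by blast
  define R where "R = cmod x + e"
  have R: "cmod z \<le> R" if "z \<in> cball x e" for z
    using that norm_triangle_ineq2[of z x] by (simp add: R_def dist_norm norm_minus_commute)
  have "uniformly_convergent_on (cball x e) (\<lambda>N z. \<Prod>n<N. factor n z)"
  proof (rule uniformly_convergent_on_prod')
    show "continuous_on (cball x e) (factor n)" for n
      using factor_holomorphic e(2) holomorphic_on_imp_continuous_on continuous_on_subset by blast
    show "uniformly_convergent_on (cball x e) (\<lambda>N z. \<Sum>n<N. norm (factor n z - 1))"
    proof (rule Weierstrass_m_test'[OF _ summable_factor_bound])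
      fix n z assume z: "z \<in> cball x e"
      then have "0 \<le> Re z" using e by force
      from factor_bound[OF this R[OF z]]
      show "norm (norm (factor n z - 1)) \<le> (R ^ 2 * exp R + 2 * R ^ 2) * (1 / real (Suc n) ^ 2)"
        by simp
    qed
  qed simp
  then obtain l where l: "uniform_limit (cball x e) (\<lambda>N z. \<Prod>n<N. factor n z) l sequentially"
    by (auto simp: uniformly_convergent_on_def)
  moreover have "l z = (\<Prod>k. factor k z)" if z: "z \<in> cball x e" for z
  proof (rule LIMSEQ_unique)
    show "(\<lambda>n. \<Prod>k<n. factor k z) \<longlonglongrightarrow> l z" by (rule tendsto_uniform_limitI[OF l z])
    have "0 \<le> Re z" using e z by force
    then show "(\<lambda>n. \<Prod>k<n. factor k z) \<longlonglongrightarrow> (\<Prod>k. factor k z)" by (rule factor_LIMSEQ)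
  qed
  ultimately have "uniform_limit (cball x e) (\<lambda>N z. \<Prod>n<N. factor n z) (\<lambda>z. \<Prod>k. factor k z) sequentially"
    using uniform_limit_cong' by (metis (no_types, lifting))
  with e show "\<exists>d>0. cball x d \<subseteq> {z. 0 < Re z} \<and>
      uniform_limit (cball x d) (\<lambda>N z. \<Prod>n<N. factor n z) (\<lambda>z. \<Prod>k. factor k z) sequentially" by blast
qed

lemma W_prod_eq: "W_prod \<phi> z = exp (- of_real (bf_gamma \<phi>) * z) / \<phi> z * (\<Prod>k. factor k z)"
  by (simp add: W_prod_def factor_def)

lemma W_prod_nonzero: "0 < Re z \<Longrightarrow> W_prod \<phi> z \<noteq> 0"
  using prodinf_factor_nonzero[of z] phi_nonzero[of z] by (simp add: W_prod_eq)

lemma W_prod_holomorphic: "W_prod \<phi> holomorphic_on {z. 0 < Re z}"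
  unfolding W_prod_eq using phi_nonzero
  by (auto intro!: holomorphic_intros phi_holomorphic prodinf_factor_holomorphic)

definition gamma_seq :: "nat \<Rightarrow> real" where
  "gamma_seq n = (\<Sum>k=1..n. Re (deriv \<phi> (of_nat k) / \<phi> (of_nat k))) - ln (Re (\<phi> (of_nat n)))"

lemma deriv_phi_ratio_real:
  assumes "0 < k"
  shows "deriv \<phi> (of_nat k) / \<phi> (of_nat k) = of_real (Re (deriv \<phi> (of_nat k) / \<phi> (of_nat k)))"
proof -
  have "deriv \<phi> (of_nat k) = of_real (d + real_moment 1 (real k))"
    using deriv_phi[of "of_nat k"] moment_of_real[of 1 "real k"] assms by simp
  then show ?thesis by (subst (1 2) phi_of_nat) (metis Re_complex_of_real of_real_divide)
qed

lemma prod_factor: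
  "(\<Prod>k<n. factor k z) = (\<Prod>k=1..n. \<phi> (of_nat k) / \<phi> (of_nat k + z))
      * exp (of_real (\<Sum>k=1..n. Re (deriv \<phi> (of_nat k) / \<phi> (of_nat k))) * z)"
proof -
  have "(\<Prod>k<n. factor k z) = (\<Prod>k<n. \<phi> (of_nat (Suc k)) / \<phi> (of_nat (Suc k) + z))
      * exp (\<Sum>k<n. deriv \<phi> (of_nat (Suc k)) / \<phi> (of_nat (Suc k)) * z)"
    unfolding factor_def by (simp only: prod.distrib exp_sum finite_lessThan)
  also have "(\<Sum>k<n. deriv \<phi> (of_nat (Suc k)) / \<phi> (of_nat (Suc k)) * z)
      = (\<Sum>k<n. of_real (Re (deriv \<phi> (of_nat (Suc k)) / \<phi> (of_nat (Suc k)))) * z)"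
    by (rule sum.cong[OF refl]) (metis deriv_phi_ratio_real zero_less_Suc)
  also have "\<dots> = of_real (\<Sum>k<n. Re (deriv \<phi> (of_nat (Suc k)) / \<phi> (of_nat (Suc k)))) * z"
    by (simp only: of_real_sum sum_distrib_right)
  finally show ?thesis
    by (simp only: prod.atLeast1_atMost_eq sum.atLeast1_atMost_eq One_nat_def)
qed

lemma telescope:
  "(\<Prod>k=1..n. \<phi> (of_nat k) / \<phi> (of_nat k + 1)) = \<phi> 1 / \<phi> (of_nat (Suc n))"
proof (induction n)
  case 0
  then show ?case using phi_nonzero[of 1] by simp
next
  case (Suc n)
  then show ?case using phi_nonzero[of "of_nat (Suc n)"] by (simp add: add.commute)
qed

text \<open>At \<open>z = 1\<close> the product telescopes, and the logarithm of its modulus is the sequence that defines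
  \<open>\<gamma>\<close>, up to a constant and a null sequence.\<close>

lemma gamma_convergent: "gamma_seq \<longlonglongrightarrow> bf_gamma \<phi>"
proof -
  let ?c = "\<lambda>k. Re (deriv \<phi> (of_nat k) / \<phi> (of_nat k))"
  let ?p = "\<lambda>k. Re (\<phi> (of_nat k))"
  have c0: "(\<lambda>n. ?c (Suc n)) \<longlonglongrightarrow> 0"
  proof (rule Lim_null_comparison[OF _ LIMSEQ_inverse_real_of_nat])
    show "eventually (\<lambda>n. norm (?c (Suc n)) \<le> inverse (real (Suc n))) sequentially"
    proof (rule always_eventually, rule allI)
      fix n
      have "norm (?c (Suc n)) \<le> cmod (deriv \<phi> (of_nat (Suc n)) / \<phi> (of_nat (Suc n)))"
        using abs_Re_le_cmod by simp
      also have "\<dots> \<le> inverse (real (Suc n))"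
        using deriv_phi_bound[of "real (Suc n)"] phi_of_nat_pos[of "Suc n"] norm_phi_of_real[of "real (Suc n)"]
        by (simp add: norm_divide field_simps)
      finally show "norm (?c (Suc n)) \<le> inverse (real (Suc n))" .
    qed
  qed
  define P where "P n = (\<Prod>k<n. factor k 1)" for n
  have P: "cmod (P n) = ?p 1 / ?p (Suc n) * exp (\<Sum>k=1..n. ?c k)" for n
  proof -
    have "P n = of_real (?p 1 / ?p (Suc n) * exp (\<Sum>k=1..n. ?c k))"
      unfolding P_def prod_factor telescope using phi_of_nat[of 1] phi_of_nat[of "Suc n"]
      by (simp only: of_real_mult of_real_divide of_nat_1 mult_1_right exp_of_real)
    then show ?thesis using phi_of_nat_pos[of 1] phi_of_nat_pos[of "Suc n"]
      by (simp only: norm_of_real) (simp del: of_nat_Suc)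
  qed
  have "(\<lambda>n. ln (cmod (P n)) - ln (?p 1) + ?c (Suc n)) \<longlonglongrightarrow> ln (cmod (\<Prod>k. factor k 1)) - ln (?p 1) + 0"
    unfolding P_def by (intro tendsto_intros c0 factor_LIMSEQ) (use prodinf_factor_nonzero[of 1] in auto)
  moreover have "ln (cmod (P n)) - ln (?p 1) + ?c (Suc n) = gamma_seq (Suc n)" for n
    unfolding P gamma_seq_def using phi_of_nat_pos[of 1] phi_of_nat_pos[of "Suc n"]
    by (simp add: ln_mult ln_div del: of_nat_Suc)
  ultimately have "(\<lambda>n. gamma_seq (Suc n)) \<longlonglongrightarrow> ln (cmod (\<Prod>k. factor k 1)) - ln (?p 1) + 0" by simp
  then have "gamma_seq \<longlonglongrightarrow> ln (cmod (\<Prod>k. factor k 1)) - ln (?p 1) + 0"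
    by (simp only: filterlim_sequentially_Suc)
  moreover from this have "bf_gamma \<phi> = ln (cmod (\<Prod>k. factor k 1)) - ln (?p 1) + 0"
    unfolding bf_gamma_def gamma_seq_def by (rule limI)
  ultimately show ?thesis by simp
qed

text \<open>The analogue of Gauss's limit formula for the gamma function: the exponential factors of the
  first \<open>n\<close> terms and \<open>e\<^sup>-\<^sup>\<gamma>\<^sup>z\<close> combine, in the limit, to \<open>\<phi>(n)\<^sup>z\<close>.\<close>

lemma Gauss_limit:
  assumes "0 < Re z"
  shows "(\<lambda>n. exp (z * of_real (ln (Re (\<phi> (of_nat n))))) / \<phi> z * (\<Prod>k=1..n. \<phi> (of_nat k) / \<phi> (of_nat k + z)))
    \<longlonglongrightarrow> W_prod \<phi> z"
proof -
  have "(\<lambda>n. exp (- of_real (gamma_seq n) * z) / \<phi> z * (\<Prod>k<n. factor k z)) \<longlonglongrightarrow> W_prod \<phi> z"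
    unfolding W_prod_eq using phi_nonzero[OF assms] assms
    by (intro tendsto_intros gamma_convergent factor_LIMSEQ) auto
  moreover have "exp (- of_real (gamma_seq n) * z) / \<phi> z * (\<Prod>k<n. factor k z)
      = exp (z * of_real (ln (Re (\<phi> (of_nat n))))) / \<phi> z * (\<Prod>k=1..n. \<phi> (of_nat k) / \<phi> (of_nat k + z))" for n
  proof -
    let ?S = "\<Sum>k=1..n. Re (deriv \<phi> (of_nat k) / \<phi> (of_nat k))"
    have "exp (- of_real (gamma_seq n) * z) * exp (of_real ?S * z) = exp (z * of_real (ln (Re (\<phi> (of_nat n)))))"
      unfolding gamma_seq_def exp_add[symmetric] by (rule arg_cong[where f = exp]) (simp add: algebra_simps)
    from this[symmetric] show ?thesis unfolding prod_factor by (simp only: divide_inverse mult_ac)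
  qed
  ultimately show ?thesis by (simp only:)
qed

text \<open>Replacing \<open>z\<close> by \<open>z + 1\<close> in the Gauss limit shifts the denominators by one, which costs the factor
  \<open>\<phi>(z) \<phi>(n) / \<phi>(n + z + 1)\<close>; its limit is \<open>\<phi>(z)\<close>.\<close>

lemma W_prod_recurrence:
  assumes "0 < Re z"
  shows "W_prod \<phi> (z + 1) = \<phi> z * W_prod \<phi> z"
proof (rule LIMSEQ_unique)
  let ?G = "\<lambda>z n. exp (z * of_real (ln (Re (\<phi> (of_nat n))))) / \<phi> z * (\<Prod>k=1..n. \<phi> (of_nat k) / \<phi> (of_nat k + z))"
  show "?G (z + 1) \<longlonglongrightarrow> W_prod \<phi> (z + 1)" by (rule Gauss_limit) (use assms in simp)
  have "(\<lambda>n. ?G z n * \<phi> z / (\<phi> (of_nat n + (z + 1)) / \<phi> (of_nat n))) \<longlonglongrightarrow> W_prod \<phi> z * \<phi> z / 1"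
    by (intro tendsto_intros Gauss_limit phi_ratio_tendsto) (use assms in auto)
  moreover have "eventually (\<lambda>n. ?G z n * \<phi> z / (\<phi> (of_nat n + (z + 1)) / \<phi> (of_nat n)) = ?G (z + 1) n) sequentially"
    using eventually_gt_at_top[of 0]
  proof eventually_elim
    case (elim n)
    have nz: "\<phi> (of_nat k + z) \<noteq> 0" for k using assms by (intro phi_nonzero) simp
    have "(\<Prod>k=1..n. \<phi> (of_nat k) / \<phi> (of_nat k + (z + 1))) / \<phi> (z + 1)
        = (\<Prod>k=1..n. \<phi> (of_nat k) / \<phi> (of_nat k + z)) / \<phi> (of_nat n + (z + 1))" for n
    proof (induction n)
      case 0
      then show ?case by simp
    next
      case (Suc n)
      have "(\<Prod>k=1..Suc n. \<phi> (of_nat k) / \<phi> (of_nat k + (z + 1))) / \<phi> (z + 1)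
         = ((\<Prod>k=1..n. \<phi> (of_nat k) / \<phi> (of_nat k + (z + 1))) / \<phi> (z + 1))
            * (\<phi> (of_nat (Suc n)) / \<phi> (of_nat (Suc n) + (z + 1)))"
        by (simp add: prod.nat_ivl_Suc')
      also have "\<dots> = (\<Prod>k=1..Suc n. \<phi> (of_nat k) / \<phi> (of_nat k + z)) / \<phi> (of_nat (Suc n) + (z + 1))"
        unfolding Suc.IH by (simp add: prod.nat_ivl_Suc' add_ac)
      finally show ?case .
    qed
    note prod = this[of n]
    have "exp ((z + 1) * of_real (ln (Re (\<phi> (of_nat n))))) = exp (z * of_real (ln (Re (\<phi> (of_nat n))))) * \<phi> (of_nat n)"
      by (simp add: distrib_right exp_add exp_ln_phi[OF elim])
    then have G: "?G (z + 1) n = exp (z * of_real (ln (Re (\<phi> (of_nat n))))) * \<phi> (of_nat n) *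
        ((\<Prod>k=1..n. \<phi> (of_nat k) / \<phi> (of_nat k + (z + 1))) / \<phi> (z + 1))"
      by (simp only: divide_inverse mult_ac)
    show ?case unfolding G prod using nz[of 0] by simp
  qed
  ultimately have "?G (z + 1) \<longlonglongrightarrow> W_prod \<phi> z * \<phi> z / 1" by (rule Lim_transform_eventually)
  then show "?G (z + 1) \<longlonglongrightarrow> \<phi> z * W_prod \<phi> z" by (simp add: mult.commute)
qed

lemma W_prod_1: "W_prod \<phi> 1 = 1"
proof (rule LIMSEQ_unique)
  let ?G = "\<lambda>z n. exp (z * of_real (ln (Re (\<phi> (of_nat n))))) / \<phi> z * (\<Prod>k=1..n. \<phi> (of_nat k) / \<phi> (of_nat k + z))"
  show "?G 1 \<longlonglongrightarrow> W_prod \<phi> 1" by (rule Gauss_limit) simp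
  have "(\<lambda>n. 1 / (\<phi> (of_nat n + 1) / \<phi> (of_nat n))) \<longlonglongrightarrow> 1 / 1"
    by (intro tendsto_intros phi_ratio_tendsto) auto
  moreover have "eventually (\<lambda>n. 1 / (\<phi> (of_nat n + 1) / \<phi> (of_nat n)) = ?G 1 n) sequentially"
    using eventually_gt_at_top[of 0]
  proof eventually_elim
    case (elim n)
    have "\<phi> (of_nat (Suc n)) = \<phi> (of_nat n + 1)" by (simp add: add.commute)
    note telescope[of n, unfolded this]
    moreover have "exp (1 * complex_of_real (ln (Re (\<phi> (of_nat n))))) = \<phi> (of_nat n)"
      using exp_ln_phi[OF elim] by simp
    ultimately show ?case using phi_nonzero[of 1] by simp
  qed
  ultimately have "?G 1 \<longlonglongrightarrow> 1 / 1" by (rule Lim_transform_eventually)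
  then show "?G 1 \<longlonglongrightarrow> 1" by simp
qed

end

section \<open>The Bernstein-gamma function to the left of the imaginary axis\<close>

context bernstein_function
begin

lemma W_eq_W_prod: "0 < Re z \<Longrightarrow> W \<phi> z = W_prod \<phi> z"
  by (subst W.simps) simp

lemma W_1: "W \<phi> 1 = 1"
  by (simp add: W_eq_W_prod W_prod_1)

lemma W_shift:
  assumes "bf_a \<phi> < ereal (Re z) \<or> 0 \<le> Re z"
  shows "W \<phi> z = W \<phi> (z + 1) / \<Phi> z"
proof (cases "0 < Re z")
  case True
  then have "W \<phi> (z + 1) = \<phi> z * W \<phi> z" by (simp add: W_eq_W_prod W_prod_recurrence)
  then show ?thesis using phi_nonzero[OF True] phi_eq[of z] True by simp
next
  case False
  then show ?thesis by (subst W.simps) (simp add: bf_ext_eq_Phi[OF assms])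
qed

lemma W_shift_iterated:
  assumes "bf_a \<phi> < ereal (Re z) \<or> 0 \<le> Re z"
  shows "W \<phi> z = W \<phi> (z + of_nat m) / (\<Prod>j<m. \<Phi> (z + of_nat j))"
proof (induction m)
  case (Suc m)
  have "bf_a \<phi> < ereal (Re (z + of_nat m)) \<or> 0 \<le> Re (z + of_nat m)"
    using assms by (auto intro: less_le_trans)
  from W_shift[OF this] Suc show ?case by (simp add: add_ac)
qed simp

lemma W_nonzero_pos: "0 < Re z \<Longrightarrow> W \<phi> z \<noteq> 0"
  by (simp add: W_eq_W_prod W_prod_nonzero)

lemma W_holomorphic_pos: "W \<phi> holomorphic_on {z. 0 < Re z}"
  by (rule holomorphic_transform[OF W_prod_holomorphic]) (simp add: W_eq_W_prod)

lemma prod_Phi_holomorphic: "(\<lambda>z. \<Prod>j<m. \<Phi> (z + of_nat j)) holomorphic_on halfplane (bf_a \<phi>)"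
proof (intro holomorphic_intros)
  fix j
  have "\<Phi> \<circ> (\<lambda>z. z + of_nat j) holomorphic_on halfplane (bf_a \<phi>)"
    by (rule holomorphic_on_compose_gen[OF _ holomorphic_Phi_bf_a])
       (auto intro!: holomorphic_intros simp: halfplane_def intro: less_le_trans)
  then show "(\<lambda>z. \<Phi> (z + of_nat j)) holomorphic_on halfplane (bf_a \<phi>)" by (simp add: comp_def)
qed

text \<open>Near a point \<open>z\<close> the function \<open>W\<close> is the quotient of a zero-free holomorphic function by a
  product of shifts of \<open>\<Phi>\<close>: as soon as the shift leads into the right half-plane, all zeros and
  poles are read off from that product.\<close>

lemma W_eventually_quotient:
  assumes "z \<in> halfplane (bf_a \<phi>)"
  shows "eventually (\<lambda>w. W \<phi> w = W \<phi> (w + of_nat m) / (\<Prod>j<m. \<Phi> (w + of_nat j))) (nhds z)"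
  using eventually_nhds_in_open[OF open_halfplane assms]
  by (rule eventually_mono) (auto simp: halfplane_def intro: W_shift_iterated)

lemma W_translate_analytic:
  assumes "0 < Re z + real m"
  shows "(\<lambda>w. W \<phi> (w + of_nat m)) analytic_on {z}"
proof -
  have "W \<phi> \<circ> (\<lambda>w. w + of_nat m) holomorphic_on {w. - real m < Re w}"
    by (rule holomorphic_on_compose_gen[OF _ W_holomorphic_pos]) (auto intro!: holomorphic_intros)
  then show ?thesis
    unfolding comp_def using assms open_halfspace_Re_gt[of "- real m"]
    by (auto simp: analytic_at)
qed

lemma prod_Phi_analytic:
  assumes "z \<in> halfplane (bf_a \<phi>)"
  shows "(\<lambda>w. \<Prod>j<m. \<Phi> (w + of_nat j)) analytic_on {z}"
  using prod_Phi_holomorphic open_halfplane assms by (auto simp: analytic_at)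

lemma W_analytic_nonzero:
  assumes z: "z \<in> halfplane (bf_a \<phi>)" and m: "0 < Re z + real m"
    and nz: "(\<Prod>j<m. \<Phi> (z + of_nat j)) \<noteq> 0"
  shows "W \<phi> analytic_on {z}" "W \<phi> z \<noteq> 0"
proof -
  have "(\<lambda>w. W \<phi> (w + of_nat m) / (\<Prod>j<m. \<Phi> (w + of_nat j))) analytic_on {z}"
    using W_translate_analytic[OF m] prod_Phi_analytic[OF z] nz by (intro analytic_on_divide) auto
  then show "W \<phi> analytic_on {z}"
    using analytic_at_cong[OF W_eventually_quotient[OF z, of m] refl] by simp
  show "W \<phi> z \<noteq> 0"
    using W_shift_iterated[of z m] z W_nonzero_pos[of "z + of_nat m"] m nz by (auto simp: halfplane_def)
qed

lemma W_pole:
  assumes z: "z \<in> halfplane (bf_a \<phi>)" and m: "0 < Re z + real m"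
    and zero: "(\<Prod>j<m. \<Phi> (z + of_nat j)) = 0"
  shows "is_pole (W \<phi>) z" "W \<phi> z = 0"
proof -
  show "W \<phi> z = 0" using W_shift_iterated[of z m] z zero by (simp add: halfplane_def)
  let ?B = "\<lambda>w. \<Prod>j<m. \<Phi> (w + of_nat j)"
  have "1 \<in> halfplane (bf_a \<phi>)"
    using le_less_trans[OF bf_a_le_0[of \<phi>], of "ereal 1"] by (simp add: halfplane_def)
  moreover have "\<Phi> (1 + of_nat j) \<noteq> 0" for j
    using phi_nonzero[of "1 + of_nat j"] phi_eq[of "1 + of_nat j"] by simp
  then have "?B 1 \<noteq> 0" by simp
  ultimately have "eventually (\<lambda>w. ?B w \<noteq> 0 \<and> w \<in> halfplane (bf_a \<phi>)) (at z)"
    by (intro non_zero_neighbour_alt[OF prod_Phi_holomorphic open_halfplane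
          convex_connected[OF convex_halfplane] z])
  then have "eventually (\<lambda>w. ?B w \<noteq> 0) (at z)" by (rule eventually_mono) simp
  moreover have "isCont ?B z" using analytic_at_imp_isCont[OF prod_Phi_analytic[OF z]] .
  then have "?B \<midarrow>z\<rightarrow> 0" using zero by (simp add: isCont_def)
  ultimately have "filterlim ?B (at 0) (at z)" by (intro filterlim_atI)
  moreover have "isCont (\<lambda>w. W \<phi> (w + of_nat m)) z"
    using analytic_at_imp_isCont[OF W_translate_analytic[OF m]] .
  moreover have "W \<phi> (z + of_nat m) \<noteq> 0" using m by (intro W_nonzero_pos) simp
  ultimately have "is_pole (\<lambda>w. W \<phi> (w + of_nat m) / ?B w) z" by (intro is_pole_divide)
  then show "is_pole (W \<phi>) z"
  proof (rule is_pole_transform)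
    show "eventually (\<lambda>w. W \<phi> (w + of_nat m) / ?B w = W \<phi> w) (at z)"
      using eventually_nhds_conv_at[THEN iffD1, OF W_eventually_quotient[OF z, of m]]
      by (auto elim: eventually_mono)
  qed simp
qed

lemma exists_shift: "\<exists>m. 0 < Re z + real m"
proof -
  obtain m where "- Re z < real m" using reals_Archimedean2 by blast
  then have "0 < Re z + real m" by linarith
  then show ?thesis by blast
qed

text \<open>Poles are those points where a division by zero occurs in the recurrence, and there \<open>W\<close> takes the
  conventional value \<open>0\<close>; at all other points \<open>W\<close> is not zero.\<close>

lemma W_pole_iff:
  assumes "z \<in> halfplane (bf_a \<phi>)"
  shows "is_pole (W \<phi>) z \<longleftrightarrow> W \<phi> z = 0"
proof -
  obtain m where m: "0 < Re z + real m" using exists_shift by blast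
  show ?thesis
    using W_pole[OF assms m] W_analytic_nonzero[OF assms m] analytic_at_imp_no_pole by blast
qed

lemma W_analytic_at:
  assumes "z \<in> halfplane (bf_a \<phi>)" "W \<phi> z \<noteq> 0"
  shows "W \<phi> analytic_on {z}"
proof -
  obtain m where m: "0 < Re z + real m" using exists_shift by blast
  show ?thesis using W_pole[OF assms(1) m] W_analytic_nonzero[OF assms(1) m] assms(2) by blast
qed

lemma W_nicely_meromorphic: "W \<phi> nicely_meromorphic_on halfplane (bf_a \<phi>)"
  unfolding nicely_meromorphic_on_def
proof (intro conjI ballI)
  fix z assume z: "z \<in> halfplane (bf_a \<phi>)"
  show "is_pole (W \<phi>) z \<and> W \<phi> z = 0 \<or> W \<phi> \<midarrow>z\<rightarrow> W \<phi> z"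
    using W_pole_iff[OF z] analytic_at_imp_isCont[OF W_analytic_at[OF z]] by (auto simp: isCont_def)
next
  show "W \<phi> meromorphic_on halfplane (bf_a \<phi>)"
  proof (subst meromorphic_on_meromorphic_at, rule ballI)
    fix z assume z: "z \<in> halfplane (bf_a \<phi>)"
    obtain m where m: "0 < Re z + real m" using exists_shift by blast
    have "(\<lambda>w. W \<phi> (w + of_nat m) / (\<Prod>j<m. \<Phi> (w + of_nat j))) meromorphic_on {z}"
      using W_translate_analytic[OF m] prod_Phi_analytic[OF z]
      by (intro meromorphic_on_divide analytic_on_imp_meromorphic_on)
    moreover have "eventually (\<lambda>w. W \<phi> w = W \<phi> (w + of_nat m) / (\<Prod>j<m. \<Phi> (w + of_nat j))) (at z)"
      using W_eventually_quotient[OF z, of m] by (simp add: eventually_nhds_conv_at)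
    ultimately show "W \<phi> meromorphic_on {z}"
      by (subst meromorphic_on_cong) auto
  qed
qed

lemma W_holomorphic: "W \<phi> holomorphic_on halfplane (bf_abar \<phi>)"
proof -
  have "W \<phi> analytic_on {z}" if "z \<in> halfplane (bf_abar \<phi>)" for z
  proof -
    obtain m where m: "0 < Re z + real m" using exists_shift by blast
    have "z \<in> halfplane (bf_a \<phi>)" using that by (simp add: halfplane_def bf_abar_def)
    moreover have "\<Phi> (z + of_nat j) \<noteq> 0" for j
      by (rule Phi_nonzero) (use that in \<open>auto simp: halfplane_def intro: less_le_trans\<close>)
    then have "(\<Prod>j<m. \<Phi> (z + of_nat j)) \<noteq> 0" by simp
    ultimately show ?thesis using W_analytic_nonzero m by blast
  qed
  then have "W \<phi> analytic_on halfplane (bf_abar \<phi>)" using analytic_on_analytic_at by blast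
  then show ?thesis by (rule analytic_imp_holomorphic)
qed

lemma W_plus_1_holomorphic: "(\<lambda>z. W \<phi> (z + 1)) holomorphic_on halfplane (bf_abar \<phi> - 1)"
proof -
  have "W \<phi> \<circ> (\<lambda>z. z + 1) holomorphic_on halfplane (bf_abar \<phi> - 1)"
    by (rule holomorphic_on_compose_gen[OF _ W_holomorphic])
       (auto intro!: holomorphic_intros simp: halfplane_def ereal_minus_less one_ereal_def)
  then show ?thesis by (simp add: comp_def)
qed

section \<open>Boundary behaviour\<close>

lemma bf_zeros_eq:
  assumes "admissible u" "bf_a \<phi> \<le> ereal u"
  shows "bf_zeros u \<phi> = {z. Re z = u \<and> \<Phi> z = 0}"
  using bf_dom_boundary[OF assms] bf_ext_boundary[OF assms] by (auto simp: bf_zeros_def vline_def)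

lemma bf_zeros_0: "bf_zeros 0 \<phi> = {z. Re z = 0 \<and> \<Phi> z = 0}"
  by (rule bf_zeros_eq[OF admissible_0]) (use bf_a_le_0 in \<open>simp add: zero_ereal_def[symmetric]\<close>)

lemma continuous_on_W_quotient:
  assumes "admissible v" "bf_abar \<phi> \<le> ereal v" "T \<subseteq> {z. v \<le> Re z \<and> \<Phi> z \<noteq> 0}"
  shows "continuous_on T (\<lambda>z. W \<phi> (z + 1) / \<Phi> z)"
proof (intro continuous_intros)
  have "T \<subseteq> halfplane (bf_abar \<phi> - 1)"
  proof
    fix z assume "z \<in> T"
    then have "ereal v < ereal (Re z + 1)" using assms(3) by auto
    with assms(2) have "bf_abar \<phi> < ereal (Re z + 1)" by (rule le_less_trans)
    then show "z \<in> halfplane (bf_abar \<phi> - 1)"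
      by (auto simp: halfplane_def ereal_minus_less one_ereal_def)
  qed
  then show "continuous_on T (\<lambda>z. W \<phi> (z + 1))"
    using W_plus_1_holomorphic holomorphic_on_imp_continuous_on continuous_on_subset
    by blast
  show "continuous_on T \<Phi>"
    by (rule continuous_on_subset[OF continuous_on_Phi[OF assms(1)]]) (use assms(3) in auto)
qed (use assms in auto)

lemma eventually_bf_ext_eq_Phi:
  assumes "bf_a \<phi> < ereal (Re z)"
  shows "eventually (\<lambda>w. bf_ext \<phi> w = \<Phi> w) (nhds z)"
  using eventually_nhds_in_open[OF open_halfplane, of z "bf_a \<phi>"] assms
  by (auto elim!: eventually_mono simp: halfplane_def bf_ext_eq_Phi)

lemma higher_deriv_bf_ext:
  assumes "bf_a \<phi> < ereal (Re z)"
  shows "(deriv ^^ n) (bf_ext \<phi>) z = (deriv ^^ n) \<Phi> z"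
  by (rule higher_deriv_cong_ev[OF eventually_bf_ext_eq_Phi[OF assms] refl])

lemma deriv_bf_ext:
  assumes "bf_a \<phi> < ereal (Re z)"
  shows "deriv (bf_ext \<phi>) z = of_real d + moment 1 z"
    and "(deriv ^^ 2) (bf_ext \<phi>) z = - moment 2 z"
proof -
  obtain v where v: "bf_a \<phi> < ereal v" "v < Re z"
    using ereal_dense2[OF assms] by (metis less_ereal.simps(1))
  note adm = admissible_of_bf_a[OF v(1)]
  show "deriv (bf_ext \<phi>) z = of_real d + moment 1 z"
    using higher_deriv_bf_ext[OF assms, of 1] deriv_Phi[OF adm v(2)] by simp
  show "(deriv ^^ 2) (bf_ext \<phi>) z = - moment 2 z"
    using higher_deriv_bf_ext[OF assms, of 2] higher_deriv_Phi[OF adm v(2), of 0]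
    by (simp add: numeral_2_eq_2)
qed

text \<open>The derivatives of \<open>\<phi>\<close> on the real axis are monotone, so their right limits are given by
  the integrals at the end point, whether these converge or not.\<close>

lemma real_moment_tendsto:
  assumes adm: "\<And>x. v < x \<Longrightarrow> admissible x" and n: "1 \<le> n"
  shows "((\<lambda>x. ereal (real_moment n x)) \<longlongrightarrow> enn2ereal (\<integral>\<^sup>+ y. ennreal (y ^ n * exp (- v * y)) \<partial>\<mu>)) (at_right v)"
proof (rule tendsto_at_right_sequentially[of v "v + 1"])
  fix S :: "nat \<Rightarrow> real"
  assume S: "\<And>i. v < S i" "decseq S" "S \<longlonglongrightarrow> v"
  \<comment> \<open>Replacing \<open>y\<close> by its positive part makes the sequence monotone on the whole line.\<close>
  define f where "f i y = ennreal (max 0 y ^ n * exp (- S i * max 0 y))" for i and y :: real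
  have f_eq: "(\<integral>\<^sup>+ y. f i y \<partial>\<mu>) = ennreal (real_moment n (S i))" for i
  proof -
    obtain x where x: "v < x" "x < S i" using dense[OF S(1)] by blast
    have "(\<integral>\<^sup>+ y. f i y \<partial>\<mu>) = (\<integral>\<^sup>+ y. ennreal (y ^ n * exp (- S i * y)) \<partial>\<mu>)"
      by (rule nn_integral_cong) (simp add: f_def)
    also have "\<dots> = ennreal (real_moment n (S i))"
      unfolding real_moment_def
      by (rule nn_integral_eq_integral[OF integrable_real_moment[OF adm[OF x(1)] x(2) n]]) (auto intro!: AE_I2)
    finally show ?thesis .
  qed
  have inc: "incseq f"
  proof (intro incseq_SucI le_funI)
    fix i y
    have "S (Suc i) * max 0 y \<le> S i * max 0 y"
      using S(2) by (intro mult_right_mono) (auto simp: decseq_Suc_iff)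
    then show "f i y \<le> f (Suc i) y" by (auto simp: f_def intro!: ennreal_leI mult_left_mono)
  qed
  have "(SUP i. f i y) = ennreal (max 0 y ^ n * exp (- v * max 0 y))" for y
  proof (rule LIMSEQ_unique[OF LIMSEQ_SUP])
    show "incseq (\<lambda>i. f i y)" using inc by (auto simp: incseq_def le_fun_def)
    show "(\<lambda>i. f i y) \<longlonglongrightarrow> ennreal (max 0 y ^ n * exp (- v * max 0 y))"
      unfolding f_def by (intro tendsto_intros S)
  qed
  then have "(\<integral>\<^sup>+ y. (SUP i. f i y) \<partial>\<mu>) = (\<integral>\<^sup>+ y. ennreal (y ^ n * exp (- v * y)) \<partial>\<mu>)"
    by (intro nn_integral_cong) simp
  moreover have "f i \<in> borel_measurable \<mu>" for i
    unfolding f_def by (intro measurable_compose[OF _ measurable_ennreal] measurable_cont continuous_intros)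
  then have "(\<integral>\<^sup>+ y. (SUP i. f i y) \<partial>\<mu>) = (SUP i. \<integral>\<^sup>+ y. f i y \<partial>\<mu>)"
    by (rule nn_integral_monotone_convergence_SUP[OF inc])
  moreover have "(\<lambda>i. \<integral>\<^sup>+ y. f i y \<partial>\<mu>) \<longlonglongrightarrow> (SUP i. \<integral>\<^sup>+ y. f i y \<partial>\<mu>)"
    using inc by (intro LIMSEQ_SUP) (auto simp: incseq_def le_fun_def intro!: nn_integral_mono)
  ultimately have "(\<lambda>i. ennreal (real_moment n (S i))) \<longlonglongrightarrow> (\<integral>\<^sup>+ y. ennreal (y ^ n * exp (- v * y)) \<partial>\<mu>)"
    by (simp add: f_eq)
  then have "(\<lambda>i. enn2ereal (ennreal (real_moment n (S i)))) \<longlonglongrightarrow> enn2ereal (\<integral>\<^sup>+ y. ennreal (y ^ n * exp (- v * y)) \<partial>\<mu>)"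
    by (rule tendsto_enn2erealI)
  moreover have "0 \<le> real_moment n (S i)" for i
    unfolding real_moment_def by (rule Bochner_Integration.integral_nonneg) auto
  ultimately show "(\<lambda>i. ereal (real_moment n (S i))) \<longlonglongrightarrow> enn2ereal (\<integral>\<^sup>+ y. ennreal (y ^ n * exp (- v * y)) \<partial>\<mu>)"
    by (simp add: enn2ereal_ennreal)
qed simp

lemma
  assumes "bf_a \<phi> \<le> ereal v"
  shows right_lim_deriv: "right_lim (deriv (bf_ext \<phi>)) v = ereal d + enn2ereal (\<integral>\<^sup>+ y. ennreal (y * exp (- v * y)) \<partial>\<mu>)"
    and right_lim_deriv2: "right_lim ((deriv ^^ 2) (bf_ext \<phi>)) v = - enn2ereal (\<integral>\<^sup>+ y. ennreal (y ^ 2 * exp (- v * y)) \<partial>\<mu>)"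
proof -
  have a: "bf_a \<phi> < ereal x" if "v < x" for x using assms that by (auto intro: le_less_trans)
  then have adm: "admissible x" if "v < x" for x using that admissible_of_bf_a by blast
  have ev: "eventually (\<lambda>x. v < x) (at_right v)" by (simp add: eventually_at_right_less)
  have "((\<lambda>x. ereal d + ereal (real_moment 1 x)) \<longlongrightarrow> ereal d + enn2ereal (\<integral>\<^sup>+ y. ennreal (y ^ 1 * exp (- v * y)) \<partial>\<mu>)) (at_right v)"
    by (intro tendsto_add_ereal_general tendsto_const real_moment_tendsto adm) auto
  moreover have "eventually (\<lambda>x. ereal d + ereal (real_moment 1 x) = ereal (Re (deriv (bf_ext \<phi>) (of_real x)))) (at_right v)"
    using ev by eventually_elim (simp add: deriv_bf_ext a moment_of_real del: One_nat_def)
  ultimately have "((\<lambda>x. ereal (Re (deriv (bf_ext \<phi>) (of_real x)))) \<longlongrightarrow> ereal d + enn2ereal (\<integral>\<^sup>+ y. ennreal (y ^ 1 * exp (- v * y)) \<partial>\<mu>)) (at_right v)"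
    by (rule Lim_transform_eventually)
  then show "right_lim (deriv (bf_ext \<phi>)) v = ereal d + enn2ereal (\<integral>\<^sup>+ y. ennreal (y * exp (- v * y)) \<partial>\<mu>)"
    unfolding right_lim_def power_one_right by (rule tendsto_Lim[OF trivial_limit_at_right_real])
  have "((\<lambda>x. - ereal (real_moment 2 x)) \<longlongrightarrow> - enn2ereal (\<integral>\<^sup>+ y. ennreal (y ^ 2 * exp (- v * y)) \<partial>\<mu>)) (at_right v)"
    by (rule ereal_Lim_uminus[THEN iffD1]) (rule real_moment_tendsto[OF adm], simp_all)
  moreover have "eventually (\<lambda>x. - ereal (real_moment 2 x) = ereal (Re ((deriv ^^ 2) (bf_ext \<phi>) (of_real x)))) (at_right v)"
    using ev by eventually_elim (simp add: deriv_bf_ext a moment_of_real)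
  ultimately have "((\<lambda>x. ereal (Re ((deriv ^^ 2) (bf_ext \<phi>) (of_real x)))) \<longlongrightarrow> - enn2ereal (\<integral>\<^sup>+ y. ennreal (y ^ 2 * exp (- v * y)) \<partial>\<mu>)) (at_right v)"
    by (rule Lim_transform_eventually)
  then show "right_lim ((deriv ^^ 2) (bf_ext \<phi>)) v = - enn2ereal (\<integral>\<^sup>+ y. ennreal (y ^ 2 * exp (- v * y)) \<partial>\<mu>)"
    unfolding right_lim_def by (rule tendsto_Lim[OF trivial_limit_at_right_real])
qed

lemma integrable_of_enn2ereal:
  assumes "enn2ereal (\<integral>\<^sup>+ y. ennreal (y ^ n * exp (- v * y)) \<partial>\<mu>) < \<infinity>"
  shows "integrable \<mu> (\<lambda>y. y ^ n * exp (- v * y))"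
proof -
  have "(\<integral>\<^sup>+ y. ennreal (norm (y ^ n * exp (- v * y))) \<partial>\<mu>) = (\<integral>\<^sup>+ y. ennreal (y ^ n * exp (- v * y)) \<partial>\<mu>)"
    by (rule nn_integral_cong) auto
  moreover have "(\<integral>\<^sup>+ y. ennreal (y ^ n * exp (- v * y)) \<partial>\<mu>) < \<infinity>"
    using assms by (cases "\<integral>\<^sup>+ y. ennreal (y ^ n * exp (- v * y)) \<partial>\<mu>") (auto simp: top_ereal_def)
  ultimately show ?thesis
    unfolding integrable_iff_bounded by (auto intro!: measurable_cont continuous_intros)
qed

lemma first_moment_of_second:
  assumes "integrable \<mu> (\<lambda>y. y ^ 2 * exp (- v * y))"
  shows "integrable \<mu> (\<lambda>y. y * exp (- v * y))"
proof (rule integrable_dominated[where g = "\<lambda>y. y ^ 2 * exp (- v * y) + exp \<bar>v\<bar> * min 1 y"])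
  fix y :: real assume y: "0 < y"
  show "norm (y * exp (- v * y)) \<le> y ^ 2 * exp (- v * y) + exp \<bar>v\<bar> * min 1 y"
  proof (cases "y \<le> 1")
    case True
    have "- v * y \<le> \<bar>v\<bar> * y" using y by (intro mult_right_mono) auto
    also have "\<dots> \<le> \<bar>v\<bar> * 1" using True by (intro mult_left_mono) auto
    finally have "y * exp (- v * y) \<le> y * exp \<bar>v\<bar>" using y by (intro mult_left_mono) auto
    moreover have "0 \<le> y ^ 2 * exp (- v * y)" by simp
    ultimately show ?thesis using True y by (simp add: mult.commute[of y] add_increasing)
  next
    case False
    then have "y * exp (- v * y) \<le> y ^ 2 * exp (- v * y)"
      by (intro mult_right_mono) (auto simp: power2_eq_square)
    moreover have "0 \<le> exp \<bar>v\<bar> * min 1 y" using y by simp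
    moreover have "norm (y * exp (- v * y)) = y * exp (- v * y)" using y by simp
    ultimately show ?thesis by linarith
  qed
qed (use assms integrable_min in \<open>auto intro!: continuous_intros\<close>)

lemma admissible_of_first_moment:
  assumes "integrable \<mu> (\<lambda>y. y * exp (- v * y))"
  shows "admissible v"
  unfolding admissible_def
  by (rule integrable_dominated[OF _ assms]) (auto intro!: continuous_intros simp: abs_mult)

lemma right_lim_deriv_real:
  assumes "bf_a \<phi> \<le> ereal v" "integrable \<mu> (\<lambda>y. y * exp (- v * y))"
  shows "right_lim (deriv (bf_ext \<phi>)) v = ereal (d + real_moment 1 v)"
proof -
  have "AE y in \<mu>. 0 \<le> y * exp (- v * y)" by (rule AE_I2) simp
  then have "(\<integral>\<^sup>+ y. ennreal (y * exp (- v * y)) \<partial>\<mu>) = ennreal (real_moment 1 v)"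
    using nn_integral_eq_integral[OF assms(2)] by (simp add: real_moment_def)
  moreover have "0 \<le> real_moment 1 v"
    unfolding real_moment_def by (rule Bochner_Integration.integral_nonneg) auto
  ultimately show ?thesis using right_lim_deriv[OF assms(1)] by (simp add: enn2ereal_ennreal)
qed

section \<open>Expansion at a zero\<close>

lemma Phi_slope_pos:
  assumes zero: "\<Phi> (of_real v) = 0" and int: "integrable \<mu> (\<lambda>y. y * exp (- v * y))"
  shows "0 < d + real_moment 1 v"
proof (rule ccontr)
  assume "\<not> ?thesis"
  moreover have nn: "0 \<le> real_moment 1 v"
    unfolding real_moment_def by (rule Bochner_Integration.integral_nonneg) auto
  ultimately have "d = 0" "real_moment 1 v = 0" using drift_nonneg by auto
  then have "(\<integral>y. y * exp (- v * y) \<partial>\<mu>) = 0" by (simp add: real_moment_def)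
  moreover have "AE y in \<mu>. 0 \<le> y * exp (- v * y)" by (rule AE_I2) auto
  ultimately have "AE y in \<mu>. y * exp (- v * y) = 0"
    using integral_nonneg_eq_0_iff_AE[OF int] by blast
  then have "AE y in \<mu>. False" by (rule AE_mp) (auto intro!: AE_I2)
  then show False using nonconst_if_zero[OF zero] \<open>d = 0\<close> by simp
qed

lemma Phi_nonzero_right:
  assumes adm: "admissible v" and zero: "\<Phi> (of_real v) = 0" and z: "v < Re z"
  shows "\<Phi> z \<noteq> 0"
  using Phi_strict_mono[OF adm z nonconst_if_zero[OF zero]] Re_Phi_ge[OF adm, of z] zero z by auto

text \<open>Around a zero \<open>v\<close> the function \<open>w \<mapsto> \<Phi>(v + w)\<close> is again a Bernstein function without constant
  term, with the same drift and the tilted measure \<open>e\<^sup>-\<^sup>v\<^sup>y \<mu>(dy)\<close>.\<close>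

lemma Phi_around_zero:
  assumes adm: "admissible v" and zero: "\<Phi> (of_real v) = 0" and w: "0 \<le> Re w"
  shows "integrable \<mu> (\<lambda>y. exp (- of_real (v * y)) * (1 - exp (- (w * of_real y))))"
    and "\<Phi> (of_real v + w) = of_real d * w + (\<integral>y. exp (- of_real (v * y)) * (1 - exp (- (w * of_real y))) \<partial>\<mu>)"
proof -
  have int: "integrable \<mu> (\<lambda>y. 1 - exp (- (of_real v + w) * of_real y))"
    "integrable \<mu> (\<lambda>y. 1 - exp (- of_real v * of_real y) :: complex)"
    using w by (intro integrable_one_minus_exp[OF adm]; simp)+
  have eq: "(1 - exp (- (of_real v + w) * of_real y)) - (1 - exp (- of_real v * of_real y))
      = exp (- of_real (v * y)) * (1 - exp (- (w * of_real y)))" for y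
    by (simp add: algebra_simps flip: exp_add)
  show "integrable \<mu> (\<lambda>y. exp (- of_real (v * y)) * (1 - exp (- (w * of_real y))))"
    using Bochner_Integration.integrable_diff[OF int] unfolding eq .
  have "\<Phi> (of_real v + w) = \<Phi> (of_real v + w) - \<Phi> (of_real v)" using zero by simp
  also have "\<dots> = of_real d * w + ((\<integral>y. 1 - exp (- (of_real v + w) * of_real y) \<partial>\<mu>) - (\<integral>y. 1 - exp (- of_real v * of_real y) \<partial>\<mu>))"
    by (simp add: \<Phi>_def algebra_simps)
  also have "(\<integral>y. 1 - exp (- (of_real v + w) * of_real y) \<partial>\<mu>) - (\<integral>y. 1 - exp (- of_real v * of_real y) \<partial>\<mu>)
     = (\<integral>y. exp (- of_real (v * y)) * (1 - exp (- (w * of_real y))) \<partial>\<mu>)"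
    by (subst Bochner_Integration.integral_diff[OF int, symmetric]) (simp only: eq)
  finally show "\<Phi> (of_real v + w) = of_real d * w + (\<integral>y. exp (- of_real (v * y)) * (1 - exp (- (w * of_real y))) \<partial>\<mu>)" .
qed

lemma Phi_slope_tendsto:
  assumes adm: "admissible v" and zero: "\<Phi> (of_real v) = 0"
    and int: "integrable \<mu> (\<lambda>y. y * exp (- v * y))"
  shows "((\<lambda>w. \<Phi> (of_real v + w) / w) \<longlongrightarrow> of_real (d + real_moment 1 v)) (at 0 within {w. 0 \<le> Re w})"
proof (subst tendsto_at_iff_sequentially, intro allI impI)
  fix X :: "nat \<Rightarrow> complex"
  assume X: "\<forall>i. X i \<in> {w. 0 \<le> Re w} - {0}" and lim: "X \<longlonglongrightarrow> 0"
  have "(\<lambda>i. \<integral>y. exp (- of_real (v * y)) * (1 - exp (- (X i * of_real y))) / X i \<partial>\<mu>)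
      \<longlonglongrightarrow> (\<integral>y. of_real (y * exp (- v * y)) \<partial>\<mu>)"
  proof (rule integral_dominated_convergence[where w = "\<lambda>y. y * exp (- v * y)"])
    show "AE y in \<mu>. (\<lambda>i. exp (- of_real (v * y)) * (1 - exp (- (X i * of_real y))) / X i)
        \<longlonglongrightarrow> complex_of_real (y * exp (- v * y))"
    proof (rule AE_I2)
      fix y assume "y \<in> space \<mu>"
      then have y: "0 < y" by simp
      have "(\<lambda>i. (1 - exp (- (X i * of_real y))) / X i - of_real y) \<longlonglongrightarrow> 0"
      proof (rule Lim_null_comparison)
        show "(\<lambda>i. cmod (X i) * y ^ 2) \<longlonglongrightarrow> 0" using lim by (auto intro!: tendsto_eq_intros)
        show "eventually (\<lambda>i. cmod ((1 - exp (- (X i * of_real y))) / X i - of_real y) \<le> cmod (X i) * y ^ 2) sequentially"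
        proof (rule always_eventually, rule allI)
          fix i
          have x: "X i \<noteq> 0" "0 \<le> Re (X i)" using X by auto
          have "(1 - exp (- (X i * of_real y))) / X i - of_real y = (1 - exp (- (X i * of_real y)) - X i * of_real y) / X i"
            using x by (simp add: field_simps)
          also have "cmod \<dots> \<le> cmod (X i * of_real y) ^ 2 / cmod (X i)"
            unfolding norm_divide using x y by (intro divide_right_mono norm_exp_minus_affine_le) auto
          also have "\<dots> = cmod (X i) * y ^ 2"
            using x y by (simp add: norm_mult power2_eq_square field_simps)
          finally show "cmod ((1 - exp (- (X i * of_real y))) / X i - of_real y) \<le> cmod (X i) * y ^ 2" .
        qed
      qed
      then have "(\<lambda>i. (1 - exp (- (X i * of_real y))) / X i) \<longlonglongrightarrow> of_real y" by (rule LIM_zero_cancel)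
      then have "(\<lambda>i. exp (- of_real (v * y)) * ((1 - exp (- (X i * of_real y))) / X i)) \<longlonglongrightarrow> exp (- of_real (v * y)) * of_real y"
        by (rule tendsto_mult[OF tendsto_const])
      then show "(\<lambda>i. exp (- of_real (v * y)) * (1 - exp (- (X i * of_real y))) / X i) \<longlonglongrightarrow> complex_of_real (y * exp (- v * y))"
        by (simp add: mult.commute flip: exp_of_real)
    qed
    show "AE y in \<mu>. cmod (exp (- of_real (v * y)) * (1 - exp (- (X i * of_real y))) / X i) \<le> y * exp (- v * y)" for i
    proof (rule AE_I2)
      fix y assume "y \<in> space \<mu>"
      then have y: "0 < y" by simp
      have x: "X i \<noteq> 0" "0 \<le> Re (X i)" using X by auto
      have "cmod (1 - exp (- (X i * of_real y))) \<le> cmod (X i) * y"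
        using norm_one_minus_exp_le[of "X i * of_real y"] x y by (simp add: norm_mult)
      then have "exp (- v * y) * cmod (1 - exp (- (X i * of_real y))) / cmod (X i) \<le> exp (- v * y) * (cmod (X i) * y) / cmod (X i)"
        by (intro divide_right_mono mult_left_mono) auto
      then show "cmod (exp (- of_real (v * y)) * (1 - exp (- (X i * of_real y))) / X i) \<le> y * exp (- v * y)"
        using x by (simp add: norm_mult norm_divide mult.commute)
    qed
  qed (use int in \<open>auto intro!: measurable_cont continuous_intros\<close>, use X in auto)
  moreover have "(\<integral>y. complex_of_real (y * exp (- v * y)) \<partial>\<mu>) = of_real (real_moment 1 v)"
    by (simp only: integral_complex_of_real real_moment_def power_one_right)
  ultimately have "(\<lambda>i. of_real d + (\<integral>y. exp (- of_real (v * y)) * (1 - exp (- (X i * of_real y))) / X i \<partial>\<mu>))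
      \<longlonglongrightarrow> of_real d + of_real (real_moment 1 v)"
    by (intro tendsto_add tendsto_const) (simp only:)
  moreover have "of_real d + (\<integral>y. exp (- of_real (v * y)) * (1 - exp (- (X i * of_real y))) / X i \<partial>\<mu>)
      = \<Phi> (of_real v + X i) / X i" for i
  proof -
    have x: "X i \<noteq> 0" "0 \<le> Re (X i)" using X by auto
    show ?thesis using Phi_around_zero(2)[OF adm zero x(2)] x(1) by (simp add: add_divide_distrib)
  qed
  ultimately show "((\<lambda>w. \<Phi> (of_real v + w) / w) \<circ> X) \<longlonglongrightarrow> of_real (d + real_moment 1 v)"
    by (simp add: comp_def)
qed

text \<open>Dominated convergence: the integrand \<open>(wy - 1 + e\<^sup>-\<^sup>w\<^sup>y) / w\<^sup>2\<close> is bounded by \<open>y\<^sup>2\<close> for \<open>Re w \<ge> 0\<close> and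
  tends to \<open>y\<^sup>2/2\<close>.\<close>

lemma Phi_second_order_tendsto:
  assumes adm: "admissible v" and zero: "\<Phi> (of_real v) = 0"
    and int: "integrable \<mu> (\<lambda>y. y ^ 2 * exp (- v * y))"
  shows "((\<lambda>w. (of_real (d + real_moment 1 v) * w - \<Phi> (of_real v + w)) / w ^ 2) \<longlongrightarrow> of_real (real_moment 2 v / 2))
     (at 0 within {w. 0 \<le> Re w})"
proof (subst tendsto_at_iff_sequentially, intro allI impI)
  fix X :: "nat \<Rightarrow> complex"
  assume X: "\<forall>i. X i \<in> {w. 0 \<le> Re w} - {0}" and lim: "X \<longlonglongrightarrow> 0"
  define f where "f i y = exp (- of_real (v * y)) * (X i * of_real y - (1 - exp (- (X i * of_real y)))) / X i ^ 2" for i and y :: real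
  have "(\<lambda>i. \<integral>y. f i y \<partial>\<mu>) \<longlonglongrightarrow> (\<integral>y. of_real (y ^ 2 * exp (- v * y) / 2) \<partial>\<mu>)"
  proof (rule integral_dominated_convergence[where w = "\<lambda>y. y ^ 2 * exp (- v * y)"])
    show "AE y in \<mu>. (\<lambda>i. f i y) \<longlonglongrightarrow> complex_of_real (y ^ 2 * exp (- v * y) / 2)"
    proof (rule AE_I2)
      fix y assume "y \<in> space \<mu>"
      then have y: "0 < y" by simp
      have "(\<lambda>i. (X i * of_real y - (1 - exp (- (X i * of_real y)))) / X i ^ 2 - of_real y ^ 2 / 2) \<longlonglongrightarrow> 0"
      proof (rule Lim_null_comparison)
        show "(\<lambda>i. cmod (X i) * y ^ 3) \<longlonglongrightarrow> 0" using lim by (auto intro!: tendsto_eq_intros)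
        show "eventually (\<lambda>i. cmod ((X i * of_real y - (1 - exp (- (X i * of_real y)))) / X i ^ 2 - of_real y ^ 2 / 2) \<le> cmod (X i) * y ^ 3) sequentially"
        proof (rule always_eventually, rule allI)
          fix i
          have x: "X i \<noteq> 0" "0 \<le> Re (X i)" using X by auto
          have "(X i * of_real y - (1 - exp (- (X i * of_real y)))) / X i ^ 2 - of_real y ^ 2 / 2
             = (exp (- (X i * of_real y)) - 1 + X i * of_real y - (X i * of_real y) ^ 2 / 2) / X i ^ 2"
            using x by (simp add: field_simps)
          also have "cmod \<dots> \<le> cmod (X i * of_real y) ^ 3 / cmod (X i ^ 2)"
            unfolding norm_divide using x y by (intro divide_right_mono norm_exp_minus_quadratic_le) auto
          also have "\<dots> = cmod (X i) * y ^ 3"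
            using x y by (simp add: norm_mult norm_power power2_eq_square power3_eq_cube field_simps)
          finally show "cmod ((X i * of_real y - (1 - exp (- (X i * of_real y)))) / X i ^ 2 - of_real y ^ 2 / 2) \<le> cmod (X i) * y ^ 3" .
        qed
      qed
      then have "(\<lambda>i. (X i * of_real y - (1 - exp (- (X i * of_real y)))) / X i ^ 2) \<longlonglongrightarrow> of_real y ^ 2 / 2"
        by (rule LIM_zero_cancel)
      then have "(\<lambda>i. exp (- of_real (v * y)) * ((X i * of_real y - (1 - exp (- (X i * of_real y)))) / X i ^ 2))
          \<longlonglongrightarrow> exp (- of_real (v * y)) * (of_real y ^ 2 / 2)"
        by (rule tendsto_mult[OF tendsto_const])
      then show "(\<lambda>i. f i y) \<longlonglongrightarrow> complex_of_real (y ^ 2 * exp (- v * y) / 2)"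
        unfolding f_def by (simp add: mult.commute flip: exp_of_real)
    qed
    show "AE y in \<mu>. cmod (f i y) \<le> y ^ 2 * exp (- v * y)" for i
    proof (rule AE_I2)
      fix y assume "y \<in> space \<mu>"
      then have y: "0 < y" by simp
      have x: "X i \<noteq> 0" "0 \<le> Re (X i)" using X by auto
      have "cmod (X i * of_real y - (1 - exp (- (X i * of_real y)))) = cmod (1 - exp (- (X i * of_real y)) - X i * of_real y)"
        by (rule norm_minus_commute)
      also have "\<dots> \<le> (cmod (X i) * y) ^ 2"
        using norm_exp_minus_affine_le[of "X i * of_real y"] x y by (simp add: norm_mult)
      finally have "exp (- v * y) * cmod (X i * of_real y - (1 - exp (- (X i * of_real y)))) / cmod (X i) ^ 2
          \<le> exp (- v * y) * (cmod (X i) * y) ^ 2 / cmod (X i) ^ 2"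
        by (intro divide_right_mono mult_left_mono) auto
      then show "cmod (f i y) \<le> y ^ 2 * exp (- v * y)"
        unfolding f_def using x by (simp add: norm_mult norm_divide norm_power power_mult_distrib mult.commute)
    qed
  qed (use int in \<open>auto intro!: measurable_cont continuous_intros simp: f_def\<close>, use X in auto)
  then have "(\<lambda>i. \<integral>y. f i y \<partial>\<mu>) \<longlonglongrightarrow> of_real (real_moment 2 v / 2)"
    unfolding real_moment_def by (simp only: integral_complex_of_real) simp
  moreover have "(\<integral>y. f i y \<partial>\<mu>) = (of_real (d + real_moment 1 v) * X i - \<Phi> (of_real v + X i)) / X i ^ 2" for i
  proof -
    have x: "X i \<noteq> 0" "0 \<le> Re (X i)" using X by auto
    let ?g = "\<lambda>y. exp (- of_real (v * y)) * (1 - exp (- (X i * of_real y)))"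
    have int1: "integrable \<mu> (\<lambda>y. X i * complex_of_real (y * exp (- v * y)))"
      using first_moment_of_second[OF int] by (intro Bochner_Integration.integrable_mult_right integrable_of_real)
    have "f i y = (X i * complex_of_real (y * exp (- v * y)) - ?g y) / X i ^ 2" for y
      by (simp add: f_def right_diff_distrib mult_ac flip: exp_of_real)
    then have "(\<integral>y. f i y \<partial>\<mu>) = ((\<integral>y. X i * complex_of_real (y * exp (- v * y)) \<partial>\<mu>) - (\<integral>y. ?g y \<partial>\<mu>)) / X i ^ 2"
      using Bochner_Integration.integral_diff[OF int1 Phi_around_zero(1)[OF adm zero x(2)]] by simp
    also have "(\<integral>y. X i * complex_of_real (y * exp (- v * y)) \<partial>\<mu>) = X i * of_real (real_moment 1 v)"
      unfolding real_moment_def by (simp only: integral_mult_right_zero integral_complex_of_real power_one_right)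
    also have "(\<integral>y. ?g y \<partial>\<mu>) = \<Phi> (of_real v + X i) - of_real d * X i"
      using Phi_around_zero(2)[OF adm zero x(2)] by simp
    finally show ?thesis by (simp add: algebra_simps)
  qed
  ultimately show "((\<lambda>w. (of_real (d + real_moment 1 v) * w - \<Phi> (of_real v + w)) / w ^ 2) \<circ> X)
      \<longlonglongrightarrow> of_real (real_moment 2 v / 2)"
    by (simp add: comp_def)
qed

end

lemma continuous_on_fill_limit:
  fixes h :: "complex \<Rightarrow> complex"
  assumes cont: "continuous_on (T - {v}) h" and lim: "(h \<longlongrightarrow> L) (at v within T)"
  shows "continuous_on T (\<lambda>z. if z = v then L else h z)"
  unfolding continuous_on_def
proof
  fix z assume z: "z \<in> T"
  show "((\<lambda>z. if z = v then L else h z) \<longlongrightarrow> (if z = v then L else h z)) (at z within T)"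
  proof (cases "z = v")
    case True
    have "((\<lambda>z. if z = v then L else h z) \<longlongrightarrow> L) (at v within T)"
      by (rule Lim_transform_eventually[OF lim]) (auto simp: eventually_at_filter)
    then show ?thesis using True by simp
  next
    case False
    then have "(h \<longlongrightarrow> h z) (at z within (T - {v}))" using cont z by (simp add: continuous_on_def)
    moreover have "at z within (T - {v}) = at z within T"
      by (rule at_within_nhd[of z "- {v}"]) (use False in auto)
    ultimately have "(h \<longlongrightarrow> h z) (at z within T)" by simp
    moreover have "eventually (\<lambda>w. w \<noteq> v) (at z within T)"
      using False by (auto simp: eventually_at_filter intro: eventually_mono[OF t1_space_nhds])
    then have "eventually (\<lambda>w. h w = (if w = v then L else h w)) (at z within T)"
      by (rule eventually_mono) simp
    ultimately show ?thesis using False by (simp cong: if_cong) (rule Lim_transform_eventually)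
  qed
qed

lemma halfplane_real: "halfplane (ereal v) = {z. v < Re z}"
  by (simp add: halfplane_def)

lemma halfplane_0: "halfplane 0 = {z. 0 < Re z}"
  by (simp add: halfplane_def zero_ereal_def)

context bernstein_function
begin

lemma Phi_slope_within:
  assumes zero: "\<Phi> (of_real v) = 0" and int: "integrable \<mu> (\<lambda>y. y * exp (- v * y))"
    and T: "T \<subseteq> {z. v \<le> Re z}"
  shows "((\<lambda>z. \<Phi> z / (z - of_real v)) \<longlongrightarrow> of_real (d + real_moment 1 v)) (at (of_real v) within T)"
    and "integrable \<mu> (\<lambda>y. y ^ 2 * exp (- v * y)) \<Longrightarrow>
      ((\<lambda>z. (of_real (d + real_moment 1 v) * (z - of_real v) - \<Phi> z) / (z - of_real v) ^ 2)
        \<longlongrightarrow> of_real (real_moment 2 v / 2)) (at (of_real v) within T)"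
proof -
  note adm = admissible_of_first_moment[OF int]
  have shift: "filterlim (\<lambda>z. z - of_real v) (at 0 within {w. 0 \<le> Re w}) (at (of_real v) within T)"
    using T by (auto simp: filterlim_at eventually_at_filter intro!: tendsto_eq_intros always_eventually)
  show "((\<lambda>z. \<Phi> z / (z - of_real v)) \<longlongrightarrow> of_real (d + real_moment 1 v)) (at (of_real v) within T)"
    using filterlim_compose[OF Phi_slope_tendsto[OF adm zero int] shift] by simp
  show "((\<lambda>z. (of_real (d + real_moment 1 v) * (z - of_real v) - \<Phi> z) / (z - of_real v) ^ 2)
        \<longlongrightarrow> of_real (real_moment 2 v / 2)) (at (of_real v) within T)"
    if "integrable \<mu> (\<lambda>y. y ^ 2 * exp (- v * y))"
    using filterlim_compose[OF Phi_second_order_tendsto[OF adm zero that] shift] by simp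
qed

lemma W_plus_1_field_differentiable:
  assumes "bf_abar \<phi> \<le> ereal (Re z)"
  shows "(\<lambda>z. W \<phi> (z + 1)) field_differentiable (at z)"
proof (rule holomorphic_on_imp_differentiable_at[OF W_plus_1_holomorphic open_halfplane])
  have "bf_abar \<phi> < ereal (Re z + 1)" using assms by (rule le_less_trans) simp
  then show "z \<in> halfplane (bf_abar \<phi> - 1)"
    by (auto simp: halfplane_def ereal_minus_less one_ereal_def)
qed

text \<open>Near a zero \<open>v\<close> of \<open>\<Phi>\<close> one has \<open>W(z) = W(z + 1) / \<Phi>(z)\<close>, and the expansion of \<open>\<Phi>\<close> to second
  order within the closed half-plane is enough to split off the simple pole.\<close>

lemma W_minus_pole_extends:
  assumes zero: "\<Phi> (of_real v) = 0" and int2: "integrable \<mu> (\<lambda>y. y ^ 2 * exp (- v * y))"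
    and av: "bf_abar \<phi> \<le> ereal v" and B: "B \<subseteq> vline v"
    and nz: "\<And>z. z \<in> B \<Longrightarrow> z \<noteq> of_real v \<Longrightarrow> \<Phi> z \<noteq> 0"
  shows "extends_continuously
     (\<lambda>z. W \<phi> z - W \<phi> (1 + of_real v) / (of_real (d + real_moment 1 v) * (z - of_real v)))
     (halfplane v) B"
proof -
  let ?v = "complex_of_real v"
  define m where "m = complex_of_real (d + real_moment 1 v)"
  define T where "T = halfplane v \<union> B"
  note int1 = first_moment_of_second[OF int2]
  note adm = admissible_of_first_moment[OF int1]
  have m: "m \<noteq> 0" using Phi_slope_pos[OF zero int1] unfolding m_def by (metis of_real_eq_0_iff less_irrefl)
  have T: "T \<subseteq> {z. v \<le> Re z}" using B by (auto simp: T_def halfplane_real vline_def)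
  have Tnz: "\<Phi> z \<noteq> 0" if "z \<in> T - {?v}" for z
    using that nz Phi_nonzero_right[OF adm zero] by (auto simp: T_def halfplane_real)
  define F where "F z = W \<phi> (z + 1)" for z
  define h where "h z = F z / \<Phi> z - F ?v / (m * (z - ?v))" for z
  obtain F' where "(F has_field_derivative F') (at ?v)"
    using W_plus_1_field_differentiable[of ?v] av unfolding field_differentiable_def F_def by auto
  then have F': "((\<lambda>z. (F z - F ?v) / (z - ?v)) \<longlongrightarrow> F') (at ?v within T)"
    unfolding has_field_derivative_iff using tendsto_within_subset by blast
  \<comment> \<open>The difference, with numerator and denominator divided by \<open>(z - v)\<^sup>2\<close>.\<close>
  define k where "k z = ((F z - F ?v) / (z - ?v) * m + F ?v * ((m * (z - ?v) - \<Phi> z) / (z - ?v) ^ 2))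
      / (m * (\<Phi> z / (z - ?v)))" for z
  have "(k \<longlongrightarrow> (F' * m + F ?v * of_real (real_moment 2 v / 2)) / (m * m)) (at ?v within T)"
    unfolding k_def
    by (intro tendsto_intros F' Phi_slope_within[OF zero int1 T, folded m_def] int2)
       (use m in auto)
  moreover have "eventually (\<lambda>z. k z = h z) (at ?v within T)"
    unfolding eventually_at_filter
  proof (rule always_eventually, intro allI impI)
    fix z assume "z \<noteq> ?v" "z \<in> T"
    then have "z - ?v \<noteq> 0" "\<Phi> z \<noteq> 0" using Tnz by auto
    then show "k z = h z" using m unfolding k_def h_def
      by (simp add: divide_simps power2_eq_square) (simp add: algebra_simps)
  qed
  ultimately have "(h \<longlongrightarrow> (F' * m + F ?v * of_real (real_moment 2 v / 2)) / (m * m)) (at ?v within T)"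
    by (rule Lim_transform_eventually)
  moreover have "continuous_on (T - {?v}) h"
    unfolding h_def F_def
    by (intro continuous_on_diff continuous_on_W_quotient[OF adm av])
       (use T Tnz m in \<open>auto intro!: continuous_intros\<close>)
  ultimately have cont: "continuous_on T (\<lambda>z. if z = ?v then (F' * m + F ?v * of_real (real_moment 2 v / 2)) / (m * m) else h z)"
    by (intro continuous_on_fill_limit)
  have "h z = W \<phi> z - W \<phi> (1 + ?v) / (m * (z - ?v))" if "z \<in> halfplane v" for z
  proof -
    have "bf_a \<phi> < ereal (Re z)"
      using that av by (auto simp: halfplane_def bf_abar_def intro: le_less_trans)
    then show ?thesis by (simp add: h_def F_def W_shift[of z] add.commute)
  qed
  then show ?thesis
    unfolding extends_continuously_def m_def[symmetric]
    by (intro exI[of _ "\<lambda>z. if z = ?v then (F' * m + F ?v * of_real (real_moment 2 v / 2)) / (m * m) else h z"] conjI)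
       (use cont in \<open>auto simp: T_def halfplane_real\<close>)
qed

lemma bf_abar_le_ereal_0: "bf_abar \<phi> \<le> ereal 0"
  using bf_abar_le_0 by (simp add: zero_ereal_def)

lemma bf_a_le_ereal_0: "bf_a \<phi> \<le> ereal 0"
  using bf_a_le_0 by (simp add: zero_ereal_def)

lemma Phi_nonzero_killing:
  assumes "0 < Re (\<phi> 0)" "0 \<le> Re z"
  shows "\<Phi> z \<noteq> 0"
  using Re_Phi_ge[OF admissible_0 assms(2)] Phi_mono[OF admissible_0 assms(2)] phi_eq[of 0] assms by auto

lemma Phi_nonzero_pos: "0 < Re z \<Longrightarrow> \<Phi> z \<noteq> 0"
  using phi_nonzero phi_eq by fastforce

lemma continuous_on_W:
  assumes "T \<subseteq> {z. 0 \<le> Re z \<and> \<Phi> z \<noteq> 0}"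
  shows "continuous_on T (W \<phi>)"
proof -
  have "continuous_on T (\<lambda>z. W \<phi> (z + 1) / \<Phi> z)"
    by (rule continuous_on_W_quotient[OF admissible_0 bf_abar_le_ereal_0 assms])
  then show ?thesis
  proof (rule continuous_on_eq)
    fix z assume "z \<in> T"
    then show "W \<phi> (z + 1) / \<Phi> z = W \<phi> z" using assms W_shift[of z] by auto
  qed
qed

lemma W_holomorphic_halfplane_0: "W \<phi> holomorphic_on halfplane 0"
  using W_holomorphic_pos by (simp add: halfplane_0)

lemma W_killing:
  assumes "0 < Re (\<phi> 0)"
  shows "holo_cont_ext (W \<phi>) 0" "continuous_on {z. 0 \<le> Re z} (W \<phi>)" "0 \<le> Re z \<Longrightarrow> W \<phi> z \<noteq> 0"
proof -
  show cont: "continuous_on {z. 0 \<le> Re z} (W \<phi>)"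
    by (rule continuous_on_W) (use Phi_nonzero_killing[OF assms] in auto)
  have "halfplane 0 \<union> vline 0 = {z. 0 \<le> Re z}" by (auto simp: halfplane_0 vline_def)
  then show "holo_cont_ext (W \<phi>) 0"
    unfolding holo_cont_ext_def extends_continuously_def
    using cont W_holomorphic_halfplane_0 by (auto simp: zero_ereal_def[symmetric] intro!: exI[of _ "W \<phi>"])
  show "W \<phi> z \<noteq> 0" if "0 \<le> Re z"
    using W_shift[of z] that Phi_nonzero_killing[OF assms that] W_nonzero_pos[of "z + 1"] by simp
qed

lemma W_extends: "extends_continuously (W \<phi>) (halfplane 0) (vline 0 - bf_zeros 0 \<phi>)"
  unfolding extends_continuously_def
  by (intro exI[of _ "W \<phi>"] conjI continuous_on_W)
     (auto simp: halfplane_0 vline_def bf_zeros_0 Phi_nonzero_pos)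

lemma integrable_first_moment:
  assumes "bf_a \<phi> \<le> ereal v" "right_lim (deriv (bf_ext \<phi>)) v < \<infinity>"
  shows "integrable \<mu> (\<lambda>y. y * exp (- v * y))"
proof -
  have "enn2ereal (\<integral>\<^sup>+ y. ennreal (y ^ 1 * exp (- v * y)) \<partial>\<mu>) < \<infinity>"
    using right_lim_deriv[OF assms(1)] assms(2) by auto
  from integrable_of_enn2ereal[OF this] show ?thesis by simp
qed

lemma integrable_second_moment:
  assumes "bf_a \<phi> \<le> ereal v" "\<bar>right_lim ((deriv ^^ 2) (bf_ext \<phi>)) v\<bar> < \<infinity>"
  shows "integrable \<mu> (\<lambda>y. y ^ 2 * exp (- v * y))"
proof (rule integrable_of_enn2ereal)
  show "enn2ereal (\<integral>\<^sup>+ y. ennreal (y ^ 2 * exp (- v * y)) \<partial>\<mu>) < \<infinity>"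
    using right_lim_deriv2[OF assms(1)] assms(2) by auto
qed

lemma z_W_extends:
  assumes zero: "\<phi> 0 = 0" and fin: "right_lim (deriv (bf_ext \<phi>)) 0 < \<infinity>"
  shows "extends_continuously (\<lambda>z. z * W \<phi> z) (halfplane 0) ((vline 0 - bf_zeros 0 \<phi>) \<union> {0})"
proof -
  define T where "T = halfplane 0 \<union> ((vline 0 - bf_zeros 0 \<phi>) \<union> {0})"
  have Phi0: "\<Phi> (of_real 0) = 0" using zero phi_eq[of 0] by simp
  have int: "integrable \<mu> (\<lambda>y. y * exp (- 0 * y))"
    by (rule integrable_first_moment[OF bf_a_le_ereal_0 fin])
  define m where "m = complex_of_real (d + real_moment 1 0)"
  have m: "m \<noteq> 0" using Phi_slope_pos[OF Phi0 int] unfolding m_def by (metis of_real_eq_0_iff less_irrefl)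
  have T: "T \<subseteq> {z. 0 \<le> Re z}" by (auto simp: T_def halfplane_0 vline_def)
  have Tnz: "T - {0} \<subseteq> {z. 0 \<le> Re z \<and> \<Phi> z \<noteq> 0}"
    by (auto simp: T_def halfplane_0 vline_def bf_zeros_0 Phi_nonzero_pos)
  have "isCont (\<lambda>z. W \<phi> (z + 1)) 0"
    using W_plus_1_field_differentiable[of 0] bf_abar_le_ereal_0 field_differentiable_imp_continuous_at by auto
  then have F: "((\<lambda>z. W \<phi> (z + 1)) \<longlongrightarrow> W \<phi> (0 + 1)) (at 0 within T)"
    unfolding isCont_def using tendsto_within_subset by blast
  have "((\<lambda>z. \<Phi> z / z) \<longlongrightarrow> m) (at 0 within T)"
    using Phi_slope_within(1)[OF Phi0 int T] by (simp add: m_def)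
  with F have "((\<lambda>z. W \<phi> (z + 1) / (\<Phi> z / z)) \<longlongrightarrow> W \<phi> (0 + 1) / m) (at 0 within T)"
    by (rule tendsto_divide) (rule m)
  moreover have "eventually (\<lambda>z. W \<phi> (z + 1) / (\<Phi> z / z) = z * W \<phi> z) (at 0 within T)"
    unfolding eventually_at_filter
  proof (rule always_eventually, intro allI impI)
    fix z assume "z \<noteq> 0" "z \<in> T"
    then show "W \<phi> (z + 1) / (\<Phi> z / z) = z * W \<phi> z" using W_shift[of z] T by auto
  qed
  ultimately have "((\<lambda>z. z * W \<phi> z) \<longlongrightarrow> W \<phi> (0 + 1) / m) (at 0 within T)"
    by (rule Lim_transform_eventually)
  moreover have "continuous_on (T - {0}) (\<lambda>z. z * W \<phi> z)"
    by (intro continuous_intros continuous_on_W Tnz)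
  ultimately have "continuous_on T (\<lambda>z. if z = 0 then W \<phi> (0 + 1) / m else z * W \<phi> z)"
    by (intro continuous_on_fill_limit)
  then show ?thesis
    unfolding extends_continuously_def T_def by (intro exI conjI) (auto simp: halfplane_0)
qed

lemma W_minus_pole_at_0_extends:
  assumes zero: "\<phi> 0 = 0" and fin: "\<bar>right_lim ((deriv ^^ 2) (bf_ext \<phi>)) 0\<bar> < \<infinity>"
  shows "extends_continuously
     (\<lambda>z. W \<phi> z - 1 / (of_real (real_of_ereal (right_lim (deriv (bf_ext \<phi>)) 0)) * z))
     (halfplane 0) ((vline 0 - bf_zeros 0 \<phi>) \<union> {0})"
proof -
  have int: "integrable \<mu> (\<lambda>y. y ^ 2 * exp (- 0 * y))"
    by (rule integrable_second_moment[OF bf_a_le_ereal_0 fin])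
  have "right_lim (deriv (bf_ext \<phi>)) 0 = ereal (d + real_moment 1 0)"
    by (rule right_lim_deriv_real[OF bf_a_le_ereal_0 first_moment_of_second[OF int]])
  moreover have "extends_continuously
     (\<lambda>z. W \<phi> z - W \<phi> (1 + of_real 0) / (of_real (d + real_moment 1 0) * (z - of_real 0)))
     (halfplane (ereal 0)) ((vline 0 - bf_zeros 0 \<phi>) \<union> {0})"
    by (rule W_minus_pole_extends[OF _ int bf_abar_le_ereal_0])
       (use zero phi_eq[of 0] in \<open>auto simp: vline_def bf_zeros_0\<close>)
  ultimately show ?thesis by (simp add: W_1 zero_ereal_def)
qed

lemma second_deriv_finite:
  assumes "bf_a \<phi> < ereal u"
  shows "\<bar>right_lim ((deriv ^^ 2) (bf_ext \<phi>)) u\<bar> < \<infinity>"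
proof -
  obtain v where v: "bf_a \<phi> < ereal v" "v < u" using ereal_dense2[OF assms] by (metis less_ereal.simps(1))
  have "integrable \<mu> (\<lambda>y. y ^ 2 * exp (- u * y))"
    by (rule integrable_real_moment[OF admissible_of_bf_a[OF v(1)] v(2)]) simp
  moreover have "AE y in \<mu>. 0 \<le> y ^ 2 * exp (- u * y)" by (rule AE_I2) simp
  ultimately have "(\<integral>\<^sup>+ y. ennreal (y ^ 2 * exp (- u * y)) \<partial>\<mu>) = ennreal (\<integral>y. y ^ 2 * exp (- u * y) \<partial>\<mu>)"
    by (rule nn_integral_eq_integral)
  moreover have "0 \<le> (\<integral>y. y ^ 2 * exp (- u * y) \<partial>\<mu>)"
    by (rule Bochner_Integration.integral_nonneg) simp
  ultimately show ?thesis
    using right_lim_deriv2[of u] assms by (simp add: enn2ereal_ennreal)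
qed

lemma W_minus_pole_at_u:
  assumes u: "bf_u \<phi> = ereal u" and zeros: "bf_zeros u \<phi> = {of_real u}"
    and fin: "\<bar>right_lim ((deriv ^^ 2) (bf_ext \<phi>)) u\<bar> < \<infinity>"
  shows "holo_cont_ext
      (\<lambda>z. W \<phi> z - W \<phi> (1 + of_real u) /
         (of_real (real_of_ereal (right_lim (deriv (bf_ext \<phi>)) u)) * (z - of_real u))) u"
    and "0 < right_lim (deriv (bf_ext \<phi>)) u" "right_lim (deriv (bf_ext \<phi>)) u < \<infinity>"
proof -
  have au: "bf_a \<phi> \<le> ereal u" by (rule bf_u_attained[OF u])
  then have abar: "bf_abar \<phi> = ereal u" using u by (simp add: bf_abar_def max_def)
  have int2: "integrable \<mu> (\<lambda>y. y ^ 2 * exp (- u * y))"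
    by (rule integrable_second_moment[OF au fin])
  note int1 = first_moment_of_second[OF int2]
  note adm = admissible_of_first_moment[OF int1]
  have zero: "\<Phi> (of_real u) = 0"
    using bf_u_attained(4)[OF u] bf_ext_boundary[OF adm au, of "of_real u"] by simp
  have rl: "right_lim (deriv (bf_ext \<phi>)) u = ereal (d + real_moment 1 u)"
    by (rule right_lim_deriv_real[OF au int1])
  then show "0 < right_lim (deriv (bf_ext \<phi>)) u" "right_lim (deriv (bf_ext \<phi>)) u < \<infinity>"
    using Phi_slope_pos[OF zero int1] by (simp_all add: zero_ereal_def)
  have "extends_continuously
     (\<lambda>z. W \<phi> z - W \<phi> (1 + of_real u) / (of_real (d + real_moment 1 u) * (z - of_real u)))
     (halfplane u) (vline u)"
    by (rule W_minus_pole_extends[OF zero int2])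
       (use abar zeros bf_zeros_eq[OF adm au] in \<open>auto simp: vline_def\<close>)
  moreover have "d + real_moment 1 u \<noteq> 0" using Phi_slope_pos[OF zero int1] by simp
  then have "complex_of_real (d + real_moment 1 u) \<noteq> 0" by (metis of_real_eq_0_iff)
  then have "(\<lambda>z. W \<phi> z - W \<phi> (1 + of_real u) / (of_real (d + real_moment 1 u) * (z - of_real u)))
      holomorphic_on halfplane u"
    using W_holomorphic abar by (intro holomorphic_intros) (auto simp: halfplane_def)
  ultimately show "holo_cont_ext
      (\<lambda>z. W \<phi> z - W \<phi> (1 + of_real u) /
         (of_real (real_of_ereal (right_lim (deriv (bf_ext \<phi>)) u)) * (z - of_real u))) u"
    unfolding holo_cont_ext_def rl by simp
qed

section \<open>Zeros on the imaginary axis\<close>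

text \<open>Without the nonnegative constant \<open>\<phi>(0)\<close>, the real part of \<open>\<Phi>\<close> on the axis is the integral of
  \<open>1 - cos (Im z y) \<ge> 0\<close>.\<close>

lemma zero_on_axis:
  assumes "\<Phi> z = 0" "Re z = 0"
  shows "\<phi> 0 = 0" "AE y in \<mu>. exp (- z * of_real y) = 1"
proof -
  have int: "integrable \<mu> (\<lambda>y. 1 - cos (Im z * y))"
    using integrable_Re[OF integrable_one_minus_exp[OF admissible_0, of z]] assms(2) by (simp add: Re_exp)
  have nn: "AE y in \<mu>. 0 \<le> 1 - cos (Im z * y)" by (rule AE_I2) simp
  have "0 \<le> (\<integral>y. 1 - cos (Im z * y) \<partial>\<mu>)" by (rule Bochner_Integration.integral_nonneg) simp
  moreover have "0 = Re (\<phi> 0) + (\<integral>y. 1 - cos (Im z * y) \<partial>\<mu>)"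
    using Re_Phi[OF admissible_0, of z] assms by simp
  ultimately have "Re (\<phi> 0) = 0" and I: "(\<integral>y. 1 - cos (Im z * y) \<partial>\<mu>) = 0"
    using killing_nonneg by linarith+
  then show "\<phi> 0 = 0" using killing_real by simp
  have "AE y in \<mu>. 1 - cos (Im z * y) = 0"
    using I integral_nonneg_eq_0_iff_AE[OF int nn] by blast
  then show "AE y in \<mu>. exp (- z * of_real y) = 1"
  proof (rule AE_mp, intro AE_I2 impI)
    fix y assume "1 - cos (Im z * y) = 0"
    then have c: "cos (Im z * y) = 1" by simp
    then have "sin (Im z * y) = 0" using sin_cos_squared_add[of "Im z * y"] by simp
    with c show "exp (- z * of_real y) = 1"
      using assms(2) by (simp add: complex_eq_iff Re_exp Im_exp)
  qed
qed

text \<open>For two distinct zeros \<open>\<zeta>\<close>, \<open>z\<close> on the axis, \<open>e\<^sup>(\<^sup>\<zeta>\<^sup>-\<^sup>z\<^sup>)\<^sup>y = 1\<close> for \<open>\<mu>\<close>-almost all \<open>y\<close>, so that \<open>\<mu>\<close> is carried by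
  \<open>[2\<pi>/|z - \<zeta>|, \<infinity>)\<close>. If zeros accumulated at \<open>\<zeta>\<close>, then \<open>\<mu>\<close> would vanish, and \<open>\<Phi>\<close> would be
  linear with a single zero.\<close>

lemma Phi_zeros_isolated:
  assumes \<zeta>: "\<Phi> \<zeta> = 0" "Re \<zeta> = 0"
  shows "eventually (\<lambda>z. \<Phi> z \<noteq> 0) (at \<zeta> within {z. 0 \<le> Re z})"
proof (cases "AE y in \<mu>. False")
  case True
  have "d \<noteq> 0" using nonconst_if_zero[OF \<zeta>(1)] True by auto
  have \<phi>: "\<Phi> z = of_real d * z" for z
    using Phi_trivial_measure[OF True] zero_on_axis(1)[OF \<zeta>] by simp
  have "\<zeta> = 0" using \<zeta>(1) \<open>d \<noteq> 0\<close> by (simp add: \<phi>)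
  then show ?thesis using \<open>d \<noteq> 0\<close> by (auto simp: eventually_at_filter \<phi>)
next
  case False
  have "\<exists>n::nat. \<not> (AE y in \<mu>. real n < y)"
  proof (rule ccontr)
    assume "\<not> ?thesis"
    then have "AE y in \<mu>. \<forall>n. real n < y" by (simp add: AE_all_countable)
    then have "AE y in \<mu>. False"
    proof (rule AE_mp, intro AE_I2 impI)
      fix y assume "\<forall>n. real n < y"
      moreover obtain n where "y < real n" using reals_Archimedean2 by blast
      ultimately show False by (metis less_asym)
    qed
    then show False using False by simp
  qed
  then obtain n :: nat where n: "\<not> (AE y in \<mu>. real n < y)" by blast
  define e where "e = 2 * pi / real (Suc n)"
  have e: "0 < e" by (simp add: e_def)
  show ?thesis
    unfolding eventually_at
  proof (intro exI[of _ e] conjI ballI impI e)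
    fix z assume z: "z \<in> {z. 0 \<le> Re z}" and "z \<noteq> \<zeta> \<and> dist z \<zeta> < e"
    then have ne: "z \<noteq> \<zeta>" and dist: "dist z \<zeta> < e" by auto
    show "\<Phi> z \<noteq> 0"
    proof
      assume zero: "\<Phi> z = 0"
      then have Re: "Re z = 0" using z Phi_nonzero_pos[of z] by force
      have "AE y in \<mu>. exp (- z * of_real y) = 1 \<and> exp (- \<zeta> * of_real y) = 1"
        using zero_on_axis(2)[OF zero Re] zero_on_axis(2)[OF \<zeta>] by (rule AE_conjI)
      then have "AE y in \<mu>. real n < y"
      proof (rule AE_mp, intro AE_I2 impI)
        fix y assume y: "y \<in> space \<mu>" and exps: "exp (- z * of_real y) = 1 \<and> exp (- \<zeta> * of_real y) = 1"
        have "exp ((\<zeta> - z) * of_real y) = exp (- z * of_real y) / exp (- \<zeta> * of_real y)"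
          by (simp add: algebra_simps flip: exp_diff)
        then have "exp ((\<zeta> - z) * of_real y) = 1" using exps by simp
        then obtain j :: int where j: "Im ((\<zeta> - z) * of_real y) = of_int (2 * j) * pi"
          by (auto simp: exp_eq_1)
        have Im: "Im (\<zeta> - z) \<noteq> 0" using ne Re \<zeta>(2) by (auto simp: complex_eq_iff)
        then have "j \<noteq> 0" using j y by auto
        then have "1 \<le> \<bar>real_of_int j\<bar>" by linarith
        then have "2 * pi \<le> \<bar>Im ((\<zeta> - z) * of_real y)\<bar>"
          unfolding j by (simp add: abs_mult)
        also have "\<dots> = \<bar>Im (\<zeta> - z)\<bar> * y" using y by (simp add: abs_mult)
        also have "\<dots> < e * y"
          using dist abs_Im_le_cmod[of "\<zeta> - z"] y by (intro mult_strict_right_mono) (auto simp: dist_norm norm_minus_commute)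
        finally have "2 * pi < 2 * pi * (y / real (Suc n))" by (simp add: e_def)
        then have "1 < y / real (Suc n)" by (simp only: mult_less_cancel_left1) (simp add: not_less[symmetric])
        then show "real n < y" by (simp add: field_simps)
      qed
      then show False using n by simp
    qed
  qed
qed

lemma phi_W_tendsto:
  assumes "\<zeta> \<in> bf_zeros 0 \<phi>"
  shows "((\<lambda>z. \<phi> z * W \<phi> z) \<longlongrightarrow> W \<phi> (\<zeta> + 1)) (at \<zeta> within {z. 0 \<le> Re z})"
proof -
  have \<zeta>: "\<Phi> \<zeta> = 0" "Re \<zeta> = 0" using assms by (auto simp: bf_zeros_0)
  have "isCont (\<lambda>z. W \<phi> (z + 1)) \<zeta>"
    using W_plus_1_field_differentiable[of \<zeta>] bf_abar_le_ereal_0 \<zeta>(2)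
      field_differentiable_imp_continuous_at by auto
  then have "((\<lambda>z. W \<phi> (z + 1)) \<longlongrightarrow> W \<phi> (\<zeta> + 1)) (at \<zeta> within {z. 0 \<le> Re z})"
    unfolding isCont_def using tendsto_within_subset by blast
  moreover have "eventually (\<lambda>z. W \<phi> (z + 1) = \<phi> z * W \<phi> z) (at \<zeta> within {z. 0 \<le> Re z})"
  proof -
    have "eventually (\<lambda>z. 0 \<le> Re z) (at \<zeta> within {z. 0 \<le> Re z})" by (auto simp: eventually_at_filter)
    with Phi_zeros_isolated[OF \<zeta>] show ?thesis
    proof eventually_elim
      case (elim z)
      then show ?case using W_shift[of z] phi_eq[of z] by simp
    qed
  qed
  ultimately show ?thesis by (rule Lim_transform_eventually)
qed

section \<open>Lattice measures and periodicity\<close>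

lemma lattice_measure_AE:
  assumes "lattice_measure \<mu> h c k"
  shows "AE y in \<mu>. \<exists>n::nat. y = h * real n"
proof -
  define N where "N = {0<..} - range (\<lambda>n::nat. h * real n)"
  have "range (\<lambda>n::nat. h * real n) \<in> sets borel"
    by (rule sets.countable) simp_all
  then have "N \<in> sets borel" unfolding N_def by (rule sets.Diff[rotated]) simp
  then have N: "N \<in> sets \<mu>" by (auto simp: sets_mu sets_restrict_space_iff N_def)
  have "emeasure \<mu> N = (\<Sum>n. ennreal (c n) * indicator N (h * real (k n)))"
    using assms N by (simp add: lattice_measure_def)
  also have "\<dots> = (\<Sum>n. 0)"
  proof (rule arg_cong[where f = suminf], rule ext)
    fix n
    have "h * real (k n) \<notin> N" by (auto simp: N_def)
    then show "ennreal (c n) * indicator N (h * real (k n)) = 0" by simp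
  qed
  finally have "emeasure \<mu> N = 0" by simp
  then have "N \<in> null_sets \<mu>" using N by auto
  then show ?thesis
    by (rule AE_I') (auto simp: N_def)
qed

text \<open>All atoms are at least \<open>h\<close>, where \<open>min 1 y\<close> is bounded below.\<close>

lemma lattice_finite:
  assumes h: "0 < h" and AE: "AE y in \<mu>. \<exists>n::nat. y = h * real n"
  shows "emeasure \<mu> (space \<mu>) < \<infinity>"
proof -
  have "integrable \<mu> (\<lambda>y. 1 :: real)"
  proof (rule Bochner_Integration.integrable_bound)
    show "integrable \<mu> (\<lambda>y. min 1 y / min 1 h)" using integrable_min by simp
    show "AE y in \<mu>. norm (1::real) \<le> norm (min 1 y / min 1 h)"
    proof (rule AE_mp[OF AE], intro AE_I2 impI)
      fix y assume y: "y \<in> space \<mu>" and "\<exists>n::nat. y = h * real n"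
      then obtain n :: nat where n: "y = h * real n" by blast
      then have "1 \<le> real n" using y h by (cases n) auto
      then have "h * 1 \<le> h * real n" using h by (intro mult_left_mono) auto
      then have "min 1 h \<le> min 1 y" using n by simp
      then have "1 \<le> min 1 y / min 1 h" using h by simp
      then show "norm (1::real) \<le> norm (min 1 y / min 1 h)" using h y by simp
    qed
  qed simp
  then show ?thesis by (simp add: integrable_iff_bounded)
qed

lemma lattice_measure_of_AE:
  assumes h: "0 < h" and AE: "AE y in \<mu>. \<exists>n::nat. y = h * real n"
  shows "lattice_measure \<mu> h (\<lambda>n. measure \<mu> {h * real n}) (\<lambda>n. n)"
proof -
  interpret finite_measure \<mu>
    using lattice_finite[OF assms] by (intro finite_measureI) auto
  have sing: "{h * real n} \<in> sets \<mu> \<or> n = 0" for n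
    using h by (auto simp: sets_mu sets_restrict_space_iff)
  have eq: "emeasure \<mu> A = (\<Sum>n. ennreal (measure \<mu> {h * real n}) * indicator A (h * real n))"
    if A: "A \<in> sets \<mu>" for A
  proof -
    have A0: "A \<subseteq> {0<..}" using sets.sets_into_space[OF A] by simp
    have meas: "A \<inter> {h * real n} \<in> sets \<mu>" for n
    proof (cases "n = 0")
      case True
      then have "A \<inter> {h * real n} = {}" using A0 by auto
      then show ?thesis by simp
    qed (use sing[of n] A in auto)
    have "emeasure \<mu> A = emeasure \<mu> (\<Union>n. A \<inter> {h * real n})"
    proof (rule emeasure_eq_AE[OF _ A])
      show "AE y in \<mu>. (y \<in> A) = (y \<in> (\<Union>n. A \<inter> {h * real n}))"
        by (rule AE_mp[OF AE]) (auto intro!: AE_I2)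
      show "(\<Union>n. A \<inter> {h * real n}) \<in> sets \<mu>"
        by (rule sets.countable_UN) (use meas in auto)
    qed
    also have "\<dots> = (\<Sum>n. emeasure \<mu> (A \<inter> {h * real n}))"
      using h meas by (intro suminf_emeasure[symmetric]) (auto simp: disjoint_family_on_def)
    also have "\<dots> = (\<Sum>n. ennreal (measure \<mu> {h * real n}) * indicator A (h * real n))"
    proof (rule arg_cong[where f = suminf], rule ext)
      fix n
      show "emeasure \<mu> (A \<inter> {h * real n}) = ennreal (measure \<mu> {h * real n}) * indicator A (h * real n)"
        by (cases "h * real n \<in> A") (simp_all add: emeasure_eq_measure)
    qed
    finally show ?thesis .
  qed
  have ind: "ennreal (measure \<mu> {h * real n}) * indicator (space \<mu>) (h * real n) = ennreal (measure \<mu> {h * real n})" for n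
  proof (cases "n = 0")
    case True
    \<comment> \<open>The point \<open>0\<close> lies outside the space, so that it has no mass.\<close>
    then have "{h * real n} \<notin> sets \<mu>" using sets.sets_into_space[of "{h * real n}" \<mu>] by auto
    then show ?thesis by (simp add: measure_notin_sets)
  qed (use h in simp)
  have "(\<Sum>n. ennreal (measure \<mu> {h * real n})) = emeasure \<mu> (space \<mu>)"
    unfolding eq[OF sets.top] ind ..
  then have "(\<Sum>n. ennreal (measure \<mu> {h * real n})) \<noteq> top"
    using lattice_finite[OF assms] by auto
  then have "summable (\<lambda>n. measure \<mu> {h * real n})"
    by (rule summable_suminf_not_top[rotated]) simp
  then have "summable (\<lambda>n. measure \<mu> {h * real (Suc n)})"
    by (subst summable_Suc_iff)
  then show ?thesis using h eq by (simp add: lattice_measure_def del: of_nat_Suc)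
qed

lemma Phi_periodic:
  assumes h: "0 < h" and AE: "AE y in \<mu>. \<exists>n::nat. y = h * real n" and d: "d = 0"
  shows "\<Phi> (z + 2 * of_real pi * \<i> / of_real h) = \<Phi> z"
proof -
  let ?\<omega> = "2 * complex_of_real pi * \<i> / of_real h"
  have "(\<integral>y. 1 - exp (- (z + ?\<omega>) * of_real y) \<partial>\<mu>) = (\<integral>y. 1 - exp (- z * of_real y) \<partial>\<mu>)"
  proof (rule integral_cong_AE)
    show "AE y in \<mu>. 1 - exp (- (z + ?\<omega>) * of_real y) = 1 - exp (- z * of_real y)"
    proof (rule AE_mp[OF AE], intro AE_I2 impI)
      fix y assume "\<exists>n::nat. y = h * real n"
      then obtain n :: nat where n: "y = h * real n" by blast
      have "- (z + ?\<omega>) * of_real y = - z * of_real y - 2 * of_real pi * \<i> * of_nat n"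
        using h by (simp add: n field_simps)
      moreover have "exp (2 * of_real pi * \<i> * of_nat n) = 1"
        using exp_integer_2pi[of "of_nat n"] by (simp add: mult_ac)
      ultimately show "1 - exp (- (z + ?\<omega>) * of_real y) = 1 - exp (- z * of_real y)"
        by (simp add: exp_diff)
    qed
  qed (auto intro!: measurable_cont continuous_intros)
  moreover have "\<Phi> w = \<phi> 0 + (\<integral>y. 1 - exp (- w * of_real y) \<partial>\<mu>)" for w
    unfolding \<Phi>_def using d by simp
  ultimately show ?thesis by (simp only:)
qed

lemma nonzero_axis_zero_iff:
  "(\<exists>\<zeta>\<in>bf_zeros 0 \<phi>. \<zeta> \<noteq> 0) \<longleftrightarrow> \<phi> 0 = 0 \<and> d = 0 \<and> (\<exists>h c k. lattice_measure \<mu> h c k)"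
proof
  assume "\<exists>\<zeta>\<in>bf_zeros 0 \<phi>. \<zeta> \<noteq> 0"
  then obtain \<zeta> where \<zeta>: "\<Phi> \<zeta> = 0" "Re \<zeta> = 0" "\<zeta> \<noteq> 0" by (auto simp: bf_zeros_0)
  note AE = zero_on_axis(2)[OF \<zeta>(1,2)]
  have \<phi>0: "\<phi> 0 = 0" by (rule zero_on_axis(1)[OF \<zeta>(1,2)])
  have "(\<integral>y. 1 - exp (- \<zeta> * of_real y) \<partial>\<mu>) = 0"
    by (rule integral_eq_zero_AE) (use AE in auto)
  then have d: "d = 0" using \<zeta> \<phi>0 by (simp add: \<Phi>_def)
  have Im: "Im \<zeta> \<noteq> 0" using \<zeta> by (auto simp: complex_eq_iff)
  define h where "h = 2 * pi / \<bar>Im \<zeta>\<bar>"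
  have h: "0 < h" using Im by (simp add: h_def)
  have "AE y in \<mu>. \<exists>n::nat. y = h * real n"
  proof (rule AE_mp[OF AE], intro AE_I2 impI)
    fix y assume y: "y \<in> space \<mu>" and "exp (- \<zeta> * of_real y) = 1"
    then obtain j :: int where "Im (- \<zeta> * of_real y) = of_int (2 * j) * pi"
      by (auto simp: exp_eq_1)
    then have "\<bar>Im \<zeta> * y\<bar> = \<bar>2 * of_int j * pi\<bar>" by simp
    then have "\<bar>Im \<zeta>\<bar> * y = 2 * pi * real (nat \<bar>j\<bar>)" using y by (simp add: abs_mult)
    then have "y = h * real (nat \<bar>j\<bar>)" using Im by (simp add: h_def field_simps)
    then show "\<exists>n::nat. y = h * real n" by blast
  qed
  then show "\<phi> 0 = 0 \<and> d = 0 \<and> (\<exists>h c k. lattice_measure \<mu> h c k)"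
    using lattice_measure_of_AE[OF h] \<phi>0 d by blast
next
  assume "\<phi> 0 = 0 \<and> d = 0 \<and> (\<exists>h c k. lattice_measure \<mu> h c k)"
  then obtain h c k where *: "\<phi> 0 = 0" "d = 0" and lat: "lattice_measure \<mu> h c k" by blast
  then have h: "0 < h" by (simp add: lattice_measure_def)
  have "\<Phi> (0 + 2 * of_real pi * \<i> / of_real h) = \<Phi> 0"
    by (rule Phi_periodic[OF h lattice_measure_AE[OF lat] *(2)])
  then have "\<Phi> (2 * of_real pi * \<i> / of_real h) = 0" using * phi_eq[of 0] by simp
  then have "2 * of_real pi * \<i> / of_real h \<in> bf_zeros 0 \<phi>"
    using h by (simp add: bf_zeros_0 Re_divide)
  moreover have "2 * of_real pi * \<i> / complex_of_real h \<noteq> 0" using h by simp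
  ultimately show "\<exists>\<zeta>\<in>bf_zeros 0 \<phi>. \<zeta> \<noteq> 0" by blast
qed

lemma phi_infinity_finite:
  assumes fin: "emeasure \<mu> (space \<mu>) < \<infinity>" and "d = 0"
  obtains L where "0 < L" "phi_infinity \<phi> = ereal L"
    "((\<lambda>x. Re (\<phi> (of_real x))) \<longlongrightarrow> L) at_top"
proof
  let ?L = "Re (\<phi> 0) + (\<integral>y. 1 \<partial>\<mu>)"
  have "((\<lambda>x. \<integral>y. 1 - exp (- x * y) \<partial>\<mu>) \<longlongrightarrow> (\<integral>y. 1 \<partial>\<mu>)) at_top"
  proof (rule integral_dominated_convergence_at_top[where w = "\<lambda>_. 1"])
    show "integrable \<mu> (\<lambda>_. 1 :: real)" using fin by (simp add: integrable_iff_bounded)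
    show "eventually (\<lambda>x. AE y in \<mu>. norm (1 - exp (- x * y)) \<le> 1) at_top"
      using eventually_ge_at_top[of "0::real"]
    proof eventually_elim
      case (elim x)
      then show ?case by (intro AE_I2) (auto simp: abs_le_iff)
    qed
    show "AE y in \<mu>. ((\<lambda>x. 1 - exp (- x * y)) \<longlongrightarrow> 1) at_top"
    proof (rule AE_I2)
      fix y :: real assume "y \<in> space \<mu>"
      then have "filterlim (\<lambda>x. x * y) at_top at_top"
        by (intro filterlim_at_top_mult_tendsto_pos[OF tendsto_const] filterlim_ident) auto
      then have "((\<lambda>x. exp (- (x * y))) \<longlongrightarrow> 0) at_top"
        by (rule filterlim_compose[OF exp_at_bot filterlim_compose[OF filterlim_uminus_at_bot_at_top]])
      then have "((\<lambda>x. 1 - exp (- (x * y))) \<longlongrightarrow> 1 - 0) at_top" by (intro tendsto_intros)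
      then show "((\<lambda>x. 1 - exp (- x * y)) \<longlongrightarrow> 1) at_top" by simp
    qed
  qed (auto intro!: measurable_cont continuous_intros)
  then have "((\<lambda>x. Re (\<phi> 0) + (\<integral>y. 1 - exp (- x * y) \<partial>\<mu>)) \<longlongrightarrow> ?L) at_top"
    by (intro tendsto_add tendsto_const)
  moreover have "eventually (\<lambda>x. Re (\<phi> 0) + (\<integral>y. 1 - exp (- x * y) \<partial>\<mu>) = Re (\<phi> (of_real x))) at_top"
    using eventually_ge_at_top[of "0::real"]
    by eventually_elim (use Re_Phi_of_real[OF admissible_0] phi_eq \<open>d = 0\<close> in simp)
  ultimately show lim: "((\<lambda>x. Re (\<phi> (of_real x))) \<longlongrightarrow> ?L) at_top"
    by (rule Lim_transform_eventually)
  have "((\<lambda>x. ereal (Re (\<phi> (of_real x)))) \<longlongrightarrow> ereal ?L) at_top"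
    using lim by (intro tendsto_intros)
  then show "phi_infinity \<phi> = ereal ?L"
    unfolding phi_infinity_def by (intro tendsto_Lim) auto
  have "Re (\<phi> (of_real 1)) \<le> ?L"
  proof (rule tendsto_lowerbound[OF lim])
    show "eventually (\<lambda>x. Re (\<phi> (of_real 1)) \<le> Re (\<phi> (of_real x))) at_top"
      using eventually_ge_at_top[of 1]
    proof eventually_elim
      case (elim x)
      have "admissible 1" by (rule admissible_mono[OF admissible_0]) simp
      from Phi_mono[OF this elim] show ?case using elim phi_eq[of "of_real x"] phi_eq[of "of_real 1"] by simp
    qed
  qed simp
  then show "0 < ?L" using phi_pos[of 1] by simp
qed

text \<open>A period of \<open>\<phi>\<close> leaves everything in the Gauss limit unchanged except the power \<open>\<phi>(n)\<^sup>z\<close>.\<close>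

lemma W_periodic:
  assumes lat: "lattice_measure \<mu> h c k" and d: "d = 0" and z: "z \<in> halfplane 0"
  defines "\<omega> \<equiv> 2 * complex_of_real pi * \<i> / of_real h"
  defines "\<kappa> \<equiv> complex_of_real (ln (real_of_ereal (phi_infinity \<phi>)))"
  shows "exp (- (z + \<omega>) * \<kappa>) * W \<phi> (z + \<omega>) = exp (- z * \<kappa>) * W \<phi> z"
    and "cmod (W \<phi> (z + \<omega>)) = cmod (W \<phi> z)"
proof -
  have h: "0 < h" using lat by (simp add: lattice_measure_def)
  note AE = lattice_measure_AE[OF lat]
  obtain L where L: "0 < L" "phi_infinity \<phi> = ereal L" "((\<lambda>x. Re (\<phi> (of_real x))) \<longlongrightarrow> L) at_top"
    using phi_infinity_finite[OF lattice_finite[OF h AE] d] by blast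
  have \<kappa>: "\<kappa> = of_real (ln L)" by (simp add: \<kappa>_def L)
  have Re\<omega>: "Re \<omega> = 0" using h by (simp add: \<omega>_def Re_divide)
  have Rez: "0 < Re z" using z by (simp add: halfplane_0)
  have per: "\<phi> (w + \<omega>) = \<phi> w" if "0 \<le> Re w" for w
    using Phi_periodic[OF h AE d, of w] phi_eq[of w] phi_eq[of "w + \<omega>"] that Re\<omega> by (simp add: \<omega>_def)
  let ?l = "\<lambda>n. complex_of_real (ln (Re (\<phi> (of_nat n))))"
  let ?G = "\<lambda>z n. exp (z * ?l n) / \<phi> z * (\<Prod>k=1..n. \<phi> (of_nat k) / \<phi> (of_nat k + z))"
  have "(\<lambda>n. Re (\<phi> (of_nat n))) \<longlonglongrightarrow> L"
    using filterlim_compose[OF L(3) filterlim_real_sequentially] by simp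
  then have "?l \<longlonglongrightarrow> of_real (ln L)" using L(1) by (intro tendsto_intros) auto
  then have "(\<lambda>n. exp (\<omega> * ?l n) * ?G z n) \<longlonglongrightarrow> exp (\<omega> * of_real (ln L)) * W_prod \<phi> z"
    by (intro tendsto_mult tendsto_exp tendsto_const Gauss_limit Rez)
  moreover have "exp (\<omega> * ?l n) * ?G z n = ?G (z + \<omega>) n" for n
  proof -
    have "(\<Prod>k=1..n. \<phi> (of_nat k) / \<phi> (of_nat k + (z + \<omega>))) = (\<Prod>k=1..n. \<phi> (of_nat k) / \<phi> (of_nat k + z))"
      using per[of "of_nat _ + z"] Rez by (intro prod.cong refl) (simp add: add.assoc)
    then show ?thesis using per[of z] Rez by (simp add: distrib_right exp_add)
  qed
  ultimately have "(\<lambda>n. ?G (z + \<omega>) n) \<longlonglongrightarrow> exp (\<omega> * of_real (ln L)) * W_prod \<phi> z" by simp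
  moreover have "?G (z + \<omega>) \<longlonglongrightarrow> W_prod \<phi> (z + \<omega>)" by (rule Gauss_limit) (use Rez Re\<omega> in simp)
  ultimately have "W_prod \<phi> (z + \<omega>) = exp (\<omega> * of_real (ln L)) * W_prod \<phi> z"
    by (rule LIMSEQ_unique[rotated])
  then have W: "W \<phi> (z + \<omega>) = exp (\<omega> * \<kappa>) * W \<phi> z"
    using Rez Re\<omega> by (simp add: W_eq_W_prod \<kappa>)
  have "exp (- (z + \<omega>) * \<kappa>) * exp (\<omega> * \<kappa>) = exp (- z * \<kappa>)"
    by (simp add: algebra_simps flip: exp_add)
  then show "exp (- (z + \<omega>) * \<kappa>) * W \<phi> (z + \<omega>) = exp (- z * \<kappa>) * W \<phi> z"
    unfolding W by (simp only: mult.assoc[symmetric])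
  have "cmod (exp (\<omega> * \<kappa>)) = 1" using Re\<omega> by (simp add: \<kappa>)
  then show "cmod (W \<phi> (z + \<omega>)) = cmod (W \<phi> z)" unfolding W by (simp add: norm_mult)
qed

section \<open>The poles on the real axis\<close>

text \<open>The numbers \<open>n\<close> in the supremum that defines \<open>bf_N\<close> form an initial segment of the naturals.\<close>

lemma less_bf_N_iff:
  assumes u: "bf_u \<phi> = ereal u" and au: "bf_a \<phi> < ereal u"
  shows "enat k < bf_N \<phi> + 1 \<longleftrightarrow> bf_a \<phi> < ereal (u - real k)"
proof -
  define S where "S = {enat n |n. bf_a \<phi> < ereal (u - real n)}"
  have N: "bf_N \<phi> = Sup S" unfolding bf_N_def S_def u by simp
  have down: "bf_a \<phi> < ereal (u - real k)" if "bf_a \<phi> < ereal (u - real n)" "k \<le> n" for k n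
    using that by (auto elim!: less_le_trans)
  show ?thesis
  proof
    assume k: "enat k < bf_N \<phi> + 1"
    show "bf_a \<phi> < ereal (u - real k)"
    proof (cases k)
      case (Suc k')
      have "enat k' < Sup S"
        using k unfolding N Suc by (cases "Sup S") (auto simp: one_enat_def)
      then obtain n where "bf_a \<phi> < ereal (u - real n)" "k' < n"
        unfolding less_Sup_iff by (auto simp: S_def)
      then show ?thesis using down[of n k] Suc by simp
    qed (use au in simp)
  next
    assume "bf_a \<phi> < ereal (u - real k)"
    then have "enat k \<le> bf_N \<phi>" unfolding N by (intro Sup_upper) (auto simp: S_def)
    then show "enat k < bf_N \<phi> + 1" by (cases "bf_N \<phi>") (auto simp: one_enat_def)
  qed
qed

lemma W_zero_real_iff:
  assumes u: "bf_u \<phi> = ereal u" and au: "bf_a \<phi> < ereal u" and x: "bf_a \<phi> < ereal x"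
  shows "W \<phi> (of_real x) = 0 \<longleftrightarrow> (\<exists>k. x = u - real k)"
proof -
  have zero: "\<Phi> (of_real u) = 0"
    using bf_u_attained(4)[OF u] bf_ext_eq_Phi[of "of_real u"] au by simp
  have xH: "of_real x \<in> halfplane (bf_a \<phi>)" using x by (simp add: halfplane_def)
  obtain m where m: "0 < Re (of_real x) + real m" using exists_shift by blast
  have "W \<phi> (of_real x) = 0 \<longleftrightarrow> (\<Prod>j<m. \<Phi> (of_real x + of_nat j)) = 0"
    using W_pole[OF xH m] W_analytic_nonzero[OF xH m] by blast
  also have "\<dots> \<longleftrightarrow> (\<exists>j<m. \<Phi> (of_real (x + real j)) = 0)" by auto
  also have "\<dots> \<longleftrightarrow> (\<exists>j<m. x + real j = u)"
  proof -
    have "\<Phi> (of_real (x + real j)) = 0 \<longleftrightarrow> x + real j = u" for j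
    proof
      assume "\<Phi> (of_real (x + real j)) = 0"
      moreover have "bf_a \<phi> < ereal (x + real j)" using x by (auto elim!: less_le_trans)
      ultimately show "x + real j = u"
        using Phi_real_zero_unique[OF _ zero] admissible_of_bf_a au by blast
    qed (use zero in simp)
    then show ?thesis by simp
  qed
  also have "\<dots> \<longleftrightarrow> (\<exists>k. x = u - real k)"
  proof
    assume "\<exists>k. x = u - real k"
    then obtain k where k: "x = u - real k" by blast
    have "u \<le> 0" by (rule bf_u_attained[OF u])
    then have "k < m" using m k by simp
    then show "\<exists>j<m. x + real j = u" using k by auto
  qed (auto simp: algebra_simps)
  finally show ?thesis .
qed

text \<open>With \<open>m = k + 1\<close> shifts, the last factor \<open>\<Phi>(w + k)\<close> of the denominator is the only one that
  vanishes at \<open>u - k\<close>, and it has a simple zero there.\<close>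

lemma W_simple_pole:
  assumes u: "bf_u \<phi> = ereal u" and au: "bf_a \<phi> < ereal u" and k: "bf_a \<phi> < ereal (u - real k)"
  shows "zorder (W \<phi>) (of_real (u - real k)) = -1"
    and "residue (W \<phi>) (of_real (u - real k)) = W \<phi> (1 + of_real u) /
      (deriv (bf_ext \<phi>) (of_real u) * (\<Prod>j=1..k. bf_ext \<phi> (of_real (u - real j))))"
proof -
  let ?p = "complex_of_real (u - real k)"
  have zero: "\<Phi> (of_real u) = 0"
    using bf_u_attained(4)[OF u] bf_ext_eq_Phi[of "of_real u"] au by simp
  have pH: "?p \<in> halfplane (bf_a \<phi>)" using k by (simp add: halfplane_def)
  have pk: "?p + of_nat k = of_real u" by simp
  define f where "f w = W \<phi> (w + of_nat (Suc k)) / (\<Prod>j<k. \<Phi> (w + of_nat j))" for w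
  define g where "g w = \<Phi> (w + of_nat k)" for w
  have prod_eq: "(\<Prod>j<k. \<Phi> (?p + of_nat j)) = (\<Prod>j=1..k. bf_ext \<phi> (of_real (u - real j)))"
  proof (rule prod.reindex_bij_witness[where i = "\<lambda>j. k - j" and j = "\<lambda>j. k - j"])
    fix j assume j: "j \<in> {..<k}"
    have "bf_a \<phi> < ereal (u - real (k - j))" using k j by (auto elim!: less_le_trans)
    moreover have "?p + of_nat j = of_real (u - real (k - j))" using j by (simp add: of_nat_diff)
    ultimately show "bf_ext \<phi> (of_real (u - real (k - j))) = \<Phi> (?p + of_nat j)"
      by (metis Re_complex_of_real bf_ext_eq_Phi)
  qed auto
  have prod_nz: "(\<Prod>j<k. \<Phi> (?p + of_nat j)) \<noteq> 0"
  proof -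
    have "\<Phi> (of_real (u - real k + real j)) \<noteq> 0" if "j < k" for j
    proof
      assume "\<Phi> (of_real (u - real k + real j)) = 0"
      moreover have "bf_a \<phi> < ereal (u - real k + real j)" using k by (auto elim!: less_le_trans)
      ultimately have "u - real k + real j = u"
        using Phi_real_zero_unique[OF _ zero] admissible_of_bf_a au by blast
      then show False using that by simp
    qed
    then show ?thesis by simp
  qed
  have abar: "bf_abar \<phi> = ereal u" using u au by (simp add: bf_abar_def max_absorb2 less_imp_le)
  have W_an: "(\<lambda>w. W \<phi> (w + of_nat (Suc k))) analytic_on {?p}"
  proof -
    have "W \<phi> analytic_on halfplane (bf_abar \<phi>)"
      using W_holomorphic open_halfplane by (simp add: analytic_on_open)
    then have "W \<phi> analytic_on (\<lambda>w. w + of_nat (Suc k)) ` {?p}"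
      by (rule analytic_on_subset) (auto simp: halfplane_def abar)
    then have "W \<phi> \<circ> (\<lambda>w. w + of_nat (Suc k)) analytic_on {?p}"
      by (intro analytic_on_compose) (auto intro!: analytic_intros)
    then show ?thesis by (simp add: comp_def)
  qed
  have "f analytic_on {?p}"
    unfolding f_def using W_an prod_Phi_analytic[OF pH] prod_nz by (intro analytic_on_divide) auto
  moreover have "g analytic_on {?p}"
  proof -
    have "\<Phi> analytic_on halfplane (bf_a \<phi>)"
      using holomorphic_Phi_bf_a open_halfplane by (simp add: analytic_on_open)
    then have "\<Phi> analytic_on (\<lambda>w. w + of_nat k) ` {?p}"
      by (rule analytic_on_subset) (use au in \<open>auto simp: halfplane_def\<close>)
    then have "\<Phi> \<circ> (\<lambda>w. w + of_nat k) analytic_on {?p}"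
      by (intro analytic_on_compose) (auto intro!: analytic_intros)
    then show ?thesis unfolding comp_def g_def .
  qed
  ultimately obtain s where "open s" "?p \<in> s" "f holomorphic_on s" "g holomorphic_on s"
    using analytic_at_two by blast
  then obtain r where r: "0 < r" "f holomorphic_on ball ?p r" "g holomorphic_on ball ?p r"
    by (meson holomorphic_on_subset openE)
  obtain v where v: "bf_a \<phi> < ereal v" "v < u" using ereal_dense2[OF au] by (metis less_ereal.simps(1))
  note adm = admissible_of_bf_a[OF v(1)]
  define g' where "g' = of_real d + moment 1 (of_real u)"
  have "(\<Phi> has_field_derivative g') (at (?p + of_nat k))"
    unfolding pk g'_def using DERIV_Phi[OF adm, of "of_real u"] v by simp
  then have g': "(g has_field_derivative g') (at ?p)"
    unfolding g_def by (subst (asm) DERIV_shift)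
  have "0 < d + real_moment 1 u"
    using Phi_slope_pos[OF zero] integrable_real_moment[OF adm v(2), of 1] by simp
  moreover have "g' = of_real (d + real_moment 1 u)" by (simp only: g'_def moment_of_real of_real_add)
  ultimately have g'_nz: "g' \<noteq> 0" by (metis less_irrefl of_real_eq_0_iff)
  have gp: "g ?p = 0" unfolding g_def pk by (rule zero)
  have fp: "f ?p = W \<phi> (1 + of_real u) / (\<Prod>j=1..k. bf_ext \<phi> (of_real (u - real j)))"
    unfolding f_def prod_eq by (simp add: algebra_simps)
  have fp_nz: "f ?p \<noteq> 0"
  proof -
    have "1 + complex_of_real u \<in> halfplane (bf_abar \<phi>)" by (simp add: halfplane_def abar)
    then have "W \<phi> analytic_on {1 + of_real u}"
      using W_holomorphic open_halfplane analytic_at by blast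
    then have "\<not> is_pole (W \<phi>) (1 + of_real u)" by (rule analytic_at_imp_no_pole)
    moreover have "bf_a \<phi> < ereal (1 + u)" using au by (rule less_trans) simp
    then have "1 + of_real u \<in> halfplane (bf_a \<phi>)" by (simp add: halfplane_def)
    ultimately have "W \<phi> (1 + of_real u) \<noteq> 0" using W_pole_iff by blast
    then show ?thesis using prod_nz unfolding fp prod_eq by simp
  qed
  have "eventually (\<lambda>w. W \<phi> w = f w / g w) (nhds ?p)"
    using W_eventually_quotient[OF pH, of "Suc k"]
    by (rule eventually_mono) (simp add: f_def g_def)
  then have ev: "eventually (\<lambda>w. W \<phi> w = f w / g w) (at ?p)"
    by (simp add: eventually_nhds_conv_at)
  have "zorder (W \<phi>) ?p = zorder (\<lambda>w. f w / g w) ?p" by (rule zorder_cong[OF ev refl])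
  also have "\<dots> = -1"
    by (rule porder_simple_pole_deriv[OF r(2,3) _ _ _ g' fp_nz gp g'_nz]) (use r in auto)
  finally show "zorder (W \<phi>) ?p = -1" .
  have "residue (W \<phi>) ?p = residue (\<lambda>w. f w / g w) ?p" by (rule residue_cong[OF ev refl])
  also have "\<dots> = f ?p / g'"
    by (rule residue_simple_pole_deriv[OF r(2,3) _ _ _ g' fp_nz gp g'_nz]) (use r in auto)
  also have "g' = deriv (bf_ext \<phi>) (of_real u)" using deriv_bf_ext(1)[of "of_real u"] au by (simp add: g'_def)
  finally show "residue (W \<phi>) ?p = W \<phi> (1 + of_real u) /
      (deriv (bf_ext \<phi>) (of_real u) * (\<Prod>j=1..k. bf_ext \<phi> (of_real (u - real j))))"
    unfolding fp by (simp add: mult.commute)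
qed

text \<open>The nonreal poles have to be removed, as \<open>\<Phi>\<close> may have nonreal zeros; the rest stays open
  since the poles are isolated.\<close>

lemma open_real_or_not_pole: "open {z \<in> halfplane (bf_a \<phi>). is_pole (W \<phi>) z \<longrightarrow> z \<in> \<real>}"
proof (subst open_subopen, rule ballI)
  fix z assume "z \<in> {z \<in> halfplane (bf_a \<phi>). is_pole (W \<phi>) z \<longrightarrow> z \<in> \<real>}"
  then have z: "z \<in> halfplane (bf_a \<phi>)" "is_pole (W \<phi>) z \<longrightarrow> z \<in> \<real>" by auto
  have "W \<phi> meromorphic_on {z}"
    using W_nicely_meromorphic z(1) meromorphic_on_subset by (auto simp: nicely_meromorphic_on_def)
  then have "eventually (\<lambda>w. \<not> is_pole (W \<phi>) w) (at z)"
    by (intro eventually_not_pole meromorphic_on_isolated_singularity)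
  then have "eventually (\<lambda>w. is_pole (W \<phi>) w \<longrightarrow> w \<in> \<real>) (nhds z)"
    using z(2) by (auto simp: eventually_nhds_conv_at elim: eventually_mono)
  then have "eventually (\<lambda>w. w \<in> {z \<in> halfplane (bf_a \<phi>). is_pole (W \<phi>) z \<longrightarrow> z \<in> \<real>}) (nhds z)"
    using eventually_nhds_in_open[OF open_halfplane z(1)] by eventually_elim simp
  then show "\<exists>T. open T \<and> z \<in> T \<and> T \<subseteq> {z \<in> halfplane (bf_a \<phi>). is_pole (W \<phi>) z \<longrightarrow> z \<in> \<real>}"
    unfolding eventually_nhds by blast
qed

lemma W_real_poles:
  assumes u: "bf_u \<phi> = ereal u" and au: "bf_a \<phi> < ereal u"
  shows "\<exists>U. open U \<and>
          (\<forall>n. bf_N \<phi> = enat n \<longrightarrow> of_real ` {u - real n..1} \<subseteq> U) \<and>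
          (bf_N \<phi> = \<infinity> \<longrightarrow> of_real ` {..1} \<subseteq> U) \<and>
          W \<phi> meromorphic_on U \<and>
          {z\<in>U. is_pole (W \<phi>) z} = {of_real (u - real k) |k. enat k < bf_N \<phi> + 1}"
proof (intro exI conjI allI impI)
  let ?U = "{z \<in> halfplane (bf_a \<phi>). is_pole (W \<phi>) z \<longrightarrow> z \<in> \<real>}"
  show "open ?U" by (rule open_real_or_not_pole)
  have real: "of_real x \<in> ?U \<longleftrightarrow> bf_a \<phi> < ereal x" for x by (simp add: halfplane_def)
  show "of_real ` {u - real n..1} \<subseteq> ?U" if n: "bf_N \<phi> = enat n" for n
  proof -
    have "bf_a \<phi> < ereal (u - real n)"
      using less_bf_N_iff[OF u au, of n] n by (simp add: one_enat_def)
    then have "bf_a \<phi> < ereal x" if "x \<in> {u - real n..1}" for x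
      using that by (auto elim!: less_le_trans)
    then show ?thesis using real by blast
  qed
  show "of_real ` {..1} \<subseteq> ?U" if N: "bf_N \<phi> = \<infinity>"
  proof -
    have "bf_a \<phi> < ereal x" for x
    proof -
      obtain k where "u - x < real k" using reals_Archimedean2 by blast
      then have "ereal (u - real k) \<le> ereal x" by simp
      then show ?thesis using less_bf_N_iff[OF u au, of k] N by (auto elim: less_le_trans)
    qed
    then show ?thesis using real by blast
  qed
  show "W \<phi> meromorphic_on ?U"
    using W_nicely_meromorphic meromorphic_on_subset by (fastforce simp: nicely_meromorphic_on_def)
  show "{z\<in>?U. is_pole (W \<phi>) z} = {of_real (u - real k) |k. enat k < bf_N \<phi> + 1}"
  proof -
    have "z \<in> ?U \<and> is_pole (W \<phi>) z \<longleftrightarrow> (\<exists>k. z = of_real (u - real k) \<and> bf_a \<phi> < ereal (u - real k))" for z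
    proof
      assume z: "z \<in> ?U \<and> is_pole (W \<phi>) z"
      then obtain x where x: "z = of_real x" by (auto elim: Reals_cases)
      then have ax: "bf_a \<phi> < ereal x" using z real by blast
      have "W \<phi> (of_real x) = 0" using z x W_pole_iff by blast
      then show "\<exists>k. z = of_real (u - real k) \<and> bf_a \<phi> < ereal (u - real k)"
        using W_zero_real_iff[OF u au ax] x ax by blast
    next
      assume "\<exists>k. z = of_real (u - real k) \<and> bf_a \<phi> < ereal (u - real k)"
      then obtain k where z: "z = of_real (u - real k)" and k: "bf_a \<phi> < ereal (u - real k)" by blast
      then have "W \<phi> z = 0" using W_zero_real_iff[OF u au k] by blast
      moreover have U: "z \<in> ?U" using real k z by blast
      ultimately show "z \<in> ?U \<and> is_pole (W \<phi>) z" using W_pole_iff by blast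
    qed
    then show ?thesis unfolding less_bf_N_iff[OF u au] by blast
  qed
qed

section \<open>Scaling\<close>

lemma holo_extension_scale:
  "holo_extension f a g \<Longrightarrow> holo_extension (\<lambda>z. c * f z) a (\<lambda>z. c * g z)"
  by (auto simp: holo_extension_def intro!: holomorphic_intros)

context
  fixes c :: real
  assumes c: "0 < c"
begin

abbreviation scaled :: "complex \<Rightarrow> complex" where
  "scaled \<equiv> \<lambda>z. of_real c * \<phi> z"

lemma bf_a_scaled: "bf_a scaled = bf_a \<phi>"
proof -
  have "(\<exists>g. holo_extension scaled a g) \<longleftrightarrow> (\<exists>g. holo_extension \<phi> a g)" for a
  proof
    assume "\<exists>g. holo_extension scaled a g"
    then obtain g where "holo_extension scaled a g" by blast
    from holo_extension_scale[OF this, of "of_real (inverse c)"] c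
    show "\<exists>g. holo_extension \<phi> a g" by (auto simp: mult.assoc[symmetric] simp flip: of_real_mult)
  qed (use holo_extension_scale in blast)
  then show ?thesis unfolding bf_a_def by simp
qed

lemma bf_ext_scaled:
  assumes "bf_a \<phi> < ereal (Re z) \<or> 0 \<le> Re z"
  shows "bf_ext scaled z = of_real c * bf_ext \<phi> z"
proof -
  have ex: "holo_extension scaled (bf_a scaled) (\<lambda>z. of_real c * \<Phi> z)"
    unfolding bf_a_scaled by (rule holo_extension_scale[OF holo_extension_Phi])
  have "holo_extension scaled (bf_a scaled) (bf_cont scaled)"
    unfolding bf_cont_def by (rule someI[where P = "holo_extension scaled (bf_a scaled)", OF ex])
  then have "bf_cont scaled z = of_real c * \<Phi> z"
    by (rule holo_extension_unique[OF _ ex]) (use assms bf_a_le_0 bf_a_scaled in auto)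
  then show ?thesis using assms bf_ext_eq_Phi[OF assms] by (auto simp: bf_ext_def bf_a_scaled)
qed

lemma deriv_scaled: "deriv scaled (of_nat (Suc n)) = of_real c * deriv \<phi> (of_nat (Suc n))"
proof (rule deriv_cmult)
  have "of_nat (Suc n) \<in> {z. 0 < Re z}" by simp
  then show "\<phi> field_differentiable at (of_nat (Suc n))"
    using phi_holomorphic holomorphic_on_imp_differentiable_at open_halfspace_Re_gt[of 0] by blast
qed

lemma log_deriv_scaled:
  "deriv scaled (of_nat (Suc n)) / scaled (of_nat (Suc n)) = deriv \<phi> (of_nat (Suc n)) / \<phi> (of_nat (Suc n))"
  unfolding deriv_scaled using c by simp

text \<open>Logarithmic derivatives do not see the constant \<open>c\<close>; only the subtracted logarithm does.\<close>

lemma bf_gamma_scaled: "bf_gamma scaled = bf_gamma \<phi> - ln c"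
proof -
  let ?g = "\<lambda>n. (\<Sum>k=1..n. Re (deriv scaled (of_nat k) / scaled (of_nat k))) - ln (Re (scaled (of_nat n)))"
  have "eventually (\<lambda>n. gamma_seq n - ln c = ?g n) sequentially"
    using eventually_gt_at_top[of 0]
  proof eventually_elim
    case (elim n)
    have "(\<Sum>k=1..n. Re (deriv scaled (of_nat k) / scaled (of_nat k))) = (\<Sum>k=1..n. Re (deriv \<phi> (of_nat k) / \<phi> (of_nat k)))"
    proof (rule sum.cong[OF refl])
      fix k assume "k \<in> {1..n}"
      then obtain j where "k = Suc j" by (cases k) auto
      then show "Re (deriv scaled (of_nat k) / scaled (of_nat k)) = Re (deriv \<phi> (of_nat k) / \<phi> (of_nat k))"
        using log_deriv_scaled[of j] by simp
    qed
    then show ?case using c phi_of_nat_pos[OF elim] by (simp add: gamma_seq_def ln_mult)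
  qed
  moreover have "(\<lambda>n. gamma_seq n - ln c) \<longlonglongrightarrow> bf_gamma \<phi> - ln c"
    by (intro tendsto_intros gamma_convergent)
  ultimately have "?g \<longlonglongrightarrow> bf_gamma \<phi> - ln c" by (rule Lim_transform_eventually[rotated])
  then show ?thesis unfolding bf_gamma_def[of scaled] by (rule limI)
qed

lemma W_prod_scaled: "W_prod scaled z = of_real c powr (z - 1) * W_prod \<phi> z"
proof -
  have "exp (- of_real (bf_gamma scaled) * z) = exp (z * of_real (ln c)) * exp (- of_real (bf_gamma \<phi>) * z)"
    unfolding bf_gamma_scaled by (simp add: algebra_simps flip: exp_add)
  moreover have "of_real c powr (z - 1) = exp (z * of_real (ln c)) / of_real c"
  proof -
    have "of_real c powr (z - 1) = exp ((z - 1) * of_real (ln c))"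
      using c by (simp add: powr_def Ln_of_real)
    also have "\<dots> = exp (z * of_real (ln c)) / exp (of_real (ln c))"
      by (simp add: left_diff_distrib exp_diff)
    also have "exp (complex_of_real (ln c)) = of_real c" using c by (simp add: exp_of_real)
    finally show ?thesis .
  qed
  moreover have "scaled (of_nat (Suc k)) / scaled (of_nat (Suc k) + z) = \<phi> (of_nat (Suc k)) / \<phi> (of_nat (Suc k) + z)" for k
    using c by simp
  ultimately show ?thesis unfolding W_prod_def log_deriv_scaled by simp
qed

lemma W_scaled:
  assumes "bf_a \<phi> < ereal (Re z) \<or> 0 \<le> Re z"
  shows "W scaled z = of_real c powr (z - 1) * W \<phi> z"
proof -
  obtain m where "0 < Re z + real m" using exists_shift by blast
  then show ?thesis using assms
  proof (induction m arbitrary: z)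
    case 0
    then show ?case using W_prod_scaled by (simp add: W.simps[of _ z])
  next
    case (Suc m)
    show ?case
    proof (cases "0 < Re z")
      case True
      then show ?thesis using W_prod_scaled by (simp add: W.simps[of _ z])
    next
      case False
      have "W scaled (z + 1) = of_real c powr (z + 1 - 1) * W \<phi> (z + 1)"
        by (rule Suc.IH) (use Suc.prems in \<open>auto intro: less_le_trans\<close>)
      moreover have "complex_of_real c powr (z + 1 - 1) = of_real c powr (z - 1) * of_real c"
        using powr_add[of "of_real c" "z - 1" 1] c by simp
      ultimately show ?thesis
        using False c bf_ext_scaled[OF Suc.prems(2)] by (simp add: W.simps[of _ z])
    qed
  qed
qed

end

end

theorem theorem4p1:
  fixes \<phi> :: "complex \<Rightarrow> complex" and d :: real and \<mu> :: "real measure"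
  assumes "bernstein \<phi> d \<mu>"
  shows
   "\<comment> \<open>(1)\<close>
    ((W \<phi> holomorphic_on halfplane (bf_abar \<phi>) \<and>
      W \<phi> nicely_meromorphic_on halfplane (bf_a \<phi>) \<and>
      (\<forall>z\<in>halfplane (bf_a \<phi>). \<not> is_pole (W \<phi>) z \<longrightarrow> W \<phi> z \<noteq> 0) \<and>
      (0 < Re (\<phi> 0) \<longrightarrow>
         holo_cont_ext (W \<phi>) 0 \<and>
         continuous_on {z. 0 \<le> Re z} (W \<phi>) \<and> (\<forall>z. 0 \<le> Re z \<longrightarrow> W \<phi> z \<noteq> 0)) \<and>
      (\<phi> 0 = 0 \<longrightarrow>
         extends_continuously (W \<phi>) (halfplane 0) (vline 0 - bf_zeros 0 \<phi>)) \<and>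
      (\<phi> 0 = 0 \<and> right_lim (deriv (bf_ext \<phi>)) 0 < \<infinity> \<longrightarrow>
         extends_continuously (\<lambda>z. z * W \<phi> z) (halfplane 0) ((vline 0 - bf_zeros 0 \<phi>) \<union> {0})) \<and>
      (\<forall>\<zeta>\<in>bf_zeros 0 \<phi>.
         ((\<lambda>z. \<phi> z * W \<phi> z) \<longlongrightarrow> W \<phi> (\<zeta> + 1)) (at \<zeta> within {z. 0 \<le> Re z})) \<and>
      (\<phi> 0 = 0 \<and> \<bar>right_lim ((deriv ^^ 2) (bf_ext \<phi>)) 0\<bar> < \<infinity> \<longrightarrow>
         extends_continuously
           (\<lambda>z. W \<phi> z - 1 / (of_real (real_of_ereal (right_lim (deriv (bf_ext \<phi>)) 0)) * z))
           (halfplane 0) ((vline 0 - bf_zeros 0 \<phi>) \<union> {0})))) \<and>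
    \<comment> \<open>(2)\<close>
    (((\<exists>\<zeta>\<in>bf_zeros 0 \<phi>. \<zeta> \<noteq> 0) \<longleftrightarrow>
        \<phi> 0 = 0 \<and> d = 0 \<and> (\<exists>h c k. lattice_measure \<mu> h c k)) \<and>
     (\<forall>h c k. \<phi> 0 = 0 \<and> d = 0 \<and> lattice_measure \<mu> h c k \<longrightarrow>
        (\<forall>z\<in>halfplane 0.
           exp (- (z + 2 * of_real pi * \<i> / of_real h) *
                  of_real (ln (real_of_ereal (phi_infinity \<phi>)))) *
             W \<phi> (z + 2 * of_real pi * \<i> / of_real h) =
           exp (- z * of_real (ln (real_of_ereal (phi_infinity \<phi>)))) * W \<phi> z \<and>
           cmod (W \<phi> (z + 2 * of_real pi * \<i> / of_real h)) = cmod (W \<phi> z)))) \<and>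
    \<comment> \<open>(3)\<close>
    (\<forall>u::real. bf_u \<phi> = ereal u \<and> u < 0 \<longrightarrow>
       (bf_a \<phi> < bf_u \<phi> \<longrightarrow> \<bar>right_lim ((deriv ^^ 2) (bf_ext \<phi>)) u\<bar> < \<infinity>) \<and>
       (bf_zeros u \<phi> = {of_real u} \<and> \<bar>right_lim ((deriv ^^ 2) (bf_ext \<phi>)) u\<bar> < \<infinity> \<longrightarrow>
          holo_cont_ext
            (\<lambda>z. W \<phi> z - W \<phi> (1 + of_real u) /
                   (of_real (real_of_ereal (right_lim (deriv (bf_ext \<phi>)) u)) * (z - of_real u))) u \<and>
          right_lim (deriv (bf_ext \<phi>)) u =
            ereal d + enn2ereal (\<integral>\<^sup>+ y. ennreal (y * exp (- u * y)) \<partial>\<mu>) \<and>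
          0 < right_lim (deriv (bf_ext \<phi>)) u \<and> right_lim (deriv (bf_ext \<phi>)) u < \<infinity>)) \<and>
    \<comment> \<open>(4)\<close>
    (\<forall>u::real. bf_u \<phi> = ereal u \<and> bf_a \<phi> < bf_u \<phi> \<and> bf_u \<phi> \<le> 0 \<longrightarrow>
       (\<exists>U. open U \<and>
          (\<forall>n. bf_N \<phi> = enat n \<longrightarrow> of_real ` {u - real n..1} \<subseteq> U) \<and>
          (bf_N \<phi> = \<infinity> \<longrightarrow> of_real ` {..1} \<subseteq> U) \<and>
          W \<phi> meromorphic_on U \<and>
          {z\<in>U. is_pole (W \<phi>) z} = {of_real (u - real k) |k. enat k < bf_N \<phi> + 1} \<and>
          (\<forall>k. enat k < bf_N \<phi> + 1 \<longrightarrow>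
             zorder (W \<phi>) (of_real (u - real k)) = -1 \<and>
             residue (W \<phi>) (of_real (u - real k)) =
               W \<phi> (1 + of_real u) /
               (deriv (bf_ext \<phi>) (of_real u) * (\<Prod>j=1..k. bf_ext \<phi> (of_real (u - real j))))))) \<and>
    \<comment> \<open>(5)\<close>
    (\<forall>c::real. 0 < c \<longrightarrow>
       (\<forall>z. bf_a \<phi> < ereal (Re z) \<or> 0 \<le> Re z \<longrightarrow>
          W (\<lambda>z. of_real c * \<phi> z) z = of_real c powr (z - 1) * W \<phi> z))"
proof -
  interpret bernstein_function \<phi> d \<mu> by (rule bernstein_function.intro) fact
  show ?thesis
    apply (intro conjI)
    subgoal by (rule W_holomorphic)
    subgoal by (rule W_nicely_meromorphic)
    subgoal using W_pole_iff by blast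
    subgoal using W_killing by blast
    subgoal using W_extends by blast
    subgoal using z_W_extends by blast
    subgoal using phi_W_tendsto by blast
    subgoal using W_minus_pole_at_0_extends by blast
    subgoal by (rule nonzero_axis_zero_iff)
    subgoal using W_periodic by blast
    subgoal
    proof (intro allI impI, elim conjE, goal_cases)
      case (1 u)
      note u = 1(1)
      show ?case
        unfolding u
        using second_deriv_finite[of u] W_minus_pole_at_u[OF u] right_lim_deriv[OF bf_u_attained(1)[OF u]]
        by blast
    qed
    subgoal
    proof (intro allI impI, elim conjE, goal_cases)
      case (1 u)
      then have u: "bf_u \<phi> = ereal u" "bf_a \<phi> < ereal u" by simp_all
      note poles = W_simple_pole[OF u, folded less_bf_N_iff[OF u]]
      from W_real_poles[OF u] show ?case
        by (elim exE conjE, intro exI conjI)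
           (assumption | intro allI impI conjI poles)+
    qed
    subgoal using W_scaled by blast
    done
qed

end
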